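(* For every $\varepsilon>0$ there is a number field $K$ and an elliptic curve $E/K$ with $j$-invariant $0$ such that \[ h_{\min}<h(E/K)<h_{\min}+\varepsilon. \]
   Context: For $\tau\in\mathbb{H}$ put $q=e^{2\pi i\tau}$, $\Delta(\tau)=(2\pi)^{12}q\prod_{n\ge1}(1-q^n)^{24}$, and let $j$ be the modular $j$-function. For an elliptic curve $E$ over a number field $K$ with $j$-invariant $j_E$, let $\Delta_{E/K}$ be its minimal discriminant ideal and for each embedding $\sigma:K\hookrightarrow\mathbb{C}$ choose $\tau_\sigma\in\mathbb{H}$ with $j(\tau_\sigma)=\sigma(j_E)$. The Faltings height is \[ h(E/K)=\frac{1}{12[K:\mathbb{Q}]}\Big(\log|N_{K/\mathbb{Q}}(\Delta_{E/K})|-\sum_{\sigma}\log\big(|\Delta(\tau_\sigma)|(\operatorname{Im}\tau_\sigma)^6\big)\Big)+\tfrac12\log\pi. \] Set $h_{\min}=-\tfrac12\log\big(\tfrac{1}{\sqrt3}(\Gamma(1/3)/\Gamma(2/3))^3\big)=-0.74875248\dots$. *)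

theory Defs
  imports
    "HOL-Analysis.Analysis"
    "HOL-Algebra.Ideal_Product"
    "HOL-Algebra.Algebraic_Closure_Type"
begin

section \<open>Number fields\<close>

abbreviation complex_ring :: "complex ring"
  where "complex_ring \<equiv> ring_of_type_algebra"

abbreviation complex_subring :: "complex set \<Rightarrow> complex ring"
  where "complex_subring S \<equiv> complex_ring \<lparr>carrier := S\<rparr>"

text \<open>
  Number fields are realised as subfields of the complex numbers of finite degree over the
  rationals. Every number field is isomorphic to one of these, and all notions below are
  invariant under isomorphism; the given inclusion into the complex numbers plays no special
  role (it is just one of the embeddings).
\<close>

definition number_field :: "complex set \<Rightarrow> bool"
  where "number_field K \<longleftrightarrow>
    subfield K complex_ring \<and> ring.finite_dimension complex_ring \<rat> K"

definition field_degree :: "complex set \<Rightarrow> nat"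
  where "field_degree K = ring.dim complex_ring \<rat> K"

text \<open>Extensionality makes distinct elements of this set distinct as maps on \<open>K\<close>.\<close>

definition embeddings :: "complex set \<Rightarrow> (complex \<Rightarrow> complex) set"
  where "embeddings K = ring_hom (complex_subring K) complex_ring \<inter> extensional K"

definition ring_of_integers :: "complex set \<Rightarrow> complex ring"
  where "ring_of_integers K = complex_subring {x \<in> K. algebraic_int x}"

abbreviation ideal_pow :: "complex set \<Rightarrow> complex set \<Rightarrow> nat \<Rightarrow> complex set"
  where "ideal_pow K I n \<equiv> I [^]\<^bsub>ideals_set (ring_of_integers K)\<^esub> n"

definition ideal_norm :: "complex set \<Rightarrow> complex set \<Rightarrow> nat"
  where "ideal_norm K I = card (carrier (ring_of_integers K Quot I))"

definition nonzero_primes :: "complex set \<Rightarrow> complex set set"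
  where "nonzero_primes K = {P. primeideal P (ring_of_integers K) \<and> P \<noteq> {0}}"

text \<open>The \<open>P\<close>-adic valuation, first on nonzero integers of \<open>K\<close>, then on nonzero elements of \<open>K\<close>.\<close>

definition prime_ord :: "complex set \<Rightarrow> complex set \<Rightarrow> complex \<Rightarrow> nat"
  where "prime_ord K P a = (GREATEST n. a \<in> ideal_pow K P n)"

definition prime_val :: "complex set \<Rightarrow> complex set \<Rightarrow> complex \<Rightarrow> int"
  where "prime_val K P x = (THE k. \<exists>a b. a \<in> carrier (ring_of_integers K) - {0} \<and>
    b \<in> carrier (ring_of_integers K) - {0} \<and> x = a / b \<and>
    k = int (prime_ord K P a) - int (prime_ord K P b))"

definition integral_at :: "complex set \<Rightarrow> complex set \<Rightarrow> complex \<Rightarrow> bool"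
  where "integral_at K P x \<longleftrightarrow> x = 0 \<or> prime_val K P x \<ge> 0"


section \<open>Elliptic curves\<close>

text \<open>The Weierstrass equation \<open>y\<^sup>2 + a1 x y + a3 y = x\<^sup>3 + a2 x\<^sup>2 + a4 x + a6\<close>.\<close>

datatype weierstrass =
  Weierstrass (a1: complex) (a2: complex) (a3: complex) (a4: complex) (a6: complex)

definition coeffs_in :: "complex set \<Rightarrow> weierstrass \<Rightarrow> bool"
  where "coeffs_in S W \<longleftrightarrow> {a1 W, a2 W, a3 W, a4 W, a6 W} \<subseteq> S"

definition b2 :: "weierstrass \<Rightarrow> complex"
  where "b2 W = (a1 W)\<^sup>2 + 4 * a2 W"

definition b4 :: "weierstrass \<Rightarrow> complex"
  where "b4 W = 2 * a4 W + a1 W * a3 W"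

definition b6 :: "weierstrass \<Rightarrow> complex"
  where "b6 W = (a3 W)\<^sup>2 + 4 * a6 W"

definition b8 :: "weierstrass \<Rightarrow> complex"
  where "b8 W = (a1 W)\<^sup>2 * a6 W + 4 * a2 W * a6 W - a1 W * a3 W * a4 W
    + a2 W * (a3 W)\<^sup>2 - (a4 W)\<^sup>2"

definition c4 :: "weierstrass \<Rightarrow> complex"
  where "c4 W = (b2 W)\<^sup>2 - 24 * b4 W"

definition discriminant :: "weierstrass \<Rightarrow> complex"
  where "discriminant W = - (b2 W)\<^sup>2 * b8 W - 8 * b4 W ^ 3 - 27 * (b6 W)\<^sup>2
    + 9 * b2 W * b4 W * b6 W"

definition j_invariant :: "weierstrass \<Rightarrow> complex"
  where "j_invariant W = c4 W ^ 3 / discriminant W"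

definition elliptic_curve :: "complex set \<Rightarrow> weierstrass \<Rightarrow> bool"
  where "elliptic_curve K E \<longleftrightarrow> coeffs_in K E \<and> discriminant E \<noteq> 0"

text \<open>The equation obtained by substituting \<open>x = u\<^sup>2 x' + r\<close> and \<open>y = u\<^sup>3 y' + u\<^sup>2 s x' + t\<close>.\<close>

definition change_vars ::
    "complex \<Rightarrow> complex \<Rightarrow> complex \<Rightarrow> complex \<Rightarrow> weierstrass \<Rightarrow> weierstrass"
  where "change_vars u r s t W = Weierstrass
    ((a1 W + 2 * s) / u)
    ((a2 W - s * a1 W + 3 * r - s\<^sup>2) / u ^ 2)
    ((a3 W + r * a1 W + 2 * t) / u ^ 3)
    ((a4 W - s * a3 W + 2 * r * a2 W - (t + r * s) * a1 W + 3 * r\<^sup>2 - 2 * s * t) / u ^ 4)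
    ((a6 W + r * a4 W + r\<^sup>2 * a2 W + r ^ 3 - t * a3 W - t\<^sup>2 - r * t * a1 W) / u ^ 6)"

definition isomorphic_over :: "complex set \<Rightarrow> weierstrass \<Rightarrow> weierstrass \<Rightarrow> bool"
  where "isomorphic_over K W W' \<longleftrightarrow>
    (\<exists>u\<in>K - {0}. \<exists>r\<in>K. \<exists>s\<in>K. \<exists>t\<in>K. W' = change_vars u r s t W)"

text \<open>The valuation at \<open>P\<close> of the discriminant of a Weierstrass equation minimal at \<open>P\<close>.\<close>

definition min_disc_ord :: "complex set \<Rightarrow> weierstrass \<Rightarrow> complex set \<Rightarrow> nat"
  where "min_disc_ord K E P = (LEAST n. \<exists>W. isomorphic_over K E W \<and>
    coeffs_in {x \<in> K. integral_at K P x} W \<and> prime_val K P (discriminant W) = int n)"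

text \<open>
  Only finitely many primes have a nonzero exponent; the product is restricted to these
  because \<^const>\<open>finprod\<close> over an infinite index set is the unit ideal.
\<close>

definition min_disc_ideal :: "complex set \<Rightarrow> weierstrass \<Rightarrow> complex set"
  where "min_disc_ideal K E =
    finprod (ideals_set (ring_of_integers K)) (\<lambda>P. ideal_pow K P (min_disc_ord K E P))
      {P \<in> nonzero_primes K. min_disc_ord K E P \<noteq> 0}"


section \<open>Modular functions\<close>

definition modular_discriminant :: "complex \<Rightarrow> complex"
  where "modular_discriminant \<tau> = (let q = exp (2 * of_real pi * \<i> * \<tau>) in
    (2 * of_real pi) ^ 12 * q * prodinf (\<lambda>n. (1 - q ^ Suc n) ^ 24))"

definition g2 :: "complex \<Rightarrow> complex"
  where "g2 \<tau> = 60 * (\<Sum>\<^sub>\<infinity>(m, n)\<in>UNIV - {(0, 0)}. 1 / (of_int m + of_int n * \<tau>) ^ 4)"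

text \<open>
  The factor \<open>(2\<pi>)\<^sup>1\<^sup>2\<close> in \<^const>\<open>modular_discriminant\<close> is the one for which it is the discriminant
  of the lattice spanned by 1 and \<open>\<tau>\<close>, so the classical formula for \<open>j\<close> applies without further
  normalisation.
\<close>

definition modular_j :: "complex \<Rightarrow> complex"
  where "modular_j \<tau> = 1728 * g2 \<tau> ^ 3 / modular_discriminant \<tau>"


section \<open>The Faltings height\<close>

text \<open>
  The value of \<open>\<bar>\<Delta>(\<tau>)\<bar> (Im \<tau>)\<^sup>6\<close> does not depend on the choice of \<open>\<tau>\<close>, since it is invariant under
  the modular group.
\<close>

definition tau_of :: "complex \<Rightarrow> complex"
  where "tau_of z = (SOME \<tau>. Im \<tau> > 0 \<and> modular_j \<tau> = z)"

definition faltings_height :: "complex set \<Rightarrow> weierstrass \<Rightarrow> real"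
  where "faltings_height K E =
    1 / (12 * real (field_degree K)) *
      (ln (real (ideal_norm K (min_disc_ideal K E))) -
       (\<Sum>\<sigma>\<in>embeddings K. let \<tau> = tau_of (\<sigma> (j_invariant E)) in
          ln (cmod (modular_discriminant \<tau>) * Im \<tau> ^ 6)))
    + 1 / 2 * ln pi"

definition h_min :: real
  where "h_min = - (1 / 2) * ln (1 / sqrt 3 * (Gamma (1 / 3) / Gamma (2 / 3)) ^ 3)"

end

theory Submission
  imports Defs "Jordan_Normal_Form.Char_Poly" "HOL-Complex_Analysis.Complex_Analysis"
begin

text \<open>
  Let \<open>c\<^sup>3 = 2\<close> and \<open>\<alpha>\<^sup>m = 1 + c\<close> with \<open>m \<equiv> 3\<close> modulo \<open>4\<close>. Since \<open>(1 + c)\<^sup>3 = 3 (1 + c + c\<^sup>2)\<close> and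
  \<open>(c - 1) (1 + c + c\<^sup>2) = 1\<close>, the number \<open>\<alpha>\<^sup>n\<close> with \<open>n = 3 m\<close> is \<open>3\<close> times a unit, so that \<open>3\<close> is totally
  ramified in \<open>K = \<rat>(\<alpha>)\<close>, a field of degree \<open>n \<equiv> 1\<close> modulo \<open>4\<close>. The curve \<open>y\<^sup>2 + y = x\<^sup>3\<close> has
  discriminant \<open>-27\<close>, of valuation \<open>3 n\<close> at the prime \<open>P = (\<alpha>)\<close>. Coordinate changes alter this by
  multiples of \<open>12\<close>, so it stays odd, and the substitution \<open>x \<mapsto> \<alpha>\<^sup>2\<^sup>k x + c\<close>, \<open>y \<mapsto> \<alpha>\<^sup>3\<^sup>k y + 1\<close> with
  \<open>n = 4 k + 1\<close> reduces it to \<open>3\<close>. Hence the minimal discriminant is a nontrivial divisor of \<open>P\<^sup>3\<close>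
  and contributes to the height a positive term that is at most \<open>ln 27 / (12 n)\<close>.

  It remains to evaluate \<open>\<bar>\<Delta>(\<tau>)\<bar> (Im \<tau>)\<^sup>6\<close> for an arbitrary \<open>\<tau>\<close> with \<open>j(\<tau>) = 0\<close>. If \<open>g\<^sub>2 = 0\<close>, then
  \<open>\<wp>(z) = \<rho>\<^sup>2 \<wp>(\<rho> z)\<close> for a primitive cube root of unity \<open>\<rho>\<close>, so the lattice is homothetic to \<open>\<int>[\<rho>]\<close>.
  Theta quotients for \<open>\<wp>(z) - \<wp>(u)\<close> at the half periods express \<open>\<Delta>\<close> by \<open>g\<^sub>3\<close>. For \<open>\<int>[\<rho>]\<close>, the
  differential equation of \<open>\<wp>\<close> along the imaginary axis, from the pole at \<open>0\<close> to the zero at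
  \<open>\<i> / \<surd>3\<close>, gives \<open>g\<^sub>3\<close> as a power of \<open>B(1/6, 1/3)\<close>.
\<close>

section \<open>Algebraic integers\<close>

hide_const (open) Polynomials.lead_coeff Polynomials.degree

text \<open>The strict lower bound shapes the arithmetic: good reduction everywhere would give
  exactly \<open>h_min\<close>, so some prime must contribute, but boundedly while the degree grows.
  Hence one totally ramified prime, whose residue field keeps 3 elements, and a model of
  discriminant valuation 3n - 12k = 3 for n = 4k + 1. A cube root of 2 is adjoined because a shift
  by r and t gives \<open>a6\<close> the numerator r^3 - t - t^2, which vanishes for r = c and t =
  1, while the other numerators become multiples of 3. The ring of integers is not determined; what
  is extracted from \<alpha>^n being 3 times a unit is that every integer of K is 0, 1 or 2 modulo
  \<alpha>. On the analytic side \<open>tau_of 0\<close> is an arbitrary choice, so the value is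
  needed at every zero of j. Comparing lattices treats all zeros at once, since the square of the
  modulus of \<open>G 6\<close> times the sixth power of Im \<tau> is invariant under homothety. The
  second obstacle is that \<Delta> is given as a product, whereas a period determines
  \<open>G 6\<close>; the values of the Weierstrass function at the half periods connect the
  two.\<close>

definition int_span :: "complex set \<Rightarrow> complex set"
  where "int_span S = {\<Sum>s\<in>S. of_int (a s) * s | a. True}"

lemma int_span_0: "0 \<in> int_span S"
  unfolding int_span_def by (rule CollectI, rule exI[of _ "\<lambda>_. 0"]) auto

lemma int_span_base:
  assumes "finite S" "s \<in> S"
  shows "s \<in> int_span S"
proof -
  have "(\<Sum>t\<in>S. of_int (if t = s then 1 else 0) * t) = (\<Sum>t\<in>S. if t = s then t else 0)"
    by (intro sum.cong) auto
  also have "\<dots> = s" using assms by (simp add: sum.delta)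
  finally show ?thesis unfolding int_span_def
    by (intro CollectI exI[of _ "\<lambda>t. if t = s then 1 else 0"]) auto
qed

lemma int_span_add:
  assumes "x \<in> int_span S" "y \<in> int_span S"
  shows "x + y \<in> int_span S"
proof -
  obtain a b where "x = (\<Sum>s\<in>S. of_int (a s) * s)" "y = (\<Sum>s\<in>S. of_int (b s) * s)"
    using assms by (auto simp: int_span_def)
  then have "x + y = (\<Sum>s\<in>S. of_int (a s + b s) * s)"
    by (simp add: sum.distrib algebra_simps)
  then show ?thesis unfolding int_span_def by (intro CollectI exI[of _ "\<lambda>s. a s + b s"]) auto
qed

lemma int_span_of_int_mult:
  assumes "x \<in> int_span S"
  shows "of_int k * x \<in> int_span S"
proof -
  obtain a where "x = (\<Sum>s\<in>S. of_int (a s) * s)"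
    using assms by (auto simp: int_span_def)
  then have "of_int k * x = (\<Sum>s\<in>S. of_int (k * a s) * s)"
    by (simp add: sum_distrib_left algebra_simps)
  then show ?thesis unfolding int_span_def by (intro CollectI exI[of _ "\<lambda>s. k * a s"]) auto
qed

lemma int_span_sum: "(\<And>i. i \<in> A \<Longrightarrow> f i \<in> int_span S) \<Longrightarrow> sum f A \<in> int_span S"
  by (induction A rule: infinite_finite_induct) (auto simp: int_span_0 int_span_add)

lemma int_span_mult_closed:
  assumes "\<And>s. s \<in> S \<Longrightarrow> x * s \<in> int_span S" "y \<in> int_span S"
  shows "x * y \<in> int_span S"
proof -
  obtain a where "y = (\<Sum>s\<in>S. of_int (a s) * s)"
    using assms by (auto simp: int_span_def)
  then have "x * y = (\<Sum>s\<in>S. of_int (a s) * (x * s))"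
    by (simp add: sum_distrib_left algebra_simps)
  then show ?thesis
    by (simp only:) (intro int_span_sum int_span_of_int_mult assms)
qed

text \<open>The action of \<open>x\<close> on a finite generating set is an integer matrix with eigenvalue \<open>x\<close>.\<close>

lemma algebraic_int_if_int_span_closed:
  assumes "finite S" "s\<^sub>0 \<in> S" "s\<^sub>0 \<noteq> 0" and cl: "\<And>s. s \<in> S \<Longrightarrow> x * s \<in> int_span S"
  shows "algebraic_int x"
proof -
  define n where "n = card S"
  obtain e where e: "bij_betw e {0..<n} S"
    using ex_bij_betw_nat_finite[OF assms(1)] n_def by blast
  have "\<exists>a. \<forall>s\<in>S. x * s = (\<Sum>t\<in>S. of_int (a s t) * t)"
    using cl unfolding int_span_def by (intro bchoice) auto
  then obtain a :: "complex \<Rightarrow> complex \<Rightarrow> int"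
    where a: "\<And>s. s \<in> S \<Longrightarrow> x * s = (\<Sum>t\<in>S. of_int (a s t) * t)" by blast
  define A where "A = mat n n (\<lambda>(i, j). a (e i) (e j))"
  define B where "B = map_mat (of_int :: int \<Rightarrow> complex) A"
  define v where "v = vec n e"
  have A: "A \<in> carrier_mat n n" by (simp add: A_def)
  have B: "B \<in> carrier_mat n n" by (simp add: B_def A_def)
  have v: "v \<in> carrier_vec n" by (simp add: v_def)
  have "B *\<^sub>v v = x \<cdot>\<^sub>v v"
  proof (rule eq_vecI)
    fix i assume "i < dim_vec (x \<cdot>\<^sub>v v)"
    then have i: "i < n" by (simp add: v_def)
    then have "e i \<in> S" using e by (auto simp: bij_betw_def)
    have "(B *\<^sub>v v) $ i = (\<Sum>j\<in>{0..<n}. of_int (a (e i) (e j)) * e j)"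
      using i by (simp add: B_def A_def v_def scalar_prod_def)
    also have "\<dots> = (\<Sum>t\<in>S. of_int (a (e i) t) * t)"
      by (rule sum.reindex_bij_betw[OF e])
    also have "\<dots> = x * e i" using a[OF \<open>e i \<in> S\<close>] by simp
    finally show "(B *\<^sub>v v) $ i = (x \<cdot>\<^sub>v v) $ i" using i by (simp add: v_def)
  qed (simp add: B_def A_def v_def)
  moreover have "v \<noteq> 0\<^sub>v n"
  proof
    assume "v = 0\<^sub>v n"
    obtain i where "i < n" "e i = s\<^sub>0" using assms(2) e by (auto simp: bij_betw_def)
    then have "v $ i = s\<^sub>0" by (simp add: v_def)
    with \<open>v = 0\<^sub>v n\<close> \<open>i < n\<close> assms(3) show False by simp
  qed
  ultimately have "eigenvalue B x"
    unfolding eigenvalue_def eigenvector_def using v B by auto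
  then have "poly (char_poly B) x = 0" using eigenvalue_root_char_poly[OF B] by simp
  moreover have "char_poly B = map_poly of_int (char_poly A)"
    unfolding B_def by (rule of_int_hom.char_poly_hom[OF A])
  moreover have "lead_coeff (char_poly A) = 1"
    using degree_monic_char_poly[OF A] by simp
  ultimately show ?thesis
    unfolding algebraic_int_altdef_ipoly by (intro exI[of _ "char_poly A"]) auto
qed

lemma algebraic_int_monic_relation:
  assumes "algebraic_int (x :: complex)"
  obtains d and a :: "nat \<Rightarrow> int" where "d > 0" "x ^ d = (\<Sum>i<d. of_int (a i) * x ^ i)"
proof -
  obtain p where p: "poly (map_poly of_int p) x = 0" "lead_coeff p = 1"
    using assms unfolding algebraic_int_altdef_ipoly by auto
  define d where "d = degree p"
  have "0 = (\<Sum>i\<le>d. of_int (Polynomial.coeff p i) * x ^ i)"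
    using p by (simp add: poly_altdef d_def Polynomial.coeff_map_poly)
  also have "\<dots> = x ^ d + (\<Sum>i<d. of_int (Polynomial.coeff p i) * x ^ i)"
    using p(2) by (simp add: d_def lessThan_Suc_atMost[symmetric])
  finally have *: "x ^ d = (\<Sum>i<d. of_int (- Polynomial.coeff p i) * x ^ i)"
    by (simp add: sum_negf eq_neg_iff_add_eq_0)
  have "d \<noteq> 0"
  proof
    assume d0: "d = 0"
    show False using *[unfolded d0] by simp
  qed
  then show ?thesis using that[OF _ *] by simp
qed

text \<open>The monomials \<open>x ^ i * y ^ j\<close> below the degrees of the two monic relations
  span a group stable under both multiplications, since a monic relation rewrites the top power. One
  common set serves sum and product alike, and \<open>1 \<in> S\<close> supplies the nonzero
  generator for the eigenvector argument.\<close>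

lemma algebraic_int_pair:
  assumes "algebraic_int (x :: complex)" "algebraic_int y"
  shows "\<exists>S. finite S \<and> 1 \<in> S \<and> (\<forall>s\<in>S. x * s \<in> int_span S \<and> y * s \<in> int_span S)"
proof -
  obtain d a where d: "d > 0" "x ^ d = (\<Sum>i<d. of_int (a i) * x ^ i)"
    using algebraic_int_monic_relation[OF assms(1)] by metis
  obtain e b where e: "e > 0" "y ^ e = (\<Sum>i<e. of_int (b i) * y ^ i)"
    using algebraic_int_monic_relation[OF assms(2)] by metis
  define S where "S = (\<lambda>(i, j). x ^ i * y ^ j) ` ({..<d} \<times> {..<e})"
  have fin: "finite S" by (simp add: S_def)
  have S: "x ^ i * y ^ j \<in> int_span S" if "i < d" "j < e" for i j
    using that by (intro int_span_base fin) (auto simp: S_def)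
  have X: "x * s \<in> int_span S" if "s \<in> S" for s
  proof -
    obtain i j where ij: "s = x ^ i * y ^ j" "i < d" "j < e" using \<open>s \<in> S\<close> by (auto simp: S_def)
    show ?thesis
    proof (cases "Suc i < d")
      case True
      then show ?thesis using S[of "Suc i" j] ij by (simp add: mult.assoc)
    next
      case False
      with ij have "d = Suc i" by simp
      then have "x * s = x ^ d * y ^ j" by (simp add: ij)
      also have "\<dots> = (\<Sum>i<d. of_int (a i) * (x ^ i * y ^ j))"
        by (subst d) (simp add: sum_distrib_right mult.assoc)
      also have "\<dots> \<in> int_span S"
        using ij by (intro int_span_sum int_span_of_int_mult S) auto
      finally show ?thesis .
    qed
  qed
  have Y: "y * s \<in> int_span S" if "s \<in> S" for s
  proof -
    obtain i j where ij: "s = x ^ i * y ^ j" "i < d" "j < e" using \<open>s \<in> S\<close> by (auto simp: S_def)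
    show ?thesis
    proof (cases "Suc j < e")
      case True
      then show ?thesis using S[of i "Suc j"] ij by (simp add: mult_ac)
    next
      case False
      with ij have "e = Suc j" by simp
      then have "y * s = y ^ e * x ^ i" by (simp add: ij)
      also have "\<dots> = (\<Sum>j<e. of_int (b j) * (x ^ i * y ^ j))"
        by (subst e) (simp add: sum_distrib_left mult_ac)
      also have "\<dots> \<in> int_span S"
        using ij by (intro int_span_sum int_span_of_int_mult S) auto
      finally show ?thesis .
    qed
  qed
  have "1 \<in> S" unfolding S_def by (rule image_eqI[of _ _ "(0, 0)"]) (simp_all add: d(1) e(1))
  then show ?thesis using fin X Y by (intro exI[of _ S] conjI ballI)
qed

lemma algebraic_int_add:
  assumes "algebraic_int (x :: complex)" "algebraic_int y"
  shows "algebraic_int (x + y)"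
proof -
  obtain S where S: "finite S" "1 \<in> S" "\<And>s. s \<in> S \<Longrightarrow> x * s \<in> int_span S"
    "\<And>s. s \<in> S \<Longrightarrow> y * s \<in> int_span S"
    using algebraic_int_pair[OF assms] by auto
  show ?thesis
  proof (rule algebraic_int_if_int_span_closed[OF S(1,2)])
    show "(x + y) * s \<in> int_span S" if "s \<in> S" for s
      unfolding distrib_right by (intro int_span_add S(3,4)[OF that])
  qed simp
qed

lemma algebraic_int_mult:
  assumes "algebraic_int (x :: complex)" "algebraic_int y"
  shows "algebraic_int (x * y)"
proof -
  obtain S where S: "finite S" "1 \<in> S" "\<And>s. s \<in> S \<Longrightarrow> x * s \<in> int_span S"
    "\<And>s. s \<in> S \<Longrightarrow> y * s \<in> int_span S"
    using algebraic_int_pair[OF assms] by auto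
  show ?thesis
  proof (rule algebraic_int_if_int_span_closed[OF S(1,2)])
    show "x * y * s \<in> int_span S" if "s \<in> S" for s
      unfolding mult.assoc by (rule int_span_mult_closed[OF S(3) S(4)[OF that]])
  qed simp
qed

lemma algebraic_int_diff:
  assumes "algebraic_int (x :: complex)" "algebraic_int y"
  shows "algebraic_int (x - y)"
  using algebraic_int_add[of x "- y"] assms by (simp add: algebraic_int_minus)

lemma algebraic_int_power: "algebraic_int (x :: complex) \<Longrightarrow> algebraic_int (x ^ n)"
  by (induction n) (auto intro: algebraic_int_mult)

lemma algebraic_int_sum:
  "(\<And>i. i \<in> A \<Longrightarrow> algebraic_int (f i :: complex)) \<Longrightarrow> algebraic_int (sum f A)"
  by (induction A rule: infinite_finite_induct) (auto intro: algebraic_int_add)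

lemma algebraic_int_of_int [simp, intro]: "algebraic_int (of_int k :: complex)"
  by (intro int_imp_algebraic_int) auto

lemma algebraic_int_numeral [simp, intro]: "algebraic_int (numeral k :: complex)"
  by (intro int_imp_algebraic_int) auto

section \<open>A totally ramified tower\<close>

definition rat_poly_eval :: "rat poly \<Rightarrow> complex \<Rightarrow> complex"
  where "rat_poly_eval p x = poly (map_poly of_rat p) x"

lemma rat_poly_eval_pCons: "rat_poly_eval (pCons a p) x = of_rat a + x * rat_poly_eval p x"
proof -
  have "map_poly complex_of_rat (pCons a p) = pCons (of_rat a) (map_poly of_rat p)"
    by (intro poly_eqI) (simp add: Polynomial.coeff_map_poly coeff_pCons split: nat.split)
  then show ?thesis by (simp add: rat_poly_eval_def)
qed

lemma rat_poly_eval_0 [simp]: "rat_poly_eval 0 x = 0"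
  by (simp add: rat_poly_eval_def)

lemma rat_poly_eval_1 [simp]: "rat_poly_eval 1 x = 1"
  by (simp add: one_pCons rat_poly_eval_pCons)

lemma rat_poly_eval_add: "rat_poly_eval (p + q) x = rat_poly_eval p x + rat_poly_eval q x"
  by (induction p q rule: poly_induct2) (simp_all add: rat_poly_eval_pCons of_rat_add algebra_simps)

lemma rat_poly_eval_smult: "rat_poly_eval (Polynomial.smult a p) x = of_rat a * rat_poly_eval p x"
  by (induction p) (simp_all add: rat_poly_eval_pCons of_rat_mult algebra_simps)

lemma rat_poly_eval_mult: "rat_poly_eval (p * q) x = rat_poly_eval p x * rat_poly_eval q x"
  by (induction p)
    (simp_all add: rat_poly_eval_pCons rat_poly_eval_add rat_poly_eval_smult algebra_simps)

lemma rat_poly_eval_uminus: "rat_poly_eval (- p) x = - rat_poly_eval p x"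
  using rat_poly_eval_smult[of "-1" p x] by simp

lemma rat_poly_eval_diff: "rat_poly_eval (p - q) x = rat_poly_eval p x - rat_poly_eval q x"
  using rat_poly_eval_add[of p "- q" x] by (simp add: rat_poly_eval_uminus)

lemma rat_poly_eval_power: "rat_poly_eval (p ^ k) x = rat_poly_eval p x ^ k"
  by (induction k) (simp_all add: rat_poly_eval_mult)

lemma rat_poly_eval_monom: "rat_poly_eval (Polynomial.monom a k) x = of_rat a * x ^ k"
  by (simp add: rat_poly_eval_def map_poly_monom poly_monom)

lemma rat_poly_eval_sum:
  assumes "Polynomial.degree p < d"
  shows "rat_poly_eval p x = (\<Sum>i<d. of_rat (Polynomial.coeff p i) * x ^ i)"
proof -
  have "rat_poly_eval p x = (\<Sum>i\<le>Polynomial.degree p. of_rat (Polynomial.coeff p i) * x ^ i)"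
    by (simp add: rat_poly_eval_def poly_altdef Polynomial.coeff_map_poly)
  also have "\<dots> = (\<Sum>i<d. of_rat (Polynomial.coeff p i) * x ^ i)"
    using assms by (intro sum.mono_neutral_left) (auto intro!: coeff_eq_0)
  finally show ?thesis .
qed

lemma clear_denominators:
  "\<exists>d q. d > 0 \<and> Polynomial.smult (of_int d) p = map_poly of_int (q :: int poly) \<and>
    Polynomial.degree q = Polynomial.degree (p :: rat poly)"
proof -
  have "\<exists>d q. d > 0 \<and> Polynomial.smult (of_int d) p = map_poly of_int (q :: int poly)"
  proof (induction p)
    case 0
    show ?case by (intro exI[of _ 1] exI[of _ 0]) auto
  next
    case (pCons a p)
    obtain d q where d: "d > 0" "Polynomial.smult (of_int d) p = map_poly of_int q"
      using pCons.IH by blast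
    obtain x y where a: "quotient_of a = (x, y)" by fastforce
    then have y: "y > 0" "a = of_int x / of_int y"
      using quotient_of_denom_pos[of a x y] quotient_of_div[of a x y] by auto
    have "Polynomial.smult (of_int (y * d)) (pCons a p)
      = pCons (of_int (x * d)) (Polynomial.smult (of_int y) (Polynomial.smult (of_int d) p))"
      using y by simp
    also have "\<dots> = map_poly of_int (pCons (x * d) (Polynomial.smult y q))"
      unfolding d(2) by (intro poly_eqI) (simp add: Polynomial.coeff_map_poly coeff_pCons split: nat.split)
    finally show ?case using d(1) y(1) by (intro exI[of _ "y * d"]) auto
  qed
  then obtain d and q :: "int poly" where d: "d > 0" "Polynomial.smult (of_int d) p = map_poly of_int q"
    by blast
  have "Polynomial.degree q = Polynomial.degree (map_poly of_int q :: rat poly)" by simp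
  also have "\<dots> = Polynomial.degree p" using d(1) by (simp flip: d(2))
  finally show ?thesis using d by blast
qed

lemma not_algebraic_int_third:
  assumes "algebraic_int (of_int a / 3 :: complex)"
  shows "3 dvd a"
proof -
  have "of_int a / 3 \<in> (\<int> :: complex set)"
    using assms by (intro rational_algebraic_int_is_int) auto
  then obtain b where "of_int a / 3 = (of_int b :: complex)" by (auto elim: Ints_cases)
  then have "(of_int a :: complex) = of_int (3 * b)" by (simp add: field_simps)
  then show ?thesis unfolding of_int_eq_iff by simp
qed

text \<open>The ramification of \<open>3\<close> holds for every positive \<open>m\<close>; the
  congruence modulo \<open>4\<close> appears later, as a hypothesis on \<open>n\<close> where the
  discriminant is treated.\<close>

locale ramified_tower =
  fixes \<alpha> :: complex and m :: nat
  assumes m_pos: "m > 0" and cube: "(\<alpha> ^ m - 1) ^ 3 = 2"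
begin

definition n :: nat where "n = 3 * m"
definition c :: complex where "c = \<alpha> ^ m - 1"
definition w :: complex where "w = c - 1"
definition v :: complex where "v = 1 + c + c ^ 2"

lemma n_pos: "n > 0" using m_pos by (simp add: n_def)

lemma c_cube: "c ^ 3 = 2" by (simp add: c_def cube)

lemma algebraic_int_c: "algebraic_int c"
proof (rule algebraic_int_root)
  show "poly (Polynomial.monom 1 3) c = 2" using c_cube by (simp add: poly_monom)
qed (auto simp: Polynomial.degree_monom_eq)

lemma algebraic_int_\<alpha>: "algebraic_int \<alpha>"
proof (rule algebraic_int_root)
  show "poly (Polynomial.monom 1 m) \<alpha> = c + 1" by (simp add: poly_monom c_def)
  show "algebraic_int (c + 1)" by (intro algebraic_int_add algebraic_int_c) auto
qed (use m_pos in \<open>auto simp: Polynomial.degree_monom_eq\<close>)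

lemma algebraic_int_w: "algebraic_int w"
  unfolding w_def by (intro algebraic_int_diff algebraic_int_c) auto

lemma w_unit: "w * v = 1"
  using c_cube by (simp add: w_def v_def algebra_simps power2_eq_square power3_eq_cube)

lemma \<alpha>_power_n: "\<alpha> ^ n = 3 * v"
proof -
  have "\<alpha> ^ n = (1 + c) ^ 3" by (simp add: n_def c_def mult.commute power_mult)
  also have "\<dots> = c ^ 3 + 1 + 3 * c + 3 * c ^ 2" by (simp add: power3_eq_cube power2_eq_square algebra_simps)
  finally show ?thesis by (simp add: c_cube v_def)
qed

lemma \<alpha>_power_n_w: "\<alpha> ^ n * w = 3"
  using \<alpha>_power_n w_unit by (simp add: mult.commute)

lemma \<alpha>_nz: "\<alpha> \<noteq> 0" and w_nz: "w \<noteq> 0"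
  using \<alpha>_power_n_w n_pos by (auto simp: zero_power)

lemma algebraic_int_unit: "algebraic_int v"
  unfolding v_def by (intro algebraic_int_add algebraic_int_power algebraic_int_c) auto

text \<open>The \<open>n\<close>-th power of \<open>a / \<alpha>\<close> is
  \<open>a ^ n / (3 * v)\<close>; multiplying by the algebraic integer \<open>v\<close> leaves the
  rational number \<open>a ^ n / 3\<close>, which must be an integer.\<close>

lemma three_dvd_if_\<alpha>_dvd:
  assumes "algebraic_int (of_int a / \<alpha>)"
  shows "3 dvd a"
proof -
  have "algebraic_int ((of_int a / \<alpha>) ^ n * v)"
    by (intro algebraic_int_mult algebraic_int_power assms algebraic_int_unit)
  also have "(of_int a / \<alpha>) ^ n * v = of_int (a ^ n) / 3"
    using w_unit by (auto simp: power_divide \<alpha>_power_n)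
  finally have "3 dvd a ^ n" by (rule not_algebraic_int_third)
  then show ?thesis using prime_dvd_power[of 3 a n] by simp
qed

text \<open>Eisenstein's argument without valuations. After division of the sum by
  \<open>\<alpha> ^ Suc i\<close>, the terms of larger index are visibly integral, and those of
  smaller index are so by induction because \<open>3 = \<alpha> ^ n * w\<close>. What remains is
  \<open>a i / \<alpha>\<close>.\<close>

lemma three_dvd_coeffs:
  assumes "algebraic_int ((\<Sum>i<n. of_int (a i) * \<alpha> ^ i) / \<alpha> ^ n)"
  shows "i < n \<Longrightarrow> 3 dvd a i"
proof (induction i rule: less_induct)
  case (less i)
  have div3: "algebraic_int (of_int (a l) * \<alpha> ^ l / \<alpha> ^ Suc i)" if l: "l < n" "l \<noteq> i" for l
  proof (cases "l < i")
    case True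
    then obtain b where b: "a l = 3 * b" using less.IH[of l] l by auto
    have "algebraic_int (of_int b * w * \<alpha> ^ l * \<alpha> ^ (n - Suc i))"
      by (intro algebraic_int_mult algebraic_int_power algebraic_int_w algebraic_int_\<alpha>) auto
    also have "of_int b * w * \<alpha> ^ l * \<alpha> ^ (n - Suc i)
        = of_int b * (\<alpha> ^ n * w) * \<alpha> ^ l / \<alpha> ^ Suc i"
      using \<open>i < n\<close> \<alpha>_nz by (simp add: power_diff)
    also have "\<dots> = of_int (a l) * \<alpha> ^ l / \<alpha> ^ Suc i" by (simp only: \<alpha>_power_n_w b) simp
    finally show ?thesis .
  next
    case False
    then have "Suc i \<le> l" using l by simp
    then have "of_int (a l) * \<alpha> ^ l / \<alpha> ^ Suc i = of_int (a l) * \<alpha> ^ (l - Suc i)"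
      using \<alpha>_nz by (simp add: power_diff)
    moreover have "algebraic_int (of_int (a l) * \<alpha> ^ (l - Suc i))"
      by (intro algebraic_int_mult algebraic_int_power algebraic_int_\<alpha>) auto
    ultimately show ?thesis by simp
  qed
  have "algebraic_int ((\<Sum>l<n. of_int (a l) * \<alpha> ^ l) / \<alpha> ^ n * \<alpha> ^ (n - Suc i))"
    by (intro algebraic_int_mult algebraic_int_power algebraic_int_\<alpha> assms)
  also have "(\<Sum>l<n. of_int (a l) * \<alpha> ^ l) / \<alpha> ^ n * \<alpha> ^ (n - Suc i)
      = (\<Sum>l<n. of_int (a l) * \<alpha> ^ l) / \<alpha> ^ Suc i"
    using \<open>i < n\<close> \<alpha>_nz by (simp add: power_diff)
  also have "\<dots> = (\<Sum>l<n. of_int (a l) * \<alpha> ^ l / \<alpha> ^ Suc i)"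
    by (simp add: sum_divide_distrib)
  also have "\<dots> = of_int (a i) * \<alpha> ^ i / \<alpha> ^ Suc i
      + (\<Sum>l\<in>{..<n} - {i}. of_int (a l) * \<alpha> ^ l / \<alpha> ^ Suc i)"
    using \<open>i < n\<close> by (intro sum.remove) auto
  also have "of_int (a i) * \<alpha> ^ i / \<alpha> ^ Suc i = of_int (a i) / \<alpha>"
    using \<alpha>_nz by simp
  finally have *: "algebraic_int (of_int (a i) / \<alpha>
      + (\<Sum>l\<in>{..<n} - {i}. of_int (a l) * \<alpha> ^ l / \<alpha> ^ Suc i))" .
  have "algebraic_int (\<Sum>l\<in>{..<n} - {i}. of_int (a l) * \<alpha> ^ l / \<alpha> ^ Suc i)"
    by (intro algebraic_int_sum div3) auto
  from algebraic_int_diff[OF * this] have "algebraic_int (of_int (a i) / \<alpha>)" by simp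
  then show ?case by (rule three_dvd_if_\<alpha>_dvd)
qed

text \<open>Infinite descent at \<open>3\<close>: the zero sum is divisible by
  \<open>\<alpha> ^ n\<close>, so all coefficients are divisible by \<open>3\<close>, and their
  quotients by \<open>3\<close> satisfy the same relation. This independence of the powers below
  \<open>n\<close> yields the degree of \<open>K\<close>.\<close>

lemma coeffs_zero:
  assumes "(\<Sum>i<n. of_int (a i) * \<alpha> ^ i) = 0"
  shows "i < n \<Longrightarrow> a i = 0"
proof -
  have "\<forall>i<n. 3 ^ k dvd a i" for k
  proof (induction k)
    case (Suc k)
    define b where "b = (\<lambda>i. a i div 3 ^ k)"
    have ab: "a i = 3 ^ k * b i" if "i < n" for i
      using Suc that by (simp add: b_def)
    have "0 = (\<Sum>i<n. of_int (3 ^ k * b i) * \<alpha> ^ i)"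
      using assms by (simp add: ab)
    also have "\<dots> = 3 ^ k * (\<Sum>i<n. of_int (b i) * \<alpha> ^ i)"
      by (simp add: sum_distrib_left mult.assoc)
    finally have "(\<Sum>i<n. of_int (b i) * \<alpha> ^ i) = 0" by simp
    then have "3 dvd b i" if "i < n" for i
      using three_dvd_coeffs[of b i] that by simp
    then show ?case using ab by auto
  qed simp
  then have dvd: "3 ^ k dvd a i" if "i < n" for i k using that by blast
  show "i < n \<Longrightarrow> a i = 0"
  proof (rule ccontr)
    assume "i < n" "a i \<noteq> 0"
    have "3 ^ nat \<bar>a i\<bar> \<le> \<bar>a i\<bar>"
      using dvd[OF \<open>i < n\<close>, of "nat \<bar>a i\<bar>"] \<open>a i \<noteq> 0\<close> by (intro zdvd_imp_le) auto
    moreover have "nat \<bar>a i\<bar> < 3 ^ nat \<bar>a i\<bar>" by (rule less_exp[THEN less_le_trans]) (simp add: power_mono)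
    then have "int (nat \<bar>a i\<bar>) < int (3 ^ nat \<bar>a i\<bar>)" by (simp only: of_nat_less_iff)
    then have "\<bar>a i\<bar> < 3 ^ nat \<bar>a i\<bar>" by simp
    ultimately show False by simp
  qed
qed

lemma rat_poly_eval_nz:
  assumes "Polynomial.degree p < n" "rat_poly_eval p \<alpha> = 0"
  shows "p = 0"
proof -
  obtain d q where d: "d > 0" "Polynomial.smult (of_int d) p = map_poly of_int (q :: int poly)"
    using clear_denominators[of p] by blast
  have "0 = rat_poly_eval (Polynomial.smult (of_int d) p) \<alpha>"
    using assms by (simp add: rat_poly_eval_smult)
  also have "\<dots> = (\<Sum>i<n. of_rat (Polynomial.coeff (Polynomial.smult (of_int d) p) i) * \<alpha> ^ i)"
    by (rule rat_poly_eval_sum[OF le_less_trans[OF degree_smult_le assms(1)]])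
  also have "\<dots> = (\<Sum>i<n. of_int (Polynomial.coeff q i) * \<alpha> ^ i)"
    by (simp only: d(2)) (simp add: Polynomial.coeff_map_poly)
  finally have *: "Polynomial.coeff q i = 0" if "i < n" for i
    using coeffs_zero[of "Polynomial.coeff q" i] that by simp
  show "p = 0"
  proof (rule poly_eqI)
    fix i
    show "Polynomial.coeff p i = Polynomial.coeff 0 i"
    proof (cases "i < n")
      case True
      have "of_int d * Polynomial.coeff p i = Polynomial.coeff (Polynomial.smult (of_int d) p) i" by simp
      also have "\<dots> = 0" unfolding d(2) using *[OF True] by (simp add: Polynomial.coeff_map_poly)
      finally show ?thesis using d(1) by simp
    next
      case False
      then show ?thesis using assms(1) by (simp add: coeff_eq_0)
    qed
  qed
qed

definition f :: "rat poly" where "f = (Polynomial.monom 1 m - 1) ^ 3 - 2"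

lemma rat_poly_eval_f: "rat_poly_eval f x = (x ^ m - 1) ^ 3 - 2"
  by (simp add: f_def rat_poly_eval_diff rat_poly_eval_power rat_poly_eval_monom
      rat_poly_eval_pCons numeral_poly)

lemma degree_f: "Polynomial.degree f = n"
proof -
  have "Polynomial.degree (Polynomial.monom 1 m - 1 :: rat poly) = m"
    using m_pos degree_add_eq_left[of "- 1" "Polynomial.monom 1 m :: rat poly"]
    by (simp add: Polynomial.degree_monom_eq)
  then have "Polynomial.degree ((Polynomial.monom 1 m - 1) ^ 3 :: rat poly) = n"
    using m_pos by (subst degree_power_eq) (auto simp: n_def)
  then show ?thesis
    using n_pos degree_add_eq_left[of "- 2" "(Polynomial.monom 1 m - 1) ^ 3 :: rat poly"]
    by (simp add: f_def)
qed

lemma f_nz: "f \<noteq> 0" using degree_f n_pos by auto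

lemma rat_poly_eval_f_\<alpha>: "rat_poly_eval f \<alpha> = 0"
  using rat_poly_eval_f[of \<alpha>] cube by simp

lemma rat_poly_eval_mod: "rat_poly_eval f x = 0 \<Longrightarrow> rat_poly_eval (p mod f) x = rat_poly_eval p x"
  using div_mult_mod_eq[of p f] by (metis add_0 mult_zero_right rat_poly_eval_add rat_poly_eval_mult)

lemma degree_mod_f: "Polynomial.degree (p mod f) < n"
  using degree_mod_less[OF f_nz, of p] degree_f n_pos by auto

text \<open>The form in which irreducibility of \<open>f\<close> over the rationals enters:
  \<open>f\<close> is the minimal polynomial of \<open>\<alpha>\<close>, by the independence of its
  powers below \<open>n\<close>.\<close>

lemma f_dvd_iff: "f dvd p \<longleftrightarrow> rat_poly_eval p \<alpha> = 0"
proof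
  assume "rat_poly_eval p \<alpha> = 0"
  then have "p mod f = 0"
    using rat_poly_eval_nz[OF degree_mod_f] rat_poly_eval_mod[OF rat_poly_eval_f_\<alpha>] by simp
  then show "f dvd p" by auto
qed (auto simp: dvd_def rat_poly_eval_mult rat_poly_eval_f_\<alpha>)

definition K :: "complex set" where "K = range (\<lambda>p. rat_poly_eval p \<alpha>)"

lemma K_I [intro]: "rat_poly_eval p \<alpha> \<in> K" by (simp add: K_def)

lemma K_add: "x \<in> K \<Longrightarrow> y \<in> K \<Longrightarrow> x + y \<in> K"
  by (auto simp: K_def simp flip: rat_poly_eval_add)

lemma K_mult: "x \<in> K \<Longrightarrow> y \<in> K \<Longrightarrow> x * y \<in> K"
  by (auto simp: K_def simp flip: rat_poly_eval_mult)

lemma K_uminus: "x \<in> K \<Longrightarrow> - x \<in> K"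
  by (auto simp: K_def simp flip: rat_poly_eval_uminus)

lemma K_diff: "x \<in> K \<Longrightarrow> y \<in> K \<Longrightarrow> x - y \<in> K"
  by (auto simp: K_def simp flip: rat_poly_eval_diff)

lemma K_of_rat: "of_rat r \<in> K"
  using K_I[of "[:r:]"] by (simp add: rat_poly_eval_pCons)

lemma K_of_int: "of_int r \<in> K"
  using K_of_rat[of "of_int r"] by simp

lemma K_0: "0 \<in> K" and K_1: "1 \<in> K"
  using K_of_int[of 0] K_of_int[of 1] by simp_all

lemma K_\<alpha>: "\<alpha> \<in> K"
  using K_I[of "[:0, 1:]"] by (simp add: rat_poly_eval_pCons)

lemma K_power: "x \<in> K \<Longrightarrow> x ^ k \<in> K"
  by (induction k) (auto intro: K_mult K_1)

lemma K_c: "c \<in> K" and K_w: "w \<in> K"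
  unfolding w_def c_def by (intro K_diff K_power K_\<alpha> K_1)+

text \<open>Bezout for \<open>p\<close> and \<open>f\<close>. The cofactor of the gcd in
  \<open>f\<close> has the root \<open>\<alpha>\<close>, so its degree is that of \<open>f\<close>,
  which makes the gcd a nonzero rational constant.\<close>

lemma K_inverse:
  assumes "x \<in> K" "x \<noteq> 0"
  shows "inverse x \<in> K"
proof -
  obtain p where p: "x = rat_poly_eval p \<alpha>" using assms by (auto simp: K_def)
  define g where "g = gcd p f"
  obtain a b where ab: "a * p + b * f = g" using bezout_coefficients_fst_snd g_def by metis
  have g: "rat_poly_eval g \<alpha> = rat_poly_eval a \<alpha> * x"
    using rat_poly_eval_f_\<alpha> p by (simp flip: ab add: rat_poly_eval_add rat_poly_eval_mult)
  have "rat_poly_eval g \<alpha> \<noteq> 0"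
  proof
    assume "rat_poly_eval g \<alpha> = 0"
    then have "f dvd g" by (simp add: f_dvd_iff)
    then have "f dvd p" unfolding g_def by simp
    then show False using assms p by (simp add: f_dvd_iff)
  qed
  obtain s where s: "f = g * s" unfolding g_def by (metis dvdE gcd_dvd2)
  have "rat_poly_eval s \<alpha> = 0"
    using rat_poly_eval_f_\<alpha> \<open>rat_poly_eval g \<alpha> \<noteq> 0\<close> s by (auto simp: rat_poly_eval_mult)
  then have "f dvd s" by (simp add: f_dvd_iff)
  moreover have "g \<noteq> 0" "s \<noteq> 0" using s f_nz by auto
  ultimately have "Polynomial.degree f \<le> Polynomial.degree s" by (intro dvd_imp_degree_le)
  then have "Polynomial.degree g = 0"
    using s \<open>g \<noteq> 0\<close> \<open>s \<noteq> 0\<close> by (simp add: degree_mult_eq)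
  then obtain r where r: "g = [:r:]" by (auto elim: degree_eq_zeroE)
  then have r': "of_rat r = rat_poly_eval a \<alpha> * x" "r \<noteq> 0"
    using g \<open>g \<noteq> 0\<close> by (auto simp: rat_poly_eval_pCons)
  then have "inverse x = of_rat (inverse r) * rat_poly_eval a \<alpha>"
    using assms unfolding of_rat_inverse r'(1) using r' by (auto simp: field_simps)
  then show ?thesis by (simp only: K_mult K_of_rat K_I)
qed

lemma K_divide: "x \<in> K \<Longrightarrow> y \<in> K \<Longrightarrow> x / y \<in> K"
  using K_mult[of x "inverse y"] K_inverse[of y] K_0 by (cases "y = 0") (auto simp: divide_inverse)

end

section \<open>Arithmetic of the ring record of complex numbers\<close>

lemma complex_ring_simps [simp]:
  "carrier complex_ring = UNIV" "x \<otimes>\<^bsub>complex_ring\<^esub> y = x * y" "x \<oplus>\<^bsub>complex_ring\<^esub> y = x + y"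
  "\<one>\<^bsub>complex_ring\<^esub> = 1" "\<zero>\<^bsub>complex_ring\<^esub> = 0"
  by (simp_all add: ring_of_type_algebra_def)

interpretation complex_cring: cring complex_ring
  by (rule cring_from_type_algebra)

lemma complex_ring_a_inv [simp]: "\<ominus>\<^bsub>complex_ring\<^esub> x = - x"
  by (rule complex_cring.minus_equality) simp_all

lemma complex_ring_m_inv: "x \<noteq> 0 \<Longrightarrow> inv\<^bsub>complex_ring\<^esub> x = inverse x"
  by (rule complex_cring.comm_inv_char) simp_all

lemma subring_complexI:
  assumes "1 \<in> S" "\<And>x. x \<in> S \<Longrightarrow> - x \<in> S" "\<And>x y. x \<in> S \<Longrightarrow> y \<in> S \<Longrightarrow> x * y \<in> S"
    "\<And>x y. x \<in> S \<Longrightarrow> y \<in> S \<Longrightarrow> x + y \<in> S"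
  shows "subring S complex_ring"
  using assms by (intro complex_cring.subringI) auto

lemma subfield_complexI:
  assumes "1 \<in> S" "\<And>x. x \<in> S \<Longrightarrow> - x \<in> S" "\<And>x y. x \<in> S \<Longrightarrow> y \<in> S \<Longrightarrow> x * y \<in> S"
    "\<And>x y. x \<in> S \<Longrightarrow> y \<in> S \<Longrightarrow> x + y \<in> S" "\<And>x. x \<in> S \<Longrightarrow> x \<noteq> 0 \<Longrightarrow> inverse x \<in> S"
  shows "subfield S complex_ring"
  using assms by (intro field.subfieldI'[OF field_from_type_algebra] subring_complexI) (auto simp: complex_ring_m_inv)

lemma subfield_Rats: "subfield \<rat> complex_ring"
  by (rule subfield_complexI) auto

lemma combine_complex:
  "complex_cring.combine Ks Us = (\<Sum>i<min (length Ks) (length Us). Ks ! i * Us ! i)"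
proof (induction Ks Us rule: complex_cring.combine.induct)
  case (1 k Ks u Us)
  then show ?case by (simp add: sum.lessThan_Suc_shift del: sum.lessThan_Suc)
qed simp_all

section \<open>The number field \<open>K\<close> and its degree\<close>

context ramified_tower
begin

lemma subfield_K: "subfield K complex_ring"
  by (rule subfield_complexI) (auto intro: K_1 K_uminus K_mult K_add K_inverse)

lemma combine_powers:
  assumes "length Ks = n" "set Ks \<subseteq> \<rat>"
  shows "\<exists>p. Polynomial.degree p < n \<and>
    complex_cring.combine Ks (map (\<lambda>i. \<alpha> ^ i) [0..<n]) = rat_poly_eval p \<alpha> \<and>
    (\<forall>i<n. Ks ! i = of_rat (Polynomial.coeff p i))"
proof -
  have "\<exists>r. Ks ! i = of_rat r" if "i < n" for i
  proof -
    have "Ks ! i \<in> \<rat>" using that assms by (metis nth_mem subsetD)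
    then show ?thesis by (auto elim: Rats_cases)
  qed
  then obtain r where r: "\<And>i. i < n \<Longrightarrow> Ks ! i = of_rat (r i)" by metis
  define p where "p = (\<Sum>i<n. Polynomial.monom (r i) i)"
  have coeff: "Polynomial.coeff p i = (if i < n then r i else 0)" for i
    by (simp add: p_def coeff_sum)
  have deg: "Polynomial.degree p < n"
    using n_pos by (intro degree_lessI) (auto simp: coeff)
  have "complex_cring.combine Ks (map (\<lambda>i. \<alpha> ^ i) [0..<n]) = rat_poly_eval p \<alpha>"
    using assms r unfolding rat_poly_eval_sum[OF deg] combine_complex
    by (intro sum.cong) (auto simp: coeff)
  then show ?thesis using deg r coeff by (intro exI[of _ p]) simp
qed

lemma dimension_K: "complex_cring.dimension n \<rat> K"
proof -
  define Us where "Us = map (\<lambda>i. \<alpha> ^ i) [0..<n]"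
  have indep: "complex_cring.independent \<rat> Us"
  proof (rule complex_cring.trivial_combine_imp_independent[OF subfield_Rats])
    fix Ks assume Ks: "set Ks \<subseteq> \<rat>" "complex_cring.combine Ks Us = \<zero>\<^bsub>complex_ring\<^esub>"
    \<comment> \<open>The independence criterion ranges over coefficient lists of every length,
      while \<open>combine\<close> stops at the shorter list. Cutting or padding with
      \<open>0\<close> to length \<open>n\<close> keeps the value.\<close>
    define Ks' where "Ks' = take n Ks @ replicate (n - length Ks) 0"
    have len: "length Ks' = n" by (simp add: Ks'_def)
    have rat: "set Ks' \<subseteq> \<rat>" using Ks set_take_subset[of n Ks] by (auto simp: Ks'_def)
    obtain p where p: "Polynomial.degree p < n" "complex_cring.combine Ks' Us = rat_poly_eval p \<alpha>"
      "\<And>i. i < n \<Longrightarrow> Ks' ! i = of_rat (Polynomial.coeff p i)"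
      using combine_powers[OF len rat] unfolding Us_def by auto
    have "complex_cring.combine Ks' Us = (\<Sum>i<n. Ks' ! i * \<alpha> ^ i)"
      by (simp add: combine_complex len Us_def)
    also have "\<dots> = (\<Sum>i<min (length Ks) n. Ks ! i * \<alpha> ^ i)"
      by (intro sum.mono_neutral_cong_right) (auto simp: Ks'_def nth_append)
    also have "\<dots> = complex_cring.combine Ks Us"
      by (simp add: combine_complex Us_def)
    finally have "p = 0" using Ks p(1,2) rat_poly_eval_nz by simp
    then have "Ks' ! i = 0" if "i < n" for i using p(3) that by simp
    then have "set Ks' \<subseteq> {0}" using len by (auto simp: in_set_conv_nth)
    then show "set (take (length Us) Ks) \<subseteq> {\<zero>\<^bsub>complex_ring\<^esub>}" by (simp add: Ks'_def Us_def)
  qed simp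
  have Span: "x \<in> complex_cring.Span \<rat> Us \<longleftrightarrow>
      (\<exists>Ks. set Ks \<subseteq> \<rat> \<and> length Ks = length Us \<and> x = complex_cring.combine Ks Us)" for x
    by (rule complex_cring.Span_mem_iff_length_version[OF subfield_Rats]) simp
  have "complex_cring.Span \<rat> Us = K"
  proof (intro Set.set_eqI iffI)
    fix x assume "x \<in> complex_cring.Span \<rat> Us"
    then obtain Ks where "set Ks \<subseteq> \<rat>" "length Ks = n" "x = complex_cring.combine Ks Us"
      unfolding Span by (auto simp: Us_def)
    then show "x \<in> K" using combine_powers[of Ks] by (auto simp: Us_def)
  next
    fix x assume "x \<in> K"
    then obtain p where p: "x = rat_poly_eval p \<alpha>" by (auto simp: K_def)
    define q where "q = p mod f"
    have q: "x = rat_poly_eval q \<alpha>" "Polynomial.degree q < n"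
      using p degree_mod_f rat_poly_eval_mod[OF rat_poly_eval_f_\<alpha>] by (auto simp: q_def)
    define Ks where "Ks = map (\<lambda>i. complex_of_rat (Polynomial.coeff q i)) [0..<n]"
    have "x = complex_cring.combine Ks Us"
      by (simp add: q rat_poly_eval_sum combine_complex Ks_def Us_def)
    moreover have "set Ks \<subseteq> \<rat>" by (auto simp: Ks_def)
    ultimately show "x \<in> complex_cring.Span \<rat> Us"
      unfolding Span by (intro exI[of _ Ks]) (simp add: Ks_def Us_def)
  qed
  with indep show ?thesis
    using complex_cring.dimension_independent[of \<rat> Us] by (simp add: Us_def)
qed

lemma number_field_K: "number_field K"
  unfolding number_field_def
  using subfield_K complex_cring.finite_dimensionI[OF dimension_K] by simp

lemma field_degree_K: "field_degree K = n"
  unfolding field_degree_def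
  using complex_cring.dimI[OF subfield_Rats dimension_K] by (simp add: over_def)

section \<open>Embeddings of \<open>K\<close>\<close>

lemma embeddingD:
  assumes "\<sigma> \<in> embeddings K"
  shows "\<And>x y. x \<in> K \<Longrightarrow> y \<in> K \<Longrightarrow> \<sigma> (x + y) = \<sigma> x + \<sigma> y"
    "\<And>x y. x \<in> K \<Longrightarrow> y \<in> K \<Longrightarrow> \<sigma> (x * y) = \<sigma> x * \<sigma> y" "\<sigma> 1 = 1"
    "\<And>x. x \<notin> K \<Longrightarrow> \<sigma> x = undefined"
  using assms unfolding embeddings_def Ring.ring_hom_def extensional_def by auto

lemma embedding_0:
  assumes "\<sigma> \<in> embeddings K"
  shows "\<sigma> 0 = 0"
  using embeddingD(1)[OF assms K_0 K_0] by simp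

lemma embedding_of_rat:
  assumes "\<sigma> \<in> embeddings K"
  shows "\<sigma> (of_rat r) = of_rat r"
proof -
  note h = embeddingD(1-3)[OF assms]
  have nat: "\<sigma> (of_nat k) = of_nat k" for k
  proof (induction k)
    case (Suc k)
    have "of_nat k \<in> K" using K_of_int[of "int k"] by simp
    then show ?case using h(1)[OF K_1, of "of_nat k"] h(3) Suc by simp
  qed (simp add: embedding_0[OF assms])
  have int: "\<sigma> (of_int k) = of_int k" for k
  proof (cases "k \<ge> 0")
    case True
    then show ?thesis using nat[of "nat k"] by simp
  next
    case False
    have "\<sigma> (of_int k) + \<sigma> (of_int (- k)) = \<sigma> (of_int k + of_int (- k))"
      by (rule h(1)[symmetric]) (rule K_of_int)+
    also have "\<dots> = 0" by (simp add: embedding_0[OF assms])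
    also have "\<sigma> (of_int (- k)) = of_int (- k)" using nat[of "nat (- k)"] False by simp
    finally show ?thesis by simp
  qed
  obtain a b where r: "r = of_int a / of_int b" "b \<noteq> 0"
    by (metis quotient_of_denom_pos quotient_of_div less_irrefl surj_pair)
  have "of_int b * \<sigma> (of_rat r) = \<sigma> (of_int b * of_rat r)"
    using h(2)[OF K_of_int K_of_rat, of b r] int by simp
  also have "of_int b * complex_of_rat r = of_int a"
    using r by (simp add: of_rat_divide)
  also have "\<sigma> (of_int a) = of_int b * of_rat r"
    using r int by (simp add: of_rat_divide)
  finally show ?thesis using r(2) by simp
qed

lemma embedding_rat_poly_eval:
  assumes "\<sigma> \<in> embeddings K"
  shows "\<sigma> (rat_poly_eval p \<alpha>) = rat_poly_eval p (\<sigma> \<alpha>)"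
proof (induction p)
  case (pCons a p)
  have "\<sigma> (of_rat a + \<alpha> * rat_poly_eval p \<alpha>) = of_rat a + \<sigma> \<alpha> * \<sigma> (rat_poly_eval p \<alpha>)"
    using embeddingD(1,2)[OF assms] embedding_of_rat[OF assms] K_of_rat K_\<alpha> K_I K_mult by metis
  then show ?case by (simp add: rat_poly_eval_pCons pCons)
qed (simp add: embedding_0[OF assms])

text \<open>The embedding sending \<open>\<alpha>\<close> to \<open>x\<close>. For a root
  \<open>x\<close> of \<open>f\<close> the choice of the polynomial is immaterial, since two
  candidates differ by a multiple of \<open>f\<close>; \<open>restrict\<close> gives the
  extensionality demanded by \<open>embeddings\<close>.\<close>

definition conj_embedding :: "complex \<Rightarrow> complex \<Rightarrow> complex"
  where "conj_embedding x = restrict (\<lambda>z. rat_poly_eval (SOME p. rat_poly_eval p \<alpha> = z) x) K"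

lemma conj_embedding_eval:
  assumes "rat_poly_eval f x = 0"
  shows "conj_embedding x (rat_poly_eval p \<alpha>) = rat_poly_eval p x"
proof -
  define q where "q = (SOME q. rat_poly_eval q \<alpha> = rat_poly_eval p \<alpha>)"
  have "rat_poly_eval q \<alpha> = rat_poly_eval p \<alpha>" unfolding q_def by (rule someI) simp
  then have "f dvd q - p" by (simp add: f_dvd_iff rat_poly_eval_diff)
  then have "rat_poly_eval (q - p) x = 0" using assms by (auto simp: dvd_def rat_poly_eval_mult)
  then show ?thesis by (simp add: conj_embedding_def K_I rat_poly_eval_diff flip: q_def)
qed

lemma conj_embedding:
  assumes "rat_poly_eval f x = 0"
  shows "conj_embedding x \<in> embeddings K" "conj_embedding x \<alpha> = x"
proof -
  note e = conj_embedding_eval[OF assms]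
  show "conj_embedding x \<alpha> = x"
    using e[of "[:0, 1:]"] by (simp add: rat_poly_eval_pCons)
  have "conj_embedding x 1 = 1" using e[of 1] by simp
  moreover have "conj_embedding x (a + b) = conj_embedding x a + conj_embedding x b"
    "conj_embedding x (a * b) = conj_embedding x a * conj_embedding x b" if ab: "a \<in> K" "b \<in> K" for a b
  proof -
    obtain p q where "a = rat_poly_eval p \<alpha>" "b = rat_poly_eval q \<alpha>"
      using ab by (auto simp: K_def)
    then show "conj_embedding x (a + b) = conj_embedding x a + conj_embedding x b"
      "conj_embedding x (a * b) = conj_embedding x a * conj_embedding x b"
      using e[of "p + q"] e[of "p * q"] e[of p] e[of q]
      by (simp_all add: rat_poly_eval_add rat_poly_eval_mult)
  qed
  moreover have "conj_embedding x \<in> extensional K" by (simp add: conj_embedding_def)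
  ultimately show "conj_embedding x \<in> embeddings K"
    unfolding embeddings_def Ring.ring_hom_def by auto
qed

lemma bij_betw_embeddings: "bij_betw (\<lambda>\<sigma>. \<sigma> \<alpha>) (embeddings K) {x. rat_poly_eval f x = 0}"
proof (rule bij_betwI')
  fix \<sigma> \<tau> assume st: "\<sigma> \<in> embeddings K" "\<tau> \<in> embeddings K"
  have "\<sigma> = \<tau>" if "\<sigma> \<alpha> = \<tau> \<alpha>"
  proof
    fix x
    show "\<sigma> x = \<tau> x"
    proof (cases "x \<in> K")
      case True
      then obtain p where "x = rat_poly_eval p \<alpha>" by (auto simp: K_def)
      then show ?thesis using that st by (simp add: embedding_rat_poly_eval)
    qed (simp add: embeddingD(4) st)
  qed
  then show "\<sigma> \<alpha> = \<tau> \<alpha> \<longleftrightarrow> \<sigma> = \<tau>" by auto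
next
  fix \<sigma> assume "\<sigma> \<in> embeddings K"
  then show "\<sigma> \<alpha> \<in> {x. rat_poly_eval f x = 0}"
    using embedding_rat_poly_eval[of \<sigma> f] by (simp add: rat_poly_eval_f_\<alpha> embedding_0)
next
  fix x assume "x \<in> {x. rat_poly_eval f x = 0}"
  then show "\<exists>\<sigma>\<in>embeddings K. x = \<sigma> \<alpha>"
    using conj_embedding[of x] by (intro bexI[of _ "conj_embedding x"]) auto
qed

text \<open>The roots of \<open>f\<close> fibre over the three cube roots \<open>z\<close> of
  \<open>2\<close>, with the \<open>m\<close>-th roots of \<open>1 + z\<close> above each; every
  fibre has \<open>m\<close> elements because \<open>-1\<close> is not a cube root of
  \<open>2\<close>.\<close>

lemma card_embeddings: "card (embeddings K) = n"
proof -
  have "{x. rat_poly_eval f x = 0} = (\<Union>z\<in>{z::complex. z ^ 3 = 2}. {x. x ^ m = 1 + z})"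
    by (auto simp: rat_poly_eval_f intro!: exI[of _ "_ - 1"])
  also have "card \<dots> = (\<Sum>z\<in>{z::complex. z ^ 3 = 2}. card {x. x ^ m = 1 + z})"
    using m_pos finite_nth_roots[of m] finite_nth_roots[of 3 2] by (intro card_UN_disjoint) auto
  also have "\<dots> = (\<Sum>z\<in>{z::complex. z ^ 3 = 2}. m)"
  proof (intro sum.cong refl card_nth_roots m_pos)
    fix z :: complex assume z: "z \<in> {z. z ^ 3 = 2}"
    show "1 + z \<noteq> 0"
    proof
      assume "1 + z = 0"
      then have "z = - 1" by (simp add: eq_neg_iff_add_eq_0 add.commute)
      with z show False by simp
    qed
  qed
  also have "\<dots> = n" using card_nth_roots[of 2 3] by (simp add: n_def)
  finally show ?thesis using bij_betw_same_card[OF bij_betw_embeddings] by simp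
qed

declare One_nat_def [simp del]

section \<open>Integers of \<open>K\<close> modulo \<open>\<alpha>\<close>\<close>

definition OK :: "complex set" where "OK = {x \<in> K. algebraic_int x}"

abbreviation R :: "complex ring" where "R \<equiv> ring_of_integers K"

lemma R_simps [simp]:
  "carrier R = OK" "x \<otimes>\<^bsub>R\<^esub> y = x * y" "x \<oplus>\<^bsub>R\<^esub> y = x + y" "\<one>\<^bsub>R\<^esub> = 1" "\<zero>\<^bsub>R\<^esub> = 0"
  by (simp_all add: ring_of_integers_def OK_def)

lemma OK_add: "x \<in> OK \<Longrightarrow> y \<in> OK \<Longrightarrow> x + y \<in> OK"
  and OK_mult: "x \<in> OK \<Longrightarrow> y \<in> OK \<Longrightarrow> x * y \<in> OK"
  and OK_diff: "x \<in> OK \<Longrightarrow> y \<in> OK \<Longrightarrow> x - y \<in> OK"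
  and OK_uminus: "x \<in> OK \<Longrightarrow> - x \<in> OK"
  and OK_of_int: "of_int k \<in> OK"
  and OK_\<alpha>: "\<alpha> \<in> OK" and OK_w: "w \<in> OK" and OK_c: "c \<in> OK"
  by (auto simp: OK_def algebraic_int_add algebraic_int_mult algebraic_int_diff algebraic_int_minus
      algebraic_int_\<alpha> algebraic_int_w algebraic_int_c K_add K_mult K_diff K_uminus K_of_int K_\<alpha> K_w K_c)

lemma OK_0: "0 \<in> OK" and OK_1: "1 \<in> OK"
  using OK_of_int[of 0] OK_of_int[of 1] by auto

lemma OK_numeral: "numeral k \<in> OK"
  using OK_of_int[of "numeral k"] by simp

lemma OK_power: "x \<in> OK \<Longrightarrow> x ^ k \<in> OK"
  by (induction k) (auto intro: OK_mult OK_1)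

lemma OK_v: "v \<in> OK"
  unfolding v_def by (intro OK_add OK_power OK_c OK_1)

lemmas OK_intros = OK_add OK_mult OK_diff OK_uminus OK_of_int OK_\<alpha> OK_w OK_c OK_0 OK_1 OK_numeral
  OK_power OK_v

lemma cring_R: "cring R"
proof -
  have "subring OK complex_ring"
    by (rule subring_complexI) (auto intro: OK_intros)
  then have "subcring OK complex_ring" by (rule complex_cring.subcringI')
  then have "cring (complex_subring OK)" using complex_cring.subcring_iff[of OK] by simp
  then show ?thesis by (simp add: ring_of_integers_def OK_def)
qed

lemma ring_R: "ring R" using cring_R by (rule cring.axioms(1))

text \<open>The residue field of \<open>\<alpha>\<close> is that of \<open>3\<close>, although
  integers of \<open>K\<close> need not be integral polynomials in \<open>\<alpha>\<close>: some
  multiple \<open>d * x\<close> with \<open>d\<close> prime to \<open>3\<close> is one, and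
  \<open>d\<close> is invertible modulo \<open>3\<close>, a multiple of
  \<open>\<alpha>\<close>.\<close>

lemma OK_decompose:
  assumes "x \<in> OK"
  obtains r y where "r \<in> {0, 1, 2 :: int}" "y \<in> OK" "x = of_int r + \<alpha> * y"
proof -
  \<comment> \<open>A factor \<open>3\<close> of \<open>d\<close> can be removed: the sum is then
    \<open>\<alpha> ^ n\<close> times an algebraic integer, so \<open>three_dvd_coeffs\<close> makes
    all coefficients divisible by \<open>3\<close> as well.\<close>
  have clear: "\<exists>d a. \<not> 3 dvd d \<and> of_int d * x = (\<Sum>i<n. of_int (a i) * \<alpha> ^ i)"
    if "d > 0" "of_int d * x = (\<Sum>i<n. of_int (a i) * \<alpha> ^ i)" for d and a :: "nat \<Rightarrow> int"
    using that
  proof (induction "nat d" arbitrary: d a rule: less_induct)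
    case less
    show ?case
    proof (cases "3 dvd d")
      case True
      then obtain d' where d': "d = 3 * d'" by auto
      have "(\<Sum>i<n. of_int (a i) * \<alpha> ^ i) = \<alpha> ^ n * (w * of_int d' * x)"
        using less.prems(2) \<alpha>_power_n_w by (simp add: d' flip: mult.assoc)
      then have "(\<Sum>i<n. of_int (a i) * \<alpha> ^ i) / \<alpha> ^ n = w * of_int d' * x"
        using \<alpha>_nz by simp
      moreover have "algebraic_int (w * of_int d' * x)"
        using assms by (intro algebraic_int_mult algebraic_int_w) (auto simp: OK_def)
      ultimately have dvd: "3 dvd a i" if "i < n" for i
        using three_dvd_coeffs[OF _ that] by simp
      have "3 * (of_int d' * x) = of_int d * x" by (simp add: d')
      also have "\<dots> = (\<Sum>i<n. 3 * (of_int (a i div 3) * \<alpha> ^ i))"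
        unfolding less.prems(2)
      proof (intro sum.cong refl)
        fix i assume "i \<in> {..<n}"
        then have "a i = 3 * (a i div 3)" using dvd by simp
        then have "of_int (a i) = 3 * (of_int (a i div 3) :: complex)" by (metis of_int_mult of_int_numeral)
        then show "of_int (a i) * \<alpha> ^ i = 3 * (of_int (a i div 3) * \<alpha> ^ i)" by simp
      qed
      finally have "of_int d' * x = (\<Sum>i<n. of_int (a i div 3) * \<alpha> ^ i)"
        by (simp flip: sum_distrib_left)
      then show ?thesis using less.hyps[of d'] less.prems(1) d' by auto
    qed (use less in blast)
  qed
  obtain p where p: "x = rat_poly_eval p \<alpha>" "Polynomial.degree p < n"
    using assms degree_mod_f rat_poly_eval_mod[OF rat_poly_eval_f_\<alpha>]
    by (auto simp: OK_def K_def) metis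
  obtain d q where d: "d > 0" "Polynomial.smult (of_int d) p = map_poly of_int (q :: int poly)"
      "Polynomial.degree q = Polynomial.degree p"
    using clear_denominators[of p] by auto
  have "of_int d * x = rat_poly_eval (Polynomial.smult (of_int d) p) \<alpha>"
    by (simp add: p rat_poly_eval_smult)
  also have "\<dots> = (\<Sum>i<n. of_int (Polynomial.coeff q i) * \<alpha> ^ i)"
    using p(2) d(3) unfolding d(2)
    by (subst rat_poly_eval_sum[of _ n]) (simp_all add: Polynomial.coeff_map_poly)
  finally obtain d and a :: "nat \<Rightarrow> int"
    where da: "\<not> 3 dvd d" "of_int d * x = (\<Sum>i<n. of_int (a i) * \<alpha> ^ i)"
    using clear[of d "Polynomial.coeff q"] d(1) by auto
  \<comment> \<open>Multiplying by \<open>d\<close> once more inverts it modulo \<open>3\<close>,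
    since \<open>d * d = 1 + 3 * e\<close>.\<close>
  define e where "e = (d * d - 1) div 3"
  have "(d * d) mod 3 = 1"
  proof -
    have "d mod 3 = 1 \<or> d mod 3 = 2" using da(1) by presburger
    then show ?thesis using mod_mult_eq[of d 3 d] by auto
  qed
  then have e: "d * d = 1 + 3 * e" unfolding e_def by presburger
  define r where "r = (d * a 0) mod 3"
  define s where "s = (d * a 0) div 3"
  have rs: "d * a 0 = r + 3 * s" by (simp add: r_def s_def)
  \<comment> \<open>Everything except the residue \<open>r\<close> of \<open>d * a 0\<close> carries
    a factor \<open>\<alpha>\<close>; the two multiples of \<open>3\<close> are rewritten with
    \<open>3 = \<alpha> * (\<alpha> ^ (n - 1) * w)\<close>.\<close>
  define z where "z = of_int d * (\<Sum>i<n - 1. of_int (a (Suc i)) * \<alpha> ^ i)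
    + \<alpha> ^ (n - 1) * w * of_int s - \<alpha> ^ (n - 1) * w * of_int e * x"
  have three: "\<alpha> * (\<alpha> ^ (n - 1) * w) = 3"
    using \<alpha>_power_n_w n_pos by (simp add: power_eq_if mult.assoc)
  have "(\<Sum>i<n. of_int (a i) * \<alpha> ^ i) = of_int (a 0) + \<alpha> * (\<Sum>i<n - 1. of_int (a (Suc i)) * \<alpha> ^ i)"
    using n_pos sum.lessThan_Suc_shift[of "\<lambda>i. of_int (a i) * \<alpha> ^ i" "n - 1"]
    by (simp add: sum_distrib_left mult_ac)
  then have "of_int (d * d) * x
      = of_int (d * a 0) + \<alpha> * (of_int d * (\<Sum>i<n - 1. of_int (a (Suc i)) * \<alpha> ^ i))"
    using da(2) by (simp only: of_int_mult mult.assoc distrib_left mult.left_commute[of \<alpha>])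
  moreover have "of_int (d * d) * x = x + 3 * (of_int e * x)"
    by (simp only: e) (simp add: algebra_simps)
  moreover have "(of_int (d * a 0) :: complex) = of_int r + 3 * of_int s"
    by (simp only: rs) simp
  ultimately have "x = of_int r + \<alpha> * (of_int d * (\<Sum>i<n - 1. of_int (a (Suc i)) * \<alpha> ^ i))
      + 3 * of_int s - 3 * (of_int e * x)" by (simp add: algebra_simps)
  also have "\<dots> = of_int r + \<alpha> * z"
    unfolding z_def by (simp only: flip: three) (simp add: algebra_simps)
  finally have x: "x = of_int r + \<alpha> * z" .
  have "algebraic_int z"
    unfolding z_def using assms
    by (intro algebraic_int_add algebraic_int_diff algebraic_int_mult algebraic_int_sum
        algebraic_int_power algebraic_int_\<alpha> algebraic_int_w) (auto simp: OK_def)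
  moreover have "z = (x - of_int r) / \<alpha>" using x \<alpha>_nz by (simp add: field_simps)
  then have "z \<in> K" using assms by (auto intro!: K_divide K_diff K_of_int K_\<alpha> simp: OK_def)
  moreover have "r \<in> {0, 1, 2}" unfolding r_def by (simp add: insert_iff) presburger
  ultimately show ?thesis using that[of r z] x by (simp add: OK_def)
qed

section \<open>Powers of the prime above 3\<close>

definition P :: "nat \<Rightarrow> complex set" where "P e = (\<lambda>x. \<alpha> ^ e * x) ` OK"

lemma P_I: "x \<in> OK \<Longrightarrow> \<alpha> ^ e * x \<in> P e" by (auto simp: P_def)

lemma P_add: "x \<in> P e \<Longrightarrow> y \<in> P e \<Longrightarrow> x + y \<in> P e"
  by (auto simp: P_def simp flip: distrib_left intro!: imageI OK_add)

lemma P_mult: "x \<in> P e \<Longrightarrow> y \<in> OK \<Longrightarrow> y * x \<in> P e"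
  by (auto simp: P_def mult.left_commute intro!: imageI OK_mult)

lemma P_uminus: "x \<in> P e \<Longrightarrow> - x \<in> P e"
  using P_mult[of x e "- 1"] by (simp add: OK_uminus OK_1)

lemma P_0: "0 \<in> P e"
  using P_I[OF OK_0] by simp

lemma P_antimono: "d \<le> e \<Longrightarrow> P e \<subseteq> P d"
  by (auto simp: P_def le_iff_add power_add mult.assoc intro!: imageI OK_intros)

lemma ideal_P: "ideal (P e) R"
proof -
  interpret cring R by (rule cring_R)
  have "ideal (PIdl\<^bsub>R\<^esub> (\<alpha> ^ e)) R" by (rule cgenideal_ideal) (simp add: OK_intros)
  also have "PIdl\<^bsub>R\<^esub> (\<alpha> ^ e) = P e" by (auto simp: cgenideal_def P_def mult.commute)
  finally show ?thesis .
qed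

lemma one_notin_P: "1 \<notin> P 1"
proof
  assume "1 \<in> P 1"
  then obtain y where "y \<in> OK" "1 = \<alpha> * y" by (auto simp: P_def)
  then have "y = of_int 1 / \<alpha>" using \<alpha>_nz by (simp add: field_simps)
  with \<open>y \<in> OK\<close> have "algebraic_int (of_int 1 / \<alpha>)" using \<alpha>_nz by (auto simp: OK_def)
  then show False using three_dvd_if_\<alpha>_dvd by fastforce
qed

lemma of_int_in_P: "of_int k \<in> P 1 \<Longrightarrow> 3 dvd k"
  using \<alpha>_nz by (intro three_dvd_if_\<alpha>_dvd) (auto simp: P_def OK_def)

text \<open>Modulo \<open>\<alpha>\<close> the product is a product of two digits from
  \<open>{0, 1, 2}\<close>, and an ordinary integer in \<open>P 1\<close> is a multiple of
  \<open>3\<close>.\<close>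

lemma prime_P:
  assumes "x \<in> OK" "y \<in> OK" "x * y \<in> P 1"
  shows "x \<in> P 1 \<or> y \<in> P 1"
proof -
  obtain r x' where x: "r \<in> {0, 1, 2}" "x' \<in> OK" "x = of_int r + \<alpha> * x'"
    using OK_decompose[OF assms(1)] .
  obtain s y' where y: "s \<in> {0, 1, 2}" "y' \<in> OK" "y = of_int s + \<alpha> * y'"
    using OK_decompose[OF assms(2)] .
  have "of_int (r * s) = x * y + - (\<alpha> ^ 1 * (of_int r * y' + of_int s * x' + \<alpha> * x' * y'))"
    by (simp add: x y algebra_simps)
  also have "\<dots> \<in> P 1" using x y by (intro P_add P_uminus assms P_I OK_intros)
  finally have "3 dvd r * s" by (rule of_int_in_P)
  then have "r = 0 \<or> s = 0" using x(1) y(1) by auto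
  then show ?thesis using x y P_I[of x' 1] P_I[of y' 1] by auto
qed

lemma prime_P_power:
  assumes "x \<in> OK" "x \<notin> P 1"
  shows "x ^ k \<notin> P 1"
proof (induction k)
  case (Suc k)
  then show ?case using prime_P[OF assms(1) OK_power[OF assms(1)], of k] assms(2) by auto
qed (use one_notin_P in simp)

lemma w_notin_P: "w \<notin> P 1"
proof
  assume "w \<in> P 1"
  then have "v * w \<in> P 1" by (rule P_mult) (rule OK_v)
  then show False using w_unit one_notin_P by (simp add: mult.commute)
qed

lemma ideal_prod_P: "ideal_prod R (P d) (P e) = P (d + e)"
proof (intro Set.set_eqI iffI)
  fix s assume "s \<in> ideal_prod R (P d) (P e)"
  then show "s \<in> P (d + e)"
  proof (induction rule: ideal_prod.induct)
    case (prod i j)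
    then obtain x y where "x \<in> OK" "y \<in> OK" "i = \<alpha> ^ d * x" "j = \<alpha> ^ e * y" by (auto simp: P_def)
    then show ?case using P_I[of "x * y" "d + e"] by (simp add: OK_mult power_add mult_ac)
  qed (simp add: P_add)
next
  fix s assume "s \<in> P (d + e)"
  then obtain x where x: "x \<in> OK" "s = \<alpha> ^ (d + e) * x" by (auto simp: P_def)
  have "(\<alpha> ^ d * x) \<otimes>\<^bsub>R\<^esub> (\<alpha> ^ e * 1) \<in> ideal_prod R (P d) (P e)"
    using x OK_1 by (intro ideal_prod.prod P_I)
  then show "s \<in> ideal_prod R (P d) (P e)" using x by (simp add: power_add mult_ac)
qed

section \<open>Ideal powers and norms\<close>

lemma ideals_set_simps [simp]:
  "x \<otimes>\<^bsub>ideals_set R\<^esub> y = ideal_prod R x y" "\<one>\<^bsub>ideals_set R\<^esub> = OK"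
  "carrier (ideals_set R) = {I. ideal I R}"
  by (simp_all add: ideals_set_def)

lemma comm_monoid_ideals: "comm_monoid (ideals_set R)"
  using cring_R by (rule cring.ideals_set_is_comm_monoid)

lemma ideal_pow_0: "ideal_pow K I 0 = OK"
  and ideal_pow_Suc: "ideal_pow K I (Suc e) = ideal_prod R (ideal_pow K I e) I"
  using monoid.nat_pow_0[of "ideals_set R" I] monoid.nat_pow_Suc[of "ideals_set R" I e]
    comm_monoid.axioms(1)[OF comm_monoid_ideals] by simp_all

lemma ideal_pow_P: "ideal_pow K (P 1) e = P e"
proof (induction e)
  case 0
  show ?case by (simp add: ideal_pow_0 P_def)
next
  case (Suc e)
  then show ?case
    using ideal_prod_P[of e 1, folded Suc_eq_plus1] by (simp only: ideal_pow_Suc)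
qed

lemma ideal_ideal_pow:
  assumes "ideal I R"
  shows "ideal (ideal_pow K I e) R"
proof (induction e)
  case 0
  show ?case using ring.oneideal[OF ring_R] by (simp add: ideal_pow_0)
next
  case (Suc e)
  then show ?case using assms ring.ideal_prod_is_ideal[OF ring_R] by (simp add: ideal_pow_Suc)
qed

lemma power_in_ideal_pow:
  assumes "ideal I R" "x \<in> I"
  shows "x ^ e \<in> ideal_pow K I e"
proof (induction e)
  case (Suc e)
  then have "x ^ e \<otimes>\<^bsub>R\<^esub> x \<in> ideal_prod R (ideal_pow K I e) I"
    using assms by (intro ideal_prod.prod)
  then show ?case by (simp add: ideal_pow_Suc mult.commute)
qed (simp add: ideal_pow_0 OK_1)

lemma primeideal_P: "primeideal (P 1) R"
proof (rule primeidealI[OF ideal_P cring_R])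
  show "carrier R \<noteq> P 1" using OK_1 one_notin_P by auto
  show "a \<in> P 1 \<or> b \<in> P 1" if "a \<in> carrier R" "b \<in> carrier R" "a \<otimes>\<^bsub>R\<^esub> b \<in> P 1" for a b
    using that prime_P by simp
qed

lemma P_in_nonzero_primes: "P 1 \<in> nonzero_primes K"
  using primeideal_P P_I[OF OK_1, of 1] \<alpha>_nz by (auto simp: nonzero_primes_def)

lemma coset_eq_iff:
  assumes "x \<in> OK" "y \<in> OK" "x - y \<in> P e"
  shows "P e +>\<^bsub>R\<^esub> x = P e +>\<^bsub>R\<^esub> y"
proof -
  have sub: "P e +>\<^bsub>R\<^esub> x \<subseteq> P e +>\<^bsub>R\<^esub> y" if "x - y \<in> P e" for x y
  proof
    fix z assume "z \<in> P e +>\<^bsub>R\<^esub> x"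
    then obtain h where "h \<in> P e" "z = h + x" by (auto simp: a_r_coset_def')
    then have "h + (x - y) \<in> P e" "z = (h + (x - y)) + y" using that by (auto intro: P_add)
    then show "z \<in> P e +>\<^bsub>R\<^esub> y" unfolding a_r_coset_def' by (auto intro!: exI bexI)
  qed
  have "y - x \<in> P e" using P_uminus[OF assms(3)] by simp
  then show ?thesis using sub[OF assms(3)] sub[of y x] by blast
qed

text \<open>Expansion in base \<open>\<alpha>\<close> with digits \<open>0\<close>,
  \<open>1\<close>, \<open>2\<close>, cut off after \<open>e\<close> places.\<close>

lemma representatives:
  "\<exists>S. finite S \<and> card S \<le> 3 ^ e \<and> S \<subseteq> OK \<and> (\<forall>x\<in>OK. \<exists>s\<in>S. x - s \<in> P e)"
proof (induction e)
  case 0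
  show ?case by (intro exI[of _ "{0}"]) (auto simp: OK_0 P_def)
next
  case (Suc e)
  then obtain S where S: "finite S" "card S \<le> 3 ^ e" "S \<subseteq> OK" "\<forall>x\<in>OK. \<exists>s\<in>S. x - s \<in> P e"
    by auto
  define T where "T = (\<lambda>(s, r). s + \<alpha> ^ e * of_int r) ` (S \<times> {0, 1, 2 :: int})"
  have "card T \<le> card (S \<times> {0, 1, 2 :: int})" unfolding T_def by (rule card_image_le) (simp add: S)
  also have "\<dots> \<le> 3 ^ Suc e" using S by (simp add: card_cartesian_product)
  finally have "card T \<le> 3 ^ Suc e" .
  moreover have "finite T" by (simp add: T_def S)
  moreover have "T \<subseteq> OK" using S(3) by (auto simp: T_def intro!: OK_intros)
  moreover have "\<exists>t\<in>T. x - t \<in> P (Suc e)" if x: "x \<in> OK" for x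
  proof -
    obtain s where s: "s \<in> S" "x - s \<in> P e" using S(4) x by auto
    then obtain y where y: "y \<in> OK" "x - s = \<alpha> ^ e * y" by (auto simp: P_def)
    obtain r z where r: "r \<in> {0, 1, 2}" "z \<in> OK" "y = of_int r + \<alpha> * z"
      using OK_decompose[OF y(1)] .
    have "x - (s + \<alpha> ^ e * of_int r) = \<alpha> ^ Suc e * z"
      using y(2) r(3) by (simp add: algebra_simps)
    then have "x - (s + \<alpha> ^ e * of_int r) \<in> P (Suc e)" using P_I[OF r(2)] by (simp only:)
    moreover have "s + \<alpha> ^ e * of_int r \<in> T" using s r(1) by (auto simp: T_def)
    ultimately show ?thesis by blast
  qed
  ultimately show ?case by blast
qed

text \<open>The lower bound makes the logarithm in the height positive, the upper one keeps it
  bounded as the degree grows. They come from the distinct cosets of \<open>0\<close> and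
  \<open>1\<close> and from the digit expansions; finiteness matters for the former, because
  \<open>card\<close> of an infinite set is \<open>0\<close>.\<close>

lemma ideal_norm_P:
  assumes "e > 0"
  shows "2 \<le> ideal_norm K (P e)" "ideal_norm K (P e) \<le> 3 ^ e"
proof -
  obtain S where S: "finite S" "card S \<le> 3 ^ e" "S \<subseteq> OK" "\<forall>x\<in>OK. \<exists>s\<in>S. x - s \<in> P e"
    using representatives[of e] by auto
  define C where "C = (\<lambda>x. P e +>\<^bsub>R\<^esub> x) ` OK"
  have carr: "carrier (R Quot P e) = C"
    by (auto simp: FactRing_def A_RCOSETS_def' C_def)
  have "C \<subseteq> (\<lambda>x. P e +>\<^bsub>R\<^esub> x) ` S"
  proof
    fix Y assume "Y \<in> C"
    then obtain x where x: "x \<in> OK" "Y = P e +>\<^bsub>R\<^esub> x" by (auto simp: C_def)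
    then obtain s where "s \<in> S" "x - s \<in> P e" using S(4) by auto
    then show "Y \<in> (\<lambda>x. P e +>\<^bsub>R\<^esub> x) ` S" using x S(3) coset_eq_iff[of x s e] by auto
  qed
  then have C: "finite C" "card C \<le> card S"
    using S(1) finite_surj surj_card_le by auto
  then show "ideal_norm K (P e) \<le> 3 ^ e" using S(2) by (simp add: ideal_norm_def carr)
  have "P e +>\<^bsub>R\<^esub> 0 \<noteq> P e +>\<^bsub>R\<^esub> 1"
  proof
    assume "P e +>\<^bsub>R\<^esub> 0 = P e +>\<^bsub>R\<^esub> 1"
    moreover have "0 \<in> P e +>\<^bsub>R\<^esub> 0" using P_0 by (auto simp: a_r_coset_def')
    ultimately have "0 \<in> P e +>\<^bsub>R\<^esub> 1" by metis
    then obtain h where h: "h \<in> P e" "h + 1 = 0" by (auto simp: a_r_coset_def')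
    then have "- h = 1" by (intro minus_unique)
    then have "1 \<in> P e" using P_uminus[OF h(1)] by simp
    then show False using one_notin_P P_antimono[of 1 e] assms by auto
  qed
  then have "card {P e +>\<^bsub>R\<^esub> 0, P e +>\<^bsub>R\<^esub> 1} = 2" by simp
  moreover have "{P e +>\<^bsub>R\<^esub> 0, P e +>\<^bsub>R\<^esub> 1} \<subseteq> C" using OK_0 OK_1 by (auto simp: C_def)
  ultimately show "2 \<le> ideal_norm K (P e)"
    using card_mono[OF C(1)] by (metis ideal_norm_def carr)
qed

section \<open>The valuation at the prime above 3\<close>

lemma nonzero_integer_multiple:
  assumes "x \<in> OK" "x \<noteq> 0"
  shows "\<exists>N y. N \<noteq> 0 \<and> y \<in> OK \<and> of_int N = x * y"
proof -
  \<comment> \<open>Powers of \<open>x\<close> are stripped from an integer relation until its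
    constant coefficient is nonzero; up to sign this coefficient is the desired multiple of
    \<open>x\<close>, a substitute for the norm.\<close>
  have "\<exists>N q. N \<noteq> 0 \<and> of_int N = x * poly (map_poly of_int q) x"
    if "poly (map_poly of_int p) x = 0" "p \<noteq> 0" for p :: "int poly"
    using that
  proof (induction p)
    case (pCons a p)
    show ?case
    proof (cases "a = 0")
      case True
      then show ?thesis using pCons assms by auto
    next
      case False
      have "of_int a + x * poly (map_poly of_int p) x = 0"
        using pCons.prems(1) by (simp add: of_int_hom.map_poly_pCons_hom)
      then have "of_int (- a) = x * poly (map_poly of_int p) x"
        unfolding of_int_minus by (rule minus_unique)
      then show ?thesis using False by (intro exI[of _ "- a"] exI[of _ p]) auto
    qed
  qed simp
  moreover obtain p where "poly (map_poly of_int p) x = 0" "Polynomial.lead_coeff (p :: int poly) = 1"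
    using assms unfolding OK_def algebraic_int_altdef_ipoly by auto
  moreover from this(2) have "p \<noteq> 0" by auto
  ultimately obtain N q where "N \<noteq> 0" "of_int N = x * poly (map_poly of_int q) x" by blast
  moreover have "poly (map_poly of_int q) x \<in> OK" for q :: "int poly"
    by (induction q) (auto intro!: OK_intros assms)
  ultimately show ?thesis by blast
qed

lemma K_eq_quotient:
  assumes "x \<in> K"
  shows "\<exists>d a. d > 0 \<and> a \<in> OK \<and> x = a / of_int d"
proof -
  obtain p where p: "x = rat_poly_eval p \<alpha>" using assms by (auto simp: K_def)
  obtain d q where d: "d > 0" "Polynomial.smult (of_int d) p = map_poly of_int (q :: int poly)"
    using clear_denominators[of p] by auto
  have "rat_poly_eval (map_poly of_int q) \<alpha> \<in> OK" for q :: "int poly"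
    by (induction q) (auto simp: rat_poly_eval_pCons intro!: OK_intros)
  then have "of_int d * x \<in> OK"
    by (simp add: p flip: d(2)) (metis d(2) of_rat_of_int_eq rat_poly_eval_smult)
  then show ?thesis using d(1) by (intro exI[of _ d] exI[of _ "of_int d * x"]) auto
qed

text \<open>The exponent is bounded because \<open>x\<close> divides a nonzero integer
  \<open>N\<close>: if \<open>\<alpha> ^ (n * k)\<close> divides \<open>x\<close>, then
  \<open>3 ^ k\<close> divides \<open>N\<close>. For \<open>k = nat \<bar>N\<bar>\<close> this is
  impossible by size.\<close>

lemma P_valuation:
  assumes "x \<in> OK" "x \<noteq> 0"
  obtains e y where "y \<in> OK" "y \<notin> P 1" "x = \<alpha> ^ e * y"
proof -
  obtain N y where N: "N \<noteq> 0" "y \<in> OK" "of_int N = x * y"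
    using nonzero_integer_multiple[OF assms] by auto
  have bound: "e < n * (nat \<bar>N\<bar>)" if "x \<in> P e" for e
  proof (rule ccontr)
    define k where "k = nat \<bar>N\<bar>"
    assume "\<not> e < n * nat \<bar>N\<bar>"
    then have "x \<in> P (n * k)" using that P_antimono[of "n * k" e] by (auto simp: k_def)
    then obtain z where z: "z \<in> OK" "x = \<alpha> ^ (n * k) * z" by (auto simp: P_def)
    have "algebraic_int (v ^ k * z * y)"
      using z N OK_intros by (auto simp: OK_def intro!: algebraic_int_mult algebraic_int_power algebraic_int_unit)
    moreover have "of_int N = of_int (3 ^ k) * (v ^ k * z * y)"
      unfolding N(3) z(2) by (simp add: power_mult \<alpha>_power_n power_mult_distrib)
    then have "of_int N / of_int (3 ^ k) = v ^ k * z * y" by (simp add: field_simps)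
    moreover have "of_int N / of_int (3 ^ k) \<in> (\<rat> :: complex set)" by simp
    ultimately have "of_int N / of_int (3 ^ k) \<in> (\<int> :: complex set)"
      by (metis rational_algebraic_int_is_int)
    then obtain M where "of_int N / of_int (3 ^ k) = (of_int M :: complex)" by (auto elim: Ints_cases)
    then have "of_int N = (of_int (3 ^ k * M) :: complex)" by (simp add: field_simps)
    then have "N = 3 ^ k * M" by (simp only: of_int_eq_iff)
    then have "3 ^ k \<le> \<bar>N\<bar>" using N(1) by (intro zdvd_imp_le) auto
    moreover have "k < 3 ^ k" by (rule less_le_trans[OF less_exp]) (simp add: power_mono)
    then have "int k < int (3 ^ k)" by (simp only: of_nat_less_iff)
    ultimately show False by (simp add: k_def)
  qed
  define e where "e = (GREATEST e. x \<in> P e)"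
  have "x \<in> P 0" using assms by (simp add: P_def)
  then have e: "x \<in> P e" unfolding e_def
    by (rule GreatestI_nat[where b = "n * nat \<bar>N\<bar>"]) (use bound in \<open>auto simp: less_imp_le\<close>)
  have max: "x \<notin> P (Suc e)"
  proof
    assume "x \<in> P (Suc e)"
    then have "Suc e \<le> e" unfolding e_def
      by (rule Greatest_le_nat[where b = "n * nat \<bar>N\<bar>"]) (use bound in \<open>auto simp: less_imp_le\<close>)
    then show False by simp
  qed
  from e obtain y where y: "y \<in> OK" "x = \<alpha> ^ e * y" by (auto simp: P_def)
  have "y \<notin> P 1"
  proof
    assume "y \<in> P 1"
    then obtain z where "z \<in> OK" "y = \<alpha> * z" by (auto simp: P_def)
    then have "x \<in> P (Suc e)" using y P_I[of z "Suc e"] by (simp add: mult_ac)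
    with max show False by simp
  qed
  then show ?thesis using that y by blast
qed

lemma \<alpha>_power_mult_in_P:
  assumes "y \<in> OK" "y \<notin> P 1"
  shows "\<alpha> ^ e * y \<in> P d \<longleftrightarrow> d \<le> e"
proof
  assume "\<alpha> ^ e * y \<in> P d"
  then obtain z where z: "z \<in> OK" "\<alpha> ^ e * y = \<alpha> ^ d * z" by (auto simp: P_def)
  show "d \<le> e"
  proof (rule ccontr)
    assume "\<not> d \<le> e"
    then have "d = e + Suc (d - e - 1)" by simp
    then have "\<alpha> ^ e * y = \<alpha> ^ e * (\<alpha> ^ 1 * (\<alpha> ^ (d - e - 1) * z))"
      using z(2) by (metis mult.assoc power_Suc power_add power_one_right)
    then have "y = \<alpha> ^ 1 * (\<alpha> ^ (d - e - 1) * z)" using \<alpha>_nz by simp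
    then show False using assms(2) P_I[of "\<alpha> ^ (d - e - 1) * z" 1] z(1) OK_intros by auto
  qed
qed (use assms P_antimono P_I in blast)

lemma prime_ord_P:
  assumes "y \<in> OK" "y \<notin> P 1"
  shows "prime_ord K (P 1) (\<alpha> ^ e * y) = e"
  unfolding prime_ord_def ideal_pow_P \<alpha>_power_mult_in_P[OF assms]
  by (rule Greatest_equality) auto

text \<open>The definite description in \<open>prime_val\<close> requires that the difference of
  orders does not depend on the quotient representing \<open>x\<close>. Cross-multiplying two
  representations shows this, since primality keeps products of cofactors outside
  \<open>P 1\<close>.\<close>

lemma prime_val_P:
  assumes "y \<in> OK" "y \<notin> P 1" "z \<in> OK" "z \<notin> P 1" "x = (\<alpha> ^ d * y) / (\<alpha> ^ e * z)"
  shows "prime_val K (P 1) x = int d - int e"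
  unfolding prime_val_def
proof (rule the_equality)
  have nz: "y \<noteq> 0" "z \<noteq> 0" using assms P_0 by auto
  then show "\<exists>a b. a \<in> carrier R - {0} \<and> b \<in> carrier R - {0} \<and> x = a / b \<and>
      int d - int e = int (prime_ord K (P 1) a) - int (prime_ord K (P 1) b)"
    using assms \<alpha>_nz OK_intros
    by (intro exI[of _ "\<alpha> ^ d * y"] exI[of _ "\<alpha> ^ e * z"]) (auto simp: prime_ord_P)
next
  fix k assume "\<exists>a b. a \<in> carrier R - {0} \<and> b \<in> carrier R - {0} \<and> x = a / b \<and>
      k = int (prime_ord K (P 1) a) - int (prime_ord K (P 1) b)"
  then obtain a b where ab: "a \<in> OK" "a \<noteq> 0" "b \<in> OK" "b \<noteq> 0" "x = a / b"
    "k = int (prime_ord K (P 1) a) - int (prime_ord K (P 1) b)" by auto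
  obtain d' a' where a: "a' \<in> OK" "a' \<notin> P 1" "a = \<alpha> ^ d' * a'" using P_valuation[OF ab(1,2)] .
  obtain e' b' where b: "b' \<in> OK" "b' \<notin> P 1" "b = \<alpha> ^ e' * b'" using P_valuation[OF ab(3,4)] .
  have nz: "y \<noteq> 0" "z \<noteq> 0" using assms P_0 by auto
  have "a * (\<alpha> ^ e * z) = b * (\<alpha> ^ d * y)"
    using ab(4,5) assms(5) nz \<alpha>_nz by (simp add: field_simps)
  then have eq: "\<alpha> ^ (d' + e) * (a' * z) = \<alpha> ^ (e' + d) * (b' * y)"
    by (simp add: a b power_add mult_ac)
  have "a' * z \<notin> P 1" "b' * y \<notin> P 1" using prime_P a b assms by blast+
  then have "prime_ord K (P 1) (\<alpha> ^ (d' + e) * (a' * z)) = d' + e"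
    "prime_ord K (P 1) (\<alpha> ^ (e' + d) * (b' * y)) = e' + d"
    using a b assms by (intro prime_ord_P OK_mult; simp)+
  then have "d' + e = e' + d" using eq by simp
  then show "k = int d - int e" using ab(6) a b by (simp add: prime_ord_P)
qed

lemma integral_at_P:
  assumes "x \<in> OK"
  shows "integral_at K (P 1) x"
proof (cases "x = 0")
  case False
  then obtain e y where "y \<in> OK" "y \<notin> P 1" "x = \<alpha> ^ e * y" using P_valuation assms by metis
  then have "prime_val K (P 1) x = int e - int 0"
    using OK_1 one_notin_P by (intro prime_val_P[of y 1]) auto
  then show ?thesis by (simp add: integral_at_def)
qed (simp add: integral_at_def)

end

section \<open>The curve \<open>y\<^sup>2 + y = x\<^sup>3\<close>\<close>

definition E0 :: weierstrass where "E0 = Weierstrass 0 0 1 0 0"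

lemma discriminant_E0: "discriminant E0 = - 27"
  by (simp add: E0_def discriminant_def b2_def b4_def b6_def b8_def)

lemma j_invariant_E0: "j_invariant E0 = 0"
  by (simp add: E0_def j_invariant_def c4_def b2_def b4_def)

lemma discriminant_change_vars_E0:
  assumes "u \<noteq> 0"
  shows "discriminant (change_vars u r s t E0) = - 27 / u ^ 12"
proof -
  define i where "i = inverse u"
  define W where "W = change_vars u r s t E0"
  have W: "a1 W = 2 * s * i" "a2 W = (3 * r - s\<^sup>2) * i ^ 2" "a3 W = (1 + 2 * t) * i ^ 3"
    "a4 W = (3 * r\<^sup>2 - s - 2 * s * t) * i ^ 4" "a6 W = (r ^ 3 - t - t\<^sup>2) * i ^ 6"
    unfolding W_def change_vars_def E0_def i_def by (simp_all add: divide_inverse power_inverse)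
  note ring = algebra_simps eval_nat_numeral
  \<comment> \<open>The b-invariants belong to the equation after completing the square, so
    \<open>s\<close> and \<open>t\<close> drop out and only \<open>r\<close> is left.\<close>
  have b2: "b2 W = 12 * r * i ^ 2"
    unfolding b2_def W by (simp add: ring)
  have b4: "b4 W = 6 * r ^ 2 * i ^ 4"
    unfolding b4_def W by (simp add: ring)
  have b6: "b6 W = (1 + 4 * r ^ 3) * i ^ 6"
    unfolding b6_def W by (simp add: ring)
  have b8: "b8 W = (3 * r + 3 * r ^ 4) * i ^ 8"
    unfolding b8_def W by (simp add: ring)
  have "discriminant W = - 27 * i ^ 12"
    unfolding discriminant_def b2 b4 b6 b8 by (simp add: ring)
  then show ?thesis by (simp add: W_def i_def divide_inverse power_inverse)
qed

section \<open>The minimal discriminant of \<open>E0\<close> over \<open>K\<close>\<close>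

context ramified_tower
begin

definition k :: nat where "k = n div 4"

text \<open>The shift leaves the numerators \<open>0\<close>, \<open>3 * c\<close>,
  \<open>3\<close>, \<open>3 * c ^ 2\<close> and \<open>c ^ 3 - 2 = 0\<close>. The nonzero ones are
  divided by at most \<open>\<alpha> ^ (4 * k)\<close>, which divides \<open>3\<close> because
  \<open>4 * k < n\<close>. The discriminant becomes \<open>- ((w * \<alpha>) ^ 3)\<close>.\<close>

lemma change_vars_E0_at_P:
  assumes "n mod 4 = 1"
  shows "coeffs_in {x \<in> K. integral_at K (P 1) x} (change_vars (\<alpha> ^ k) c 0 1 E0)"
    and "prime_val K (P 1) (discriminant (change_vars (\<alpha> ^ k) c 0 1 E0)) = 3"
proof -
  have n: "n = 4 * k + 1" using assms by (simp add: k_def) presburger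
  have nz: "\<alpha> ^ k \<noteq> 0" using \<alpha>_nz by simp
  have three: "3 / \<alpha> ^ i = w * \<alpha> ^ (n - i)" if "i \<le> n" for i
    using that \<alpha>_nz \<alpha>_power_n_w by (simp add: power_diff mult.commute)
  have in_OK: "w * \<alpha> ^ i \<in> OK" for i by (intro OK_intros)
  have *: "3 / \<alpha> ^ (k * i) \<in> OK" if "i \<le> 4" for i
  proof -
    have "k * i \<le> n" using mult_le_mono2[OF that, of k] n by linarith
    then show ?thesis using in_OK three by simp
  qed
  have "{0, c * (3 / \<alpha> ^ (k * 2)), 3 / \<alpha> ^ (k * 3), c ^ 2 * (3 / \<alpha> ^ (k * 4))} \<subseteq> OK"
    using *[of 2] *[of 3] *[of 4]
    by (auto simp del: times_divide_eq_right intro!: OK_intros)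
  moreover have "OK \<subseteq> {x \<in> K. integral_at K (P 1) x}"
    using integral_at_P by (auto simp: OK_def)
  ultimately have "{0, c * (3 / \<alpha> ^ (k * 2)), 3 / \<alpha> ^ (k * 3), c ^ 2 * (3 / \<alpha> ^ (k * 4))}
      \<subseteq> {x \<in> K. integral_at K (P 1) x}" by (rule subset_trans)
  then show "coeffs_in {x \<in> K. integral_at K (P 1) x} (change_vars (\<alpha> ^ k) c 0 1 E0)"
    by (simp add: coeffs_in_def change_vars_def E0_def c_cube power_mult mult.commute)
  have "- 27 / (\<alpha> ^ k) ^ 12 = - ((3 / \<alpha> ^ (k * 4)) ^ 3)"
    by (simp add: power_divide mult.commute flip: power_mult)
  also have "3 / \<alpha> ^ (k * 4) = w * \<alpha>"
    using three[of "k * 4"] n by (simp add: mult.commute)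
  finally have "discriminant (change_vars (\<alpha> ^ k) c 0 1 E0) = (\<alpha> ^ 3 * (- 1 * w ^ 3)) / (\<alpha> ^ 0 * 1)"
    unfolding discriminant_change_vars_E0[OF nz] by (simp add: power_mult_distrib)
  moreover have "- 1 * w ^ 3 \<notin> P 1"
    using prime_P_power[OF OK_w w_notin_P, of 3] P_uminus[of "- (w ^ 3)" 1] by auto
  moreover have "- 1 * w ^ 3 \<in> OK" by (intro OK_intros)
  ultimately have "prime_val K (P 1) (discriminant (change_vars (\<alpha> ^ k) c 0 1 E0)) = int 3 - int 0"
    using OK_1 one_notin_P by (intro prime_val_P[of "- 1 * w ^ 3" 1])
  then show "prime_val K (P 1) (discriminant (change_vars (\<alpha> ^ k) c 0 1 E0)) = 3" by simp
qed

text \<open>If \<open>u\<close> is a quotient with exponents \<open>e\<close> and \<open>g\<close>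
  of \<open>\<alpha>\<close> in numerator and denominator, then
  \<open>d + 12 * e = 3 * n + 12 * g\<close>. Oddness is the way in which \<open>d = 0\<close>, that
  is good reduction, is excluded.\<close>

lemma odd_prime_val_discriminant:
  assumes "odd n" "isomorphic_over K E0 W" "prime_val K (P 1) (discriminant W) = int d"
  shows "odd d"
proof -
  obtain u r s t where u: "u \<in> K" "u \<noteq> 0" "W = change_vars u r s t E0"
    using assms(2) by (auto simp: isomorphic_over_def)
  obtain N a where a: "N > 0" "a \<in> OK" "u = a / of_int N"
    using K_eq_quotient[OF u(1)] by auto
  have "a \<noteq> 0" using a u by auto
  then obtain e y where y: "y \<in> OK" "y \<notin> P 1" "a = \<alpha> ^ e * y" using P_valuation[OF a(2)] by metis
  obtain g z where z: "z \<in> OK" "z \<notin> P 1" "of_int N = \<alpha> ^ g * z"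
    using P_valuation[OF OK_of_int, of N] a(1) by (metis less_irrefl of_int_eq_0_iff)
  have nz: "y \<noteq> 0" "z \<noteq> 0" using y z P_0 by auto
  have "discriminant W = (\<alpha> ^ n * w) ^ 3 * (- 1) / u ^ 12"
    by (simp add: u discriminant_change_vars_E0 \<alpha>_power_n_w)
  also have "\<dots> = (\<alpha> ^ (3 * n + 12 * g) * (- 1 * (w ^ 3 * z ^ 12))) / (\<alpha> ^ (12 * e) * y ^ 12)"
    unfolding a(3) y(3) z(3) using nz \<alpha>_nz
    by (simp add: field_simps power_mult_distrib power_add power_divide flip: power_mult)
  finally have disc: "discriminant W
      = (\<alpha> ^ (3 * n + 12 * g) * (- 1 * (w ^ 3 * z ^ 12))) / (\<alpha> ^ (12 * e) * y ^ 12)" .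
  have "w ^ 3 * z ^ 12 \<notin> P 1"
    using prime_P[of "w ^ 3" "z ^ 12"] prime_P_power[OF OK_w w_notin_P, of 3] prime_P_power[OF z(1,2), of 12]
      OK_power OK_w z(1) by auto
  then have "- 1 * (w ^ 3 * z ^ 12) \<notin> P 1" using P_uminus[of "- (w ^ 3 * z ^ 12)" 1] by auto
  moreover have "- 1 * (w ^ 3 * z ^ 12) \<in> OK" using z by (intro OK_intros)
  moreover have "y ^ 12 \<in> OK" "y ^ 12 \<notin> P 1" using y prime_P_power OK_power by auto
  ultimately have "prime_val K (P 1) (discriminant W) = int (3 * n + 12 * g) - int (12 * e)"
    using disc by (intro prime_val_P)
  then have "int d + 12 * int e = 3 * int n + 12 * int g" using assms(3) by simp
  then have "d + 12 * e = 3 * n + 12 * g" by linarith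
  then show ?thesis using assms(1) by presburger
qed

lemma min_disc_ord_P:
  assumes "n mod 4 = 1"
  shows "0 < min_disc_ord K E0 (P 1)" "min_disc_ord K E0 (P 1) \<le> 3"
proof -
  define A where "A = (\<lambda>d. \<exists>W. isomorphic_over K E0 W \<and>
    coeffs_in {x \<in> K. integral_at K (P 1) x} W \<and> prime_val K (P 1) (discriminant W) = int d)"
  have "isomorphic_over K E0 (change_vars (\<alpha> ^ k) c 0 1 E0)"
    unfolding isomorphic_over_def using \<alpha>_nz K_power[OF K_\<alpha>] K_c K_0 K_1
    by (intro bexI[of _ "\<alpha> ^ k"] bexI[of _ c] bexI[of _ 0] bexI[of _ 1]) auto
  then have A: "A 3"
    unfolding A_def using change_vars_E0_at_P[OF assms]
    by (intro exI[of _ "change_vars (\<alpha> ^ k) c 0 1 E0"]) simp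
  have ord: "min_disc_ord K E0 (P 1) = (LEAST d. A d)" by (simp add: min_disc_ord_def A_def)
  then show "min_disc_ord K E0 (P 1) \<le> 3" using A by (simp add: Least_le)
  have "odd n" using assms by presburger
  moreover have "A (min_disc_ord K E0 (P 1))" unfolding ord using A by (rule LeastI)
  ultimately have "odd (min_disc_ord K E0 (P 1))"
    unfolding A_def using odd_prime_val_discriminant by blast
  then show "0 < min_disc_ord K E0 (P 1)" by (simp add: odd_pos)
qed

text \<open>Such a prime contains \<open>\<alpha> ^ n = 3 * v\<close> and hence
  \<open>\<alpha>\<close>; by the digit decomposition any element outside \<open>P 1\<close> would
  put \<open>1\<close> or \<open>2\<close>, and therefore \<open>1\<close>, into
  \<open>Q\<close>.\<close>

lemma three_in_prime:
  assumes "primeideal Q R" "3 \<in> Q"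
  shows "Q = P 1"
proof -
  interpret Q: primeideal Q R by (rule assms)
  have one: "1 \<notin> Q" using Q.one_imp_carrier Q.I_notcarr by auto
  have add: "x \<in> Q \<Longrightarrow> y \<in> Q \<Longrightarrow> x + y \<in> Q" for x y using additive_subgroup.a_closed[OF Q.is_additive_subgroup, of x y] by simp
  have mult: "x \<in> Q \<Longrightarrow> y \<in> OK \<Longrightarrow> y * x \<in> Q" for x y using Q.I_l_closed[of x y] by simp
  have prime: "x \<in> OK \<Longrightarrow> y \<in> OK \<Longrightarrow> x * y \<in> Q \<Longrightarrow> x \<in> Q \<or> y \<in> Q" for x y
    using Q.I_prime[of x y] by simp
  have "v * 3 \<in> Q" using assms(2) OK_v by (intro mult)
  then have "\<alpha> ^ n \<in> Q" by (simp add: \<alpha>_power_n mult.commute)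
  have "\<alpha> ^ i \<in> Q \<Longrightarrow> \<alpha> \<in> Q" for i
  proof (induction i)
    case (Suc i)
    then show ?case using prime[OF OK_\<alpha> OK_power[OF OK_\<alpha>], of i] by auto
  qed (use one in simp)
  then have \<alpha>: "\<alpha> \<in> Q" using \<open>\<alpha> ^ n \<in> Q\<close> by blast
  show ?thesis
  proof
    show "P 1 \<subseteq> Q" using mult[OF \<alpha>] by (auto simp: P_def mult.commute)
    show "Q \<subseteq> P 1"
    proof
      fix x assume "x \<in> Q"
      then have "x \<in> OK" using Q.Icarr by simp
      then obtain r y where r: "r \<in> {0, 1, 2}" "y \<in> OK" "x = of_int r + \<alpha> * y"
        using OK_decompose by metis
      have "y * \<alpha> \<in> Q" using mult[OF \<alpha> r(2)] .
      then have "x + (- 1) * (y * \<alpha>) \<in> Q"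
        using \<open>x \<in> Q\<close> OK_uminus[OF OK_1] by (intro add mult[of "y * \<alpha>"])
      then have rQ: "of_int r \<in> Q" using r(3) by (simp add: mult.commute)
      have "r \<noteq> 1" using rQ one by auto
      moreover have "r \<noteq> 2"
      proof
        assume "r = 2"
        then have "3 + (- 1) * 2 \<in> Q"
          using rQ assms(2) OK_uminus[OF OK_1] by (intro add mult) auto
        then show False using one by simp
      qed
      ultimately have "r = 0" using r(1) by auto
      then show "x \<in> P 1" using r P_I[of y 1] by simp
    qed
  qed
qed

text \<open>No factorisation theory is needed away from \<open>3\<close>: multiplication by an element that is
  invertible modulo all powers of \<open>Q\<close> does not change membership in these powers.\<close>

lemma prime_val_unit:
  assumes "x \<in> OK" "x \<noteq> 0" "\<And>e b. b \<in> OK \<Longrightarrow> x * b \<in> ideal_pow K Q e \<longleftrightarrow> b \<in> ideal_pow K Q e"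
  shows "prime_val K Q x = 0"
  unfolding prime_val_def
proof (rule the_equality)
  have ord: "prime_ord K Q (x * b) = prime_ord K Q b" if "b \<in> OK" for b
    using assms(3)[OF that] by (simp add: prime_ord_def)
  show "\<exists>a b. a \<in> carrier R - {0} \<and> b \<in> carrier R - {0} \<and> x = a / b \<and>
      0 = int (prime_ord K Q a) - int (prime_ord K Q b)"
    using ord[OF OK_1] assms(1,2) OK_1 by (intro exI[of _ x] exI[of _ 1]) simp
  fix d assume "\<exists>a b. a \<in> carrier R - {0} \<and> b \<in> carrier R - {0} \<and> x = a / b \<and>
      d = int (prime_ord K Q a) - int (prime_ord K Q b)"
  then obtain a b where "b \<in> OK" "b \<noteq> 0" "x = a / b"
    "d = int (prime_ord K Q a) - int (prime_ord K Q b)" by auto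
  moreover from this have "a = x * b" by simp
  ultimately show "d = 0" using ord by simp
qed

text \<open>\<open>E0\<close> itself has integral coefficients and discriminant \<open>- 27\<close>,
  a unit at \<open>Q\<close>, so its exponent \<open>0\<close> is already minimal.\<close>

lemma min_disc_ord_away:
  assumes "Q \<in> nonzero_primes K" "Q \<noteq> P 1"
  shows "min_disc_ord K E0 Q = 0"
proof -
  have Q: "primeideal Q R" "Q \<noteq> {0}" using assms by (auto simp: nonzero_primes_def)
  interpret Q: primeideal Q R by (rule Q)
  have ideal: "ideal Q R" by (rule Q.is_ideal)
  have three: "3 \<notin> Q" using three_in_prime[OF Q(1)] assms(2) by auto
  obtain x where x: "x \<in> Q" "x \<noteq> 0" using Q(2) additive_subgroup.zero_closed[OF Q.is_additive_subgroup] by auto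
  then obtain N y where N: "N \<noteq> 0" "y \<in> OK" "of_int N = x * y"
    using nonzero_integer_multiple Q.Icarr by (metis R_simps(1))
  have "of_int N \<in> Q" using Q.I_r_closed[of x y] x N by simp
  \<comment> \<open>\<open>Q\<close> contains a nonzero ordinary integer; as \<open>Q\<close> is
    prime and \<open>3 \<notin> Q\<close>, its factors \<open>3\<close> can be cancelled.\<close>
  then have "\<exists>M. of_int M \<in> Q \<and> \<not> 3 dvd M" using N(1)
  proof (induction "nat \<bar>N\<bar>" arbitrary: N rule: less_induct)
    case less
    show ?case
    proof (cases "3 dvd N")
      case True
      then obtain M where M: "N = 3 * M" by auto
      then have "3 \<otimes>\<^bsub>R\<^esub> of_int M \<in> Q" using less.prems by simp
      then have "of_int M \<in> Q" using Q.I_prime[of 3 "of_int M"] three OK_of_int OK_numeral by auto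
      then show ?thesis using less.hyps[of M] less.prems M by auto
    qed (use less in blast)
  qed
  then obtain M where M: "of_int M \<in> Q" "\<not> 3 dvd M" by auto
  have val27: "prime_val K Q (- 27) = 0"
  proof (rule prime_val_unit)
    show "- 27 \<in> OK" "(- 27 :: complex) \<noteq> 0" by (auto intro: OK_intros)
    fix e b assume b: "b \<in> OK"
    interpret I: ideal "ideal_pow K Q e" R by (rule ideal_ideal_pow[OF ideal])
    \<comment> \<open>\<open>27\<close> is inverted modulo the \<open>e\<close>-th power of
      \<open>Q\<close> by means of \<open>M ^ e\<close>, which lies in that power.\<close>
    have "coprime (3 ^ 3) (M ^ e)"
      using M(2) prime_imp_coprime[of 3 M] by (intro coprime_power_left_iff[THEN iffD2] coprime_power_right_iff[THEN iffD2]) auto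
    then obtain s t where st: "s * 3 ^ 3 + t * M ^ e = 1"
      using bezout_coefficients_fst_snd[of "3 ^ 3" "M ^ e"] by (metis coprime_imp_gcd_eq_1)
    have Me: "of_int (M ^ e) \<in> ideal_pow K Q e"
      using power_in_ideal_pow[OF ideal M(1), of e] by simp
    show "- 27 * b \<in> ideal_pow K Q e \<longleftrightarrow> b \<in> ideal_pow K Q e"
    proof
      assume *: "- 27 * b \<in> ideal_pow K Q e"
      have "of_int (- s) \<otimes>\<^bsub>R\<^esub> (- 27 * b) \<oplus>\<^bsub>R\<^esub> (of_int t * b) \<otimes>\<^bsub>R\<^esub> of_int (M ^ e) \<in> ideal_pow K Q e"
        using b by (intro I.a_closed I.I_l_closed * Me) (simp_all only: R_simps OK_intros)
      also have "of_int (- s) \<otimes>\<^bsub>R\<^esub> (- 27 * b) \<oplus>\<^bsub>R\<^esub> (of_int t * b) \<otimes>\<^bsub>R\<^esub> of_int (M ^ e)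
          = of_int (s * 3 ^ 3 + t * M ^ e) * b" by (simp add: algebra_simps)
      finally show "b \<in> ideal_pow K Q e" by (simp only: st of_int_1 mult_1)
    next
      assume "b \<in> ideal_pow K Q e"
      then have "- 27 \<otimes>\<^bsub>R\<^esub> b \<in> ideal_pow K Q e"
        by (rule I.I_l_closed) (simp add: OK_uminus OK_numeral)
      then show "- 27 * b \<in> ideal_pow K Q e" by simp
    qed
  qed
  have val1: "prime_val K Q 1 = 0" by (rule prime_val_unit) (auto simp: OK_1)
  have "change_vars 1 0 0 0 E0 = E0" by (simp add: change_vars_def E0_def)
  then have "isomorphic_over K E0 E0"
    unfolding isomorphic_over_def using K_0 K_1
    by (intro bexI[of _ 1] bexI[of _ 0]) auto
  moreover have "coeffs_in {x \<in> K. integral_at K Q x} E0"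
    using val1 K_0 K_1 by (auto simp: coeffs_in_def E0_def integral_at_def)
  ultimately have "\<exists>W. isomorphic_over K E0 W \<and> coeffs_in {x \<in> K. integral_at K Q x} W \<and>
      prime_val K Q (discriminant W) = int 0"
    using val27 by (intro exI[of _ E0]) (simp add: discriminant_E0)
  then show ?thesis unfolding min_disc_ord_def by (rule Least_eq_0)
qed

lemma min_disc_ideal_E0:
  assumes "n mod 4 = 1"
  shows "\<exists>e\<in>{1..3}. min_disc_ideal K E0 = P e"
proof -
  define e where "e = min_disc_ord K E0 (P 1)"
  have e: "0 < e" "e \<le> 3" unfolding e_def using min_disc_ord_P[OF assms] by auto
  interpret comm_monoid "ideals_set R" by (rule comm_monoid_ideals)
  have "{Q \<in> nonzero_primes K. min_disc_ord K E0 Q \<noteq> 0} = {P 1}"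
    using min_disc_ord_away P_in_nonzero_primes e unfolding e_def
    by (intro Set.set_eqI) (metis (mono_tags, lifting) mem_Collect_eq neq0_conv singleton_iff)
  then have "min_disc_ideal K E0
      = finprod (ideals_set R) (\<lambda>Q. ideal_pow K Q (min_disc_ord K E0 Q)) {P 1}"
    by (simp add: min_disc_ideal_def)
  also have "\<dots> = P e \<otimes>\<^bsub>ideals_set R\<^esub> \<one>\<^bsub>ideals_set R\<^esub>"
    using ideal_P by (subst finprod_insert) (auto simp: ideal_pow_P e_def)
  also have "\<dots> = P e"
    using ideal_P by (intro r_one) simp
  finally show ?thesis using e by (intro bexI[of _ e]) auto
qed

text \<open>Every embedding fixes \<open>0\<close>, so each of the \<open>n\<close> archimedean
  terms is the same \<open>L\<close>; divided by \<open>12 * n\<close> they give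
  \<open>L / 12\<close> whatever the field, and only the finite part depends on
  \<open>n\<close>.\<close>

lemma faltings_height_E0:
  assumes "n mod 4 = 1"
    and tau: "ln (cmod (modular_discriminant (tau_of 0)) * Im (tau_of 0) ^ 6) = L"
  shows "\<exists>N\<in>{2..27::nat}. faltings_height K E0 = ln N / (12 * n) - L / 12 + 1 / 2 * ln pi"
proof -
  obtain e where e: "e \<in> {1..3}" "min_disc_ideal K E0 = P e" using min_disc_ideal_E0[OF assms(1)] by auto
  define N where "N = ideal_norm K (P e)"
  have "(3 :: nat) ^ e \<le> 3 ^ 3" using e(1) by (intro power_increasing) auto
  then have N: "N \<in> {2..27}" unfolding N_def using ideal_norm_P[of e] e(1) by auto
  have "(\<Sum>\<sigma>\<in>embeddings K. let \<tau> = tau_of (\<sigma> (j_invariant E0)) in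
          ln (cmod (modular_discriminant \<tau>) * Im \<tau> ^ 6)) = (\<Sum>\<sigma>\<in>embeddings K. L)"
    by (intro sum.cong refl) (simp add: j_invariant_E0 embedding_0 tau Let_def)
  then have "faltings_height K E0 = 1 / (12 * n) * (ln N - n * L) + 1 / 2 * ln pi"
    by (simp add: faltings_height_def field_degree_K e(2) N_def card_embeddings)
  also have "1 / (12 * n) * (ln N - n * L) = ln N / (12 * n) - L / 12"
    using n_pos by (simp add: field_simps)
  finally show ?thesis using N by (intro bexI[of _ N]) auto
qed

lemma elliptic_curve_E0: "elliptic_curve K E0"
  using K_0 K_1 by (simp add: elliptic_curve_def discriminant_E0) (simp add: coeffs_in_def E0_def)

end

lemma small_height:
  assumes "\<epsilon> > 0" and tau: "ln (cmod (modular_discriminant (tau_of 0)) * Im (tau_of 0) ^ 6) = L"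
  shows "\<exists>K E. number_field K \<and> elliptic_curve K E \<and> j_invariant E = 0 \<and>
    - L / 12 + 1 / 2 * ln pi < faltings_height K E \<and>
    faltings_height K E < - L / 12 + 1 / 2 * ln pi + \<epsilon>"
proof -
  obtain i :: nat where i: "ln 27 / \<epsilon> < real i" using reals_Archimedean2 by blast
  \<comment> \<open>Then \<open>n = 12 * i + 9\<close>, which is \<open>1\<close> modulo
    \<open>4\<close> and large enough for \<open>ln 27 / (12 * n) < \<epsilon>\<close>.\<close>
  define m where "m = 4 * i + 3"
  define z where "z = complex_of_real (root m (root 3 2 + 1))"
  have z: "z ^ m = of_real (root 3 2) + 1"
    unfolding z_def by (simp add: m_def flip: of_real_power)
  interpret ramified_tower z m
  proof
    show "m > 0" by (simp add: m_def)
    have "complex_of_real (root 3 2) ^ 3 = of_real (root 3 2 ^ 3)" by (simp only: of_real_power)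
    also have "root 3 2 ^ 3 = (2 :: real)" by (rule real_root_pow_pos) auto
    finally show "(z ^ m - 1) ^ 3 = 2" by (simp add: z)
  qed
  have n: "n = 3 * (4 * i + 3)" by (simp only: n_def) (simp add: m_def)
  then have "n mod 4 = 1" by presburger
  from faltings_height_E0[OF this tau] obtain N :: nat where N: "2 \<le> N" "N \<le> 27"
    "faltings_height K E0 = ln N / (12 * n) - L / 12 + 1 / 2 * ln pi" by auto
  have "0 < ln N / (12 * n)" using N(1) n_pos by simp
  moreover have "ln N / (12 * n) < \<epsilon>"
  proof -
    have "ln N \<le> ln 27" using N by simp
    also have "\<dots> < \<epsilon> * i" using i assms(1) by (simp add: field_simps)
    also have "\<dots> \<le> \<epsilon> * (12 * n)" using assms(1) by (intro mult_left_mono) (auto simp: n)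
    finally show ?thesis using n_pos by (simp add: field_simps)
  qed
  ultimately show ?thesis
    using number_field_K elliptic_curve_E0 j_invariant_E0 N(3)
    by (intro exI[of _ K] exI[of _ E0]) auto
qed

section \<open>The Weierstrass function\<close>

text \<open>The Weierstrass test on a disc, combined with termwise differentiation of uniform limits
  of holomorphic functions. The majorant \<open>M\<close> is asked for outside a finite set
  \<open>F\<close>, because lattice points close to the disc violate it; compactness bounds those
  terms.\<close>

lemma termwise_derivative:
  fixes f f' :: "'a \<Rightarrow> complex \<Rightarrow> complex"
  assumes r: "r > 0"
    and deriv: "\<And>w z. w \<in> A \<Longrightarrow> z \<in> cball z\<^sub>0 r \<Longrightarrow> (f w has_field_derivative f' w z) (at z)"
    and fin: "finite F"
    and bound: "\<And>w z. w \<in> A - F \<Longrightarrow> z \<in> cball z\<^sub>0 r \<Longrightarrow> norm (f w z) \<le> M w"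
    and M: "M summable_on A"
  shows "((\<lambda>z. \<Sum>\<^sub>\<infinity>w\<in>A. f w z) has_field_derivative (\<Sum>\<^sub>\<infinity>w\<in>A. f' w z\<^sub>0)) (at z\<^sub>0)"
    and "(\<lambda>w. f w z\<^sub>0) summable_on A"
proof -
  have cont: "continuous_on (cball z\<^sub>0 r) (f w)" if "w \<in> A" for w
    using deriv[OF that] by (intro continuous_at_imp_continuous_on ballI DERIV_isCont)
  have "\<exists>B. \<forall>z\<in>cball z\<^sub>0 r. norm (f w z) \<le> B" if "w \<in> A" for w
    using compact_continuous_image[OF cont[OF that] compact_cball, THEN compact_imp_bounded]
    by (auto simp: bounded_iff)
  then obtain B where B: "\<And>w z. w \<in> A \<Longrightarrow> z \<in> cball z\<^sub>0 r \<Longrightarrow> norm (f w z) \<le> B w"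
    by metis
  define M' where "M' = (\<lambda>w. M w + (if w \<in> F then \<bar>B w\<bar> + \<bar>M w\<bar> else 0))"
  have M': "norm (f w z) \<le> M' w" if "w \<in> A" "z \<in> cball z\<^sub>0 r" for w z
    using bound[of w z] B[OF that] that by (auto simp: M'_def)
  have "(\<lambda>w. if w \<in> F then \<bar>B w\<bar> + \<bar>M w\<bar> else 0) summable_on A"
    by (rule summable_on_cong_neutral[THEN iffD1, OF _ _ _ summable_on_finite[of "F \<inter> A"]])
      (use fin in auto)
  then have M'_sum: "M' summable_on A" unfolding M'_def by (intro summable_on_add M)
  have ul: "uniform_limit (cball z\<^sub>0 r) (\<lambda>Y z. \<Sum>w\<in>Y. f w z) (\<lambda>z. \<Sum>\<^sub>\<infinity>w\<in>A. f w z)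
      (finite_subsets_at_top A)"
    by (rule Weierstrass_m_test_general[OF M' M'_sum])
  have "(\<lambda>w. f w z\<^sub>0) summable_on A"
  proof (rule abs_summable_summable, rule summable_on_comparison_test[OF M'_sum])
    show "norm (f w z\<^sub>0) \<le> M' w" if "w \<in> A" for w using M'[OF that] r by simp
  qed auto
  then show "(\<lambda>w. f w z\<^sub>0) summable_on A" .
  have ev: "\<forall>\<^sub>F Y in finite_subsets_at_top A. continuous_on (cball z\<^sub>0 r) (\<lambda>z. \<Sum>w\<in>Y. f w z) \<and>
      (\<forall>z\<in>ball z\<^sub>0 r. ((\<lambda>z. \<Sum>w\<in>Y. f w z) has_field_derivative (\<Sum>w\<in>Y. f' w z)) (at z))"
  proof (rule eventually_finite_subsets_at_top_weakI)
    fix Y assume Y: "finite Y" "Y \<subseteq> A"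
    have "continuous_on (cball z\<^sub>0 r) (\<lambda>z. \<Sum>w\<in>Y. f w z)"
      using Y cont by (intro continuous_on_sum) auto
    moreover have "((\<lambda>z. \<Sum>w\<in>Y. f w z) has_field_derivative (\<Sum>w\<in>Y. f' w z)) (at z)"
      if "z \<in> ball z\<^sub>0 r" for z
      using Y deriv that by (intro DERIV_sum) (auto simp: less_imp_le)
    ultimately show "continuous_on (cball z\<^sub>0 r) (\<lambda>z. \<Sum>w\<in>Y. f w z) \<and>
      (\<forall>z\<in>ball z\<^sub>0 r. ((\<lambda>z. \<Sum>w\<in>Y. f w z) has_field_derivative (\<Sum>w\<in>Y. f' w z)) (at z))"
      by blast
  qed
  obtain g' where g': "\<And>z. z \<in> ball z\<^sub>0 r \<Longrightarrow> ((\<lambda>z. \<Sum>\<^sub>\<infinity>w\<in>A. f w z) has_field_derivative g' z) (at z) \<and>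
      ((\<lambda>Y. \<Sum>w\<in>Y. f' w z) \<longlongrightarrow> g' z) (finite_subsets_at_top A)"
    using has_complex_derivative_uniform_limit[OF ev ul finite_subsets_at_top_neq_bot r] by metis
  have "((\<lambda>w. f' w z\<^sub>0) has_sum g' z\<^sub>0) A"
    unfolding has_sum_def using g'[of z\<^sub>0] r by simp
  then have "g' z\<^sub>0 = (\<Sum>\<^sub>\<infinity>w\<in>A. f' w z\<^sub>0)"
    by (simp add: infsumI)
  then show "((\<lambda>z. \<Sum>\<^sub>\<infinity>w\<in>A. f w z) has_field_derivative (\<Sum>\<^sub>\<infinity>w\<in>A. f' w z\<^sub>0)) (at z\<^sub>0)"
    using g'[of z\<^sub>0] r by auto
qed

text \<open>The exponent is half of \<open>3\<close>: the lattice sum of inverse cubes is dominated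
  by a product of two such sums, because \<open>max a b ^ 3\<close> is at least
  \<open>(a * b) powr (3/2)\<close> for positive \<open>a\<close> and \<open>b\<close>.\<close>

lemma summable_int_powr: "(\<lambda>k::int. (max 1 \<bar>real_of_int k\<bar>) powr (-3/2)) summable_on UNIV"
proof -
  define h where "h = (\<lambda>k::int. (max 1 \<bar>real_of_int k\<bar>) powr (-3/2))"
  have "summable (\<lambda>n::nat. real n powr (-3/2))" by (subst summable_real_powr_iff) simp
  then have "summable (\<lambda>n::nat. norm (h (int n)))"
  proof (rule summable_comparison_test_ev[rotated])
    show "\<forall>\<^sub>F n in sequentially. norm (norm (h (int n))) \<le> real n powr (- 3 / 2)"
      using eventually_gt_at_top[of 0] by eventually_elim (simp add: h_def max_def)
  qed
  then have nat: "(\<lambda>n. h (int n)) summable_on UNIV"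
    by (rule norm_summable_imp_summable_on)
  have "h summable_on range int"
    using nat by (subst summable_on_reindex) (auto simp: o_def)
  moreover have "h summable_on range (\<lambda>n. - int n)"
    using nat by (subst summable_on_reindex) (auto simp: o_def h_def inj_on_def)
  ultimately have "h summable_on (range int \<union> range (\<lambda>n. - int n))"
    by (rule summable_on_union)
  also have "range int \<union> range (\<lambda>n. - int n) = UNIV"
  proof -
    have "k \<in> range int \<union> range (\<lambda>n. - int n)" for k
      by (cases k rule: int_cases2) auto
    then show ?thesis by auto
  qed
  finally show ?thesis by (simp add: h_def)
qed

section \<open>The lattice spanned by \<open>1\<close> and \<open>\<tau>\<close>\<close>

locale tau_lattice =
  fixes \<tau> :: complex
  assumes Im_pos: "Im \<tau> > 0"
begin

definition pt :: "int \<times> int \<Rightarrow> complex" where "pt = (\<lambda>(m, n). of_int m + of_int n * \<tau>)"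
definition L :: "complex set" where "L = range pt"
definition L' :: "complex set" where "L' = L - {0}"

lemma L_I: "of_int m + of_int n * \<tau> \<in> L"
  unfolding L_def pt_def by (rule range_eqI[of _ _ "(m, n)"]) simp

lemma L_E: assumes "w \<in> L" obtains m n where "w = of_int m + of_int n * \<tau>"
  using assms by (auto simp: L_def pt_def)

lemma L_0: "0 \<in> L" and L_1: "1 \<in> L" and L_\<tau>: "\<tau> \<in> L"
  using L_I[of 0 0] L_I[of 1 0] L_I[of 0 1] by simp_all

lemma L_add: "x \<in> L \<Longrightarrow> y \<in> L \<Longrightarrow> x + y \<in> L"
proof -
  assume "x \<in> L" "y \<in> L"
  then obtain m n p q where "x = of_int m + of_int n * \<tau>" "y = of_int p + of_int q * \<tau>"
    by (elim L_E)
  then have "x + y = of_int (m + p) + of_int (n + q) * \<tau>" by (simp add: algebra_simps)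
  then show ?thesis by (simp only: L_I)
qed

lemma L_uminus: "x \<in> L \<Longrightarrow> - x \<in> L"
proof -
  assume "x \<in> L"
  then obtain m n where "x = of_int m + of_int n * \<tau>" by (elim L_E)
  then have "- x = of_int (- m) + of_int (- n) * \<tau>" by simp
  then show ?thesis by (simp only: L_I)
qed

lemma L_diff: "x \<in> L \<Longrightarrow> y \<in> L \<Longrightarrow> x - y \<in> L"
  using L_add[of x "- y"] L_uminus by simp

lemma L_uminus_iff: "- x \<in> L \<longleftrightarrow> x \<in> L"
  using L_uminus[of x] L_uminus[of "- x"] by auto

lemma L_add_iff: "w \<in> L \<Longrightarrow> x + w \<in> L \<longleftrightarrow> x \<in> L"
  using L_add[of x w] L_diff[of "x + w" w] by auto

lemma pt_eq_0: "of_int m + of_int n * \<tau> = 0 \<Longrightarrow> m = 0 \<and> n = 0"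
  using Im_pos by (auto simp: complex_eq_iff)

lemma inj_pt: "inj pt"
proof (rule injI)
  fix x y :: "int \<times> int" assume eq: "pt x = pt y"
  have "of_int (fst x - fst y) + of_int (snd x - snd y) * \<tau> = pt x - pt y"
    by (simp add: pt_def case_prod_beta algebra_simps)
  then show "x = y" using pt_eq_0[of "fst x - fst y" "snd x - snd y"] eq by (simp add: prod_eq_iff)
qed

lemma L'_eq: "L' = pt ` (UNIV - {(0, 0)})"
  using pt_eq_0 by (auto simp: L'_def L_def pt_def)

lemma countable_L: "countable L" by (simp add: L_def)

lemma norm_pt_bound:
  "\<exists>C>0. \<forall>m n. max \<bar>real_of_int m\<bar> \<bar>real_of_int n\<bar> \<le> C * norm (of_int m + of_int n * \<tau>)"
proof -
  define C where "C = 1 + (1 + norm \<tau>) / Im \<tau>"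
  have "max \<bar>real_of_int m\<bar> \<bar>real_of_int n\<bar> \<le> C * norm (of_int m + of_int n * \<tau>)" for m n
  proof -
    let ?w = "of_int m + of_int n * \<tau>"
    have "\<bar>real_of_int n\<bar> * Im \<tau> = \<bar>Im ?w\<bar>" using Im_pos by (simp add: abs_mult)
    also have "\<dots> \<le> norm ?w" by (rule abs_Im_le_cmod)
    finally have n: "\<bar>real_of_int n\<bar> \<le> norm ?w / Im \<tau>" using Im_pos by (simp add: field_simps)
    have "\<bar>real_of_int m\<bar> = norm (?w - of_int n * \<tau>)" by simp
    also have "\<dots> \<le> norm ?w + \<bar>real_of_int n\<bar> * norm \<tau>"
      using norm_triangle_ineq4[of ?w "of_int n * \<tau>"] by (simp add: norm_mult)
    also have "\<dots> \<le> norm ?w + norm ?w / Im \<tau> * norm \<tau>"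
      using n by (intro add_left_mono mult_right_mono) auto
    finally have m: "\<bar>real_of_int m\<bar> \<le> norm ?w + norm ?w / Im \<tau> * norm \<tau>" .
    have C: "C * norm ?w = norm ?w + norm ?w / Im \<tau> + norm ?w / Im \<tau> * norm \<tau>"
      by (simp add: C_def add_divide_distrib distrib_right distrib_left)
    have "norm ?w / Im \<tau> \<ge> 0" "norm ?w / Im \<tau> * norm \<tau> \<ge> 0" using Im_pos by auto
    then show ?thesis using m n C by simp
  qed
  moreover have "C > 0" using Im_pos by (simp add: C_def add_pos_nonneg)
  ultimately show ?thesis by blast
qed

lemma finite_L_ball: "finite (L \<inter> cball 0 r)"
proof -
  obtain C where C: "C > 0"
    "\<And>m n. max \<bar>real_of_int m\<bar> \<bar>real_of_int n\<bar> \<le> C * norm (of_int m + of_int n * \<tau>)"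
    using norm_pt_bound by blast
  define N where "N = \<lceil>C * r\<rceil>"
  have "L \<inter> cball 0 r \<subseteq> pt ` ({-N..N} \<times> {-N..N})"
  proof
    fix w assume w: "w \<in> L \<inter> cball 0 r"
    then obtain m n where mn: "w = of_int m + of_int n * \<tau>" by (auto elim: L_E)
    have "max \<bar>real_of_int m\<bar> \<bar>real_of_int n\<bar> \<le> C * norm w" using C(2) mn by simp
    also have "\<dots> \<le> C * r" using w C(1) by (intro mult_left_mono) auto
    finally have "\<bar>real_of_int m\<bar> \<le> C * r" "\<bar>real_of_int n\<bar> \<le> C * r" by auto
    then have "\<bar>m\<bar> \<le> N" "\<bar>n\<bar> \<le> N" unfolding N_def by linarith+
    then show "w \<in> pt ` ({-N..N} \<times> {-N..N})"
      by (intro image_eqI[of _ _ "(m, n)"]) (auto simp: mn pt_def)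
  qed
  then show ?thesis by (rule finite_subset) auto
qed

lemma summable_norm_cube: "(\<lambda>w. 1 / norm w ^ 3) summable_on L'"
proof -
  obtain C where C: "C > 0"
    "\<And>m n. max \<bar>real_of_int m\<bar> \<bar>real_of_int n\<bar> \<le> C * norm (of_int m + of_int n * \<tau>)"
    using norm_pt_bound by blast
  define h where "h = (\<lambda>k::int. (max 1 \<bar>real_of_int k\<bar>) powr (-3/2))"
  define H where "H = (\<lambda>(m, n). h m * h n)"
  have "((\<lambda>n. H (m, n)) has_sum h m * infsum h UNIV) UNIV" for m
    unfolding H_def prod.case
    using summable_int_powr by (intro has_sum_cmult_right has_sum_infsum) (simp add: h_def)
  moreover have "(\<lambda>m. h m * infsum h UNIV) summable_on UNIV"
    using summable_int_powr by (intro summable_on_cmult_left) (simp add: h_def)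
  moreover have "0 \<le> H x" for x by (simp add: H_def h_def case_prod_beta)
  ultimately have "H summable_on UNIV \<times> UNIV"
    by (rule summable_on_SigmaI[where f = H and g = "\<lambda>m. h m * infsum h UNIV"])
  then have "H summable_on UNIV - {(0, 0)}" by (rule summable_on_subset_banach) simp
  then have "(\<lambda>x. C ^ 3 * H x) summable_on UNIV - {(0, 0)}" by (rule summable_on_cmult_right)
  then have "(\<lambda>x. norm (1 / norm (pt x) ^ 3)) summable_on UNIV - {(0, 0)}"
  proof (rule Infinite_Sum.abs_summable_on_comparison_test')
    fix x :: "int \<times> int" assume x: "x \<in> UNIV - {(0, 0)}"
    obtain m n where mn: "x = (m, n)" by fastforce
    define a where "a = max 1 \<bar>real_of_int m\<bar>"
    define b where "b = max 1 \<bar>real_of_int n\<bar>"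
    define M where "M = max \<bar>real_of_int m\<bar> \<bar>real_of_int n\<bar>"
    have "m \<noteq> 0 \<or> n \<noteq> 0" using x mn by auto
    then have "1 \<le> M" unfolding M_def by auto
    then have ab: "1 \<le> a" "a \<le> M" "1 \<le> b" "b \<le> M" by (auto simp: a_def b_def M_def)
    have M: "M \<le> C * norm (pt x)" using C(2)[of m n] by (simp add: M_def mn pt_def)
    then have "0 < C * norm (pt x)" using \<open>1 \<le> M\<close> by linarith
    then have pos: "0 < norm (pt x)" using C(1) by (simp add: zero_less_mult_iff)
    have "(a * b) powr (3/2) \<le> (M * M) powr (3/2)"
      using ab by (intro powr_mono2 mult_mono) auto
    also have "\<dots> = M powr 3" using \<open>1 \<le> M\<close> by (simp add: powr_mult flip: powr_add)
    also have "\<dots> = M ^ 3" using \<open>1 \<le> M\<close> by (simp add: powr_numeral)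
    also have "\<dots> \<le> (C * norm (pt x)) ^ 3" using M \<open>1 \<le> M\<close> by (intro power_mono) auto
    finally have "(a * b) powr (3/2) \<le> C ^ 3 * norm (pt x) ^ 3" by (simp add: power_mult_distrib)
    moreover have "0 < (a * b) powr (3/2)" using ab by simp
    ultimately have "1 / norm (pt x) ^ 3 \<le> C ^ 3 * (1 / (a * b) powr (3/2))"
      using pos by (simp add: field_simps)
    also have "1 / (a * b) powr (3/2) = h m * h n"
      using ab by (simp add: h_def powr_mult powr_minus_divide flip: a_def b_def)
    finally show "norm (1 / norm (pt x) ^ 3) \<le> C ^ 3 * H x"
      by (simp add: mn H_def)
  qed
  then have "(\<lambda>x. 1 / norm (pt x) ^ 3) summable_on UNIV - {(0, 0)}" by (rule abs_summable_summable)
  then show ?thesis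
    unfolding L'_eq by (subst summable_on_reindex) (auto simp: o_def intro: inj_on_subset[OF inj_pt])
qed

lemma closed_subset_L: "S \<subseteq> L \<Longrightarrow> closed S"
proof -
  assume S: "S \<subseteq> L"
  have "\<not> z islimpt S" for z
  proof
    assume "z islimpt S"
    then have "infinite (S \<inter> ball z 1)" by (subst (asm) islimpt_eq_infinite_ball) auto
    moreover have "S \<inter> ball z 1 \<subseteq> L \<inter> cball 0 (norm z + 1)"
    proof
      fix w assume w: "w \<in> S \<inter> ball z 1"
      have "norm w \<le> norm z + dist z w" using norm_triangle_ineq4[of z "z - w"] by (simp add: dist_norm)
      then show "w \<in> L \<inter> cball 0 (norm z + 1)" using w S by auto
    qed
    ultimately show False using finite_L_ball finite_subset by blast
  qed
  then show ?thesis by (simp add: closed_limpt)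
qed

lemma open_compl_L: "open (- L)" and open_compl_L': "open (- L')"
  by (intro open_Compl closed_subset_L; simp add: L'_def)+

lemma connected_compl_L: "connected (- L)"
  using connected_open_diff_countable[of UNIV L] countable_L connected_UNIV by (simp add: Compl_eq_Diff_UNIV)

lemma L_separated: "\<exists>r>0. \<forall>w\<in>L. \<forall>z\<in>L. z \<in> ball w r \<longrightarrow> z = w"
proof -
  have "open (- L')" "0 \<in> - L'" using open_compl_L' by (auto simp: L'_def)
  then obtain r where r: "r > 0" "ball 0 r \<subseteq> - L'" by (auto simp: open_contains_ball)
  have "z = w" if "w \<in> L" "z \<in> L" "z \<in> ball w r" for z w
  proof (rule ccontr)
    assume "z \<noteq> w"
    then have "z - w \<in> L'" using that L_diff by (auto simp: L'_def)
    moreover have "z - w \<in> ball 0 r" using that by (simp add: dist_norm norm_minus_commute)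
    ultimately show False using r by auto
  qed
  then show ?thesis using r(1) by blast
qed

lemma cball_compl_L':
  assumes "z\<^sub>0 \<notin> L'"
  obtains r where "r > 0" "r \<le> 1" "cball z\<^sub>0 r \<inter> L' = {}"
proof -
  obtain e where e: "e > 0" "cball z\<^sub>0 e \<subseteq> - L'"
    using open_compl_L' assms by (meson Compl_iff open_contains_cball)
  have "cball z\<^sub>0 (min e 1) \<subseteq> cball z\<^sub>0 e" by auto
  then show ?thesis using e that[of "min e 1"] by auto
qed

lemma norm_diff_lower:
  fixes z w :: complex
  assumes "norm z \<le> R" "2 * R \<le> norm w"
  shows "norm w / 2 \<le> norm (z - w)"
  using norm_triangle_ineq3[of w z] assms by (simp add: norm_minus_commute)

section \<open>The Weierstrass function and its derivatives\<close>

definition S :: "nat \<Rightarrow> complex \<Rightarrow> complex"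
  where "S k z = (\<Sum>\<^sub>\<infinity>w\<in>L'. 1 / (z - w) ^ k)"

text \<open>The Weierstrass function without its pole at \<open>0\<close>. Like \<open>S k\<close>
  it omits the lattice point \<open>0\<close>, so that both can be expanded there in Taylor
  series.\<close>

definition \<phi> :: "complex \<Rightarrow> complex"
  where "\<phi> z = (\<Sum>\<^sub>\<infinity>w\<in>L'. 1 / (z - w) ^ 2 - 1 / w ^ 2)"

definition G :: "nat \<Rightarrow> complex" where "G k = (\<Sum>\<^sub>\<infinity>w\<in>L'. 1 / w ^ k)"

lemma has_field_derivative_inverse_power:
  fixes z w :: complex
  assumes "z \<noteq> w"
  shows "((\<lambda>z. 1 / (z - w) ^ k) has_field_derivative - of_nat k * (1 / (z - w) ^ Suc k)) (at z)"
proof (cases k)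
  case (Suc m)
  have "((\<lambda>z. inverse (z - w)) has_field_derivative - (inverse (z - w) * inverse (z - w))) (at z)"
    using assms by (auto intro!: derivative_eq_intros)
  note deriv = DERIV_power[OF this, of k]
  have "(\<lambda>z. 1 / (z - w) ^ k) = (\<lambda>z. inverse (z - w) ^ k)"
    by (simp add: divide_inverse power_inverse)
  moreover have "- of_nat k * x ^ Suc k = of_nat k * (- (x * x) * x ^ (k - Suc 0))" for x :: complex
    by (simp add: Suc algebra_simps)
  from this[of "inverse (z - w)"] have "- of_nat k * (1 / (z - w) ^ Suc k)
      = of_nat k * (- (inverse (z - w) * inverse (z - w)) * inverse (z - w) ^ (k - Suc 0))"
    by (simp only: divide_inverse mult_1 flip: power_inverse)
  ultimately show ?thesis using deriv by simp
qed simp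

lemma S_properties:
  assumes z: "z \<notin> L'" and k: "k \<ge> 3"
  shows "(S k has_field_derivative - of_nat k * S (Suc k) z) (at z)"
    and "(\<lambda>w. 1 / (z - w) ^ k) summable_on L'"
proof -
  obtain r where r: "r > 0" "r \<le> 1" "cball z r \<inter> L' = {}" using cball_compl_L'[OF z] .
  define R where "R = norm z + 1"
  define F where "F = L \<inter> cball 0 (2 * R)"
  have R: "R \<ge> 1" by (simp add: R_def)
  have bound: "norm (1 / (x - w) ^ k) \<le> 2 ^ k * (1 / norm w ^ 3)"
    if w: "w \<in> L' - F" and x: "x \<in> cball z r" for w x
  proof -
    have "norm x \<le> norm z + dist z x" using norm_triangle_ineq4[of z "z - x"] by (simp add: dist_norm)
    then have "norm x \<le> R" using x r(2) by (simp add: R_def)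
    moreover have w2: "2 * R \<le> norm w" using w by (auto simp: F_def L'_def)
    ultimately have "norm w / 2 \<le> norm (x - w)" by (rule norm_diff_lower)
    moreover have w1: "1 \<le> norm w" using w2 R by simp
    ultimately have "(norm w / 2) ^ k \<le> norm (x - w) ^ k" by (intro power_mono) auto
    moreover have "norm w ^ 3 \<le> norm w ^ k" using w1 k by (rule power_increasing[rotated])
    ultimately have "norm w ^ 3 / 2 ^ k \<le> norm (x - w) ^ k"
      by (simp add: power_divide) (meson divide_right_mono order_trans zero_le_numeral zero_le_power)
    moreover have "0 < norm w" using w1 by linarith
    then have "0 < norm w ^ 3 / 2 ^ k" by simp
    ultimately have "1 / norm (x - w) ^ k \<le> 1 / (norm w ^ 3 / 2 ^ k)" by (intro frac_le) auto
    then show ?thesis by (simp add: norm_divide norm_power)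
  qed
  have sm: "(\<lambda>w. 2 ^ k * (1 / norm w ^ 3)) summable_on L'"
    by (intro summable_on_cmult_right summable_norm_cube)
  have deriv: "((\<lambda>z. 1 / (z - w) ^ k) has_field_derivative - of_nat k * (1 / (x - w) ^ Suc k)) (at x)"
    if "w \<in> L'" "x \<in> cball z r" for w x
    using that r(3) by (intro has_field_derivative_inverse_power) auto
  have finF: "finite F" unfolding F_def by (rule finite_L_ball)
  note t = termwise_derivative[OF r(1) deriv finF bound sm]
  show "(S k has_field_derivative - of_nat k * S (Suc k) z) (at z)"
    using t(1) unfolding S_def infsum_cmult_right' .
  show "(\<lambda>w. 1 / (z - w) ^ k) summable_on L'" using t(2) .
qed

lemma phi_deriv:
  assumes z: "z \<notin> L'"
  shows "(\<phi> has_field_derivative - 2 * S 3 z) (at z)"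
    and "(\<lambda>w. 1 / (z - w) ^ 2 - 1 / w ^ 2) summable_on L'"
proof -
  obtain r where r: "r > 0" "r \<le> 1" "cball z r \<inter> L' = {}" using cball_compl_L'[OF z] .
  define R where "R = norm z + 1"
  define F where "F = L \<inter> cball 0 (2 * R)"
  have R: "R \<ge> 1" by (simp add: R_def)
  have bound: "norm (1 / (x - w) ^ 2 - 1 / w ^ 2) \<le> 12 * R * (1 / norm w ^ 3)"
    if w: "w \<in> L' - F" and x: "x \<in> cball z r" for w x
  proof -
    have "norm x \<le> norm z + dist z x" using norm_triangle_ineq4[of z "z - x"] by (simp add: dist_norm)
    then have xR: "norm x \<le> R" using x r(2) by (simp add: R_def)
    moreover have w2: "2 * R \<le> norm w" using w by (auto simp: F_def L'_def)
    ultimately have xw: "norm w / 2 \<le> norm (x - w)" by (rule norm_diff_lower)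
    have w1: "0 < norm w" using w2 R by linarith
    have nz: "x - w \<noteq> 0" "w \<noteq> 0" using xw w1 by auto
    \<comment> \<open>Subtracting \<open>1 / w ^ 2\<close> gains one power of \<open>w\<close>: the
      numerator is of size \<open>norm w\<close>, the denominator of size \<open>norm w ^ 4\<close>,
      so inverse cubes dominate again.\<close>
    have "1 / (x - w) ^ 2 - 1 / w ^ 2 = (x * (2 * w - x)) / ((x - w) ^ 2 * w ^ 2)"
      using nz by (simp add: divide_simps) (simp add: algebra_simps power2_eq_square)
    then have "norm (1 / (x - w) ^ 2 - 1 / w ^ 2)
        = (norm x * norm (2 * w - x)) / (norm (x - w) ^ 2 * norm w ^ 2)"
      by (simp add: norm_divide norm_mult norm_power)
    also have "\<dots> \<le> (R * (3 * norm w)) / ((norm w / 2) ^ 2 * norm w ^ 2)"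
    proof (intro frac_le mult_mono power_mono xR xw)
      have "norm (2 * w - x) \<le> 2 * norm w + norm x"
        using norm_triangle_ineq4[of "2 * w" x] by (simp add: norm_mult)
      then show "norm (2 * w - x) \<le> 3 * norm w" using xR w2 w1 R by linarith
    qed (use R w1 in auto)
    also have "\<dots> = 12 * R * (1 / norm w ^ 3)"
      using w1 by (simp add: divide_simps eval_nat_numeral)
    finally show ?thesis .
  qed
  have sm: "(\<lambda>w. 12 * R * (1 / norm w ^ 3)) summable_on L'"
    by (intro summable_on_cmult_right summable_norm_cube)
  have deriv: "((\<lambda>z. 1 / (z - w) ^ 2 - 1 / w ^ 2) has_field_derivative - 2 * (1 / (x - w) ^ 3)) (at x)"
    if "w \<in> L'" "x \<in> cball z r" for w x
  proof -
    have "x \<noteq> w" using that r(3) by auto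
    from DERIV_diff[OF has_field_derivative_inverse_power[OF this, of 2] DERIV_const[of "1 / w ^ 2"]]
    show ?thesis by simp
  qed
  have finF: "finite F" unfolding F_def by (rule finite_L_ball)
  note t = termwise_derivative[OF r(1) deriv finF bound sm]
  show "(\<phi> has_field_derivative - 2 * S 3 z) (at z)"
    using t(1) unfolding S_def \<phi>_def infsum_cmult_right' .
  show "(\<lambda>w. 1 / (z - w) ^ 2 - 1 / w ^ 2) summable_on L'" using t(2) .
qed

lemma bij_uminus_L': "bij_betw uminus L' L'"
  by (rule bij_betwI[of _ _ _ uminus]) (auto simp: L'_def L_uminus)

lemma S_uminus: "S k (- z) = (- 1) ^ k * S k z"
proof -
  have "S k (- z) = (\<Sum>\<^sub>\<infinity>w\<in>L'. 1 / (- z - - w) ^ k)"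
    unfolding S_def by (rule infsum_reindex_bij_betw[OF bij_uminus_L', symmetric])
  also have "\<dots> = (\<Sum>\<^sub>\<infinity>w\<in>L'. (- 1) ^ k * (1 / (z - w) ^ k))"
  proof (rule infsum_cong)
    fix w
    have "(- z - - w) = (- 1) * (z - w)" by simp
    then have "1 / (- z - - w) ^ k = 1 / ((- 1) ^ k * (z - w) ^ k)" by (simp only: power_mult_distrib)
    also have "\<dots> = (- 1) ^ k * (1 / (z - w) ^ k)" by (cases "even k") auto
    finally show "1 / (- z - - w) ^ k = (- 1) ^ k * (1 / (z - w) ^ k)" .
  qed
  finally show ?thesis by (simp only: S_def infsum_cmult_right')
qed

lemma S_0: "S k 0 = (- 1) ^ k * G k"
  unfolding S_def G_def infsum_cmult_right'[symmetric]
proof (rule infsum_cong)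
  fix w :: complex
  show "1 / (0 - w) ^ k = (- 1) ^ k * (1 / w ^ k)"
    by (cases "even k") auto
qed

lemma phi_uminus: "\<phi> (- z) = \<phi> z"
proof -
  have "\<phi> (- z) = (\<Sum>\<^sub>\<infinity>w\<in>L'. 1 / (- z - - w) ^ 2 - 1 / (- w) ^ 2)"
    unfolding \<phi>_def by (rule infsum_reindex_bij_betw[OF bij_uminus_L', symmetric])
  then show ?thesis by (simp add: \<phi>_def power2_commute)
qed

lemma phi_0: "\<phi> 0 = 0" by (simp add: \<phi>_def)

definition wp :: "complex \<Rightarrow> complex" where "wp z = 1 / z ^ 2 + \<phi> z"
definition wp' :: "complex \<Rightarrow> complex" where "wp' z = - 2 / z ^ 3 - 2 * S 3 z"
definition wp'' :: "complex \<Rightarrow> complex" where "wp'' z = 6 / z ^ 4 + 6 * S 4 z"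

lemma not_L: "z \<notin> L \<Longrightarrow> z \<notin> L' \<and> z \<noteq> 0" using L_0 by (auto simp: L'_def)

lemma wp_deriv: "z \<notin> L \<Longrightarrow> (wp has_field_derivative wp' z) (at z)"
  using DERIV_add[OF has_field_derivative_inverse_power[of z 0 2] phi_deriv(1)[of z]] not_L[of z]
  by (simp add: wp_def[abs_def] wp'_def)

lemma wp'_deriv: "z \<notin> L \<Longrightarrow> (wp' has_field_derivative wp'' z) (at z)"
  using DERIV_diff[OF DERIV_cmult[OF has_field_derivative_inverse_power[of z 0 3], of "- 2"]
      DERIV_cmult[OF S_properties(1)[of z 3], of 2]] not_L[of z]
  by (simp add: wp'_def[abs_def] wp''_def)

lemma wp_uminus: "wp (- z) = wp z" by (simp add: wp_def phi_uminus)

lemma wp'_eq_infsum: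
  assumes "z \<notin> L"
  shows "wp' z = - 2 * (\<Sum>\<^sub>\<infinity>w\<in>L. 1 / (z - w) ^ 3)"
proof -
  have L: "L = insert 0 L'" using L_0 by (auto simp: L'_def)
  have "0 \<notin> L'" by (simp add: L'_def)
  have "((\<lambda>w. 1 / (z - w) ^ 3) has_sum S 3 z) L'"
    unfolding S_def using S_properties(2)[of z 3] not_L[OF assms] by (intro has_sum_infsum) auto
  from has_sum_insert[OF \<open>0 \<notin> L'\<close> this] have "((\<lambda>w. 1 / (z - w) ^ 3) has_sum (1 / z ^ 3 + S 3 z)) L"
    by (simp add: L)
  then have "(\<Sum>\<^sub>\<infinity>w\<in>L. 1 / (z - w) ^ 3) = 1 / z ^ 3 + S 3 z" by (rule infsumI)
  then show ?thesis by (simp add: wp'_def)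
qed

lemma wp'_periodic:
  assumes "u \<in> L" "z \<notin> L"
  shows "wp' (z + u) = wp' z"
proof -
  have bij: "bij_betw (\<lambda>w. w + u) L L"
    using assms(1) by (intro bij_betwI[of _ _ _ "\<lambda>w. w - u"]) (auto intro: L_add L_diff)
  have "(\<Sum>\<^sub>\<infinity>w\<in>L. 1 / (z + u - w) ^ 3) = (\<Sum>\<^sub>\<infinity>w\<in>L. 1 / (z + u - (w + u)) ^ 3)"
    by (rule infsum_reindex_bij_betw[OF bij, symmetric])
  then show ?thesis
    using assms L_add_iff[OF assms(1), of z] by (simp add: wp'_eq_infsum)
qed

text \<open>The derivative is periodic by reindexing its series, so \<open>wp (z + u) - wp z\<close>
  is constant on the connected set \<open>- L\<close>; evenness gives the value \<open>0\<close> at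
  \<open>- u / 2\<close>, a point that must avoid the lattice.\<close>

lemma wp_periodic_aux:
  assumes "u \<in> L" "u / 2 \<notin> L" "z \<notin> L"
  shows "wp (z + u) = wp z"
proof -
  define d where "d = (\<lambda>z. wp (z + u) - wp z)"
  have "(d has_field_derivative 0) (at z)" if "z \<notin> L" for z
  proof -
    have "z + u \<notin> L" using that L_add_iff[OF assms(1)] by simp
    then have "((\<lambda>z. wp (z + u)) has_field_derivative wp' (z + u)) (at z)"
      by (intro DERIV_shift[THEN iffD1] wp_deriv)
    then have "(d has_field_derivative wp' (z + u) - wp' z) (at z)"
      unfolding d_def by (intro DERIV_diff wp_deriv that)
    then show ?thesis using wp'_periodic[OF assms(1) that] by simp
  qed
  then have "d constant_on - L"
    by (intro has_field_derivative_0_imp_constant_on[OF _ connected_compl_L open_compl_L]) auto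
  then have "d z = d (- (u / 2))"
    using assms L_uminus_iff by (auto simp: constant_on_def)
  also have "\<dots> = 0" using wp_uminus[of "u / 2"] by (simp add: d_def)
  finally show ?thesis by (simp add: d_def)
qed

lemma half_notin_L: "1 / 2 \<notin> L" "\<tau> / 2 \<notin> L"
proof -
  have half: False if "real_of_int m = 1 / 2" for m :: int
  proof -
    have "real_of_int (2 * m) = real_of_int 1" using that by simp
    then have "2 * m = 1" unfolding of_int_eq_iff .
    then show False by presburger
  qed
  show "1 / 2 \<notin> L"
  proof
    assume "1 / 2 \<in> L"
    then obtain m n where mn: "1 / 2 = of_int m + of_int n * \<tau>" by (elim L_E)
    have "Im (of_int m + of_int n * \<tau>) = 0" unfolding mn[symmetric] by simp
    then have "n = 0" using Im_pos by simp
    then have "real_of_int m = 1 / 2" using mn by (simp add: complex_eq_iff)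
    then show False by (rule half)
  qed
  show "\<tau> / 2 \<notin> L"
  proof
    assume "\<tau> / 2 \<in> L"
    then obtain m n where mn: "\<tau> / 2 = of_int m + of_int n * \<tau>" by (elim L_E)
    have "Im (\<tau> / 2) = Im (of_int m + of_int n * \<tau>)" by (simp only: mn)
    then have "real_of_int n = 1 / 2" using Im_pos by (simp add: field_simps)
    then show False by (rule half)
  qed
qed

lemma wp_periodic_1: "z \<notin> L \<Longrightarrow> wp (z + 1) = wp z"
  and wp_periodic_\<tau>: "z \<notin> L \<Longrightarrow> wp (z + \<tau>) = wp z"
  using wp_periodic_aux[OF L_1 half_notin_L(1)] wp_periodic_aux[OF L_\<tau> half_notin_L(2)] by auto

lemma periodic_all:
  assumes f1: "\<And>z. z \<notin> L \<Longrightarrow> f (z + 1) = f z" and f\<tau>: "\<And>z. z \<notin> L \<Longrightarrow> f (z + \<tau>) = f z"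
    and "u \<in> L" "z \<notin> L"
  shows "f (z + u) = (f z :: complex)"
proof -
  have int: "f (z + of_int k * v) = f z"
    if v: "v \<in> L" "\<And>z. z \<notin> L \<Longrightarrow> f (z + v) = f z" and z: "z \<notin> L" for k v z
  proof -
    have kv: "of_nat m * v \<in> L" for m
      by (induction m) (auto simp: L_0 algebra_simps intro: L_add v(1))
    have nat: "f (z + of_nat m * v) = f z" if "z \<notin> L" for m z
    proof (induction m)
      case (Suc m)
      have "z + of_nat m * v \<notin> L" using that L_add_iff[OF kv] by simp
      then have "f (z + of_nat m * v + v) = f z" using v(2) Suc by simp
      then show ?case by (simp add: algebra_simps)
    qed simp
    show ?thesis
    proof (cases "k \<ge> 0")
      case True
      then show ?thesis using nat[OF z, of "nat k"] by simp
    next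
      case False
      define z' where "z' = z + of_int k * v"
      have eq: "z = z' + of_nat (nat (- k)) * v" using False by (simp add: z'_def)
      have "z' \<notin> L" using z L_add_iff[OF kv, of z' "nat (- k)"] unfolding eq[symmetric] by simp
      from nat[OF this, of "nat (- k)"] have "f z = f z'" unfolding eq[symmetric] .
      then show ?thesis by (simp add: z'_def)
    qed
  qed
  obtain m n where mn: "u = of_int m + of_int n * \<tau>" using assms(3) by (elim L_E)
  have "of_int m \<in> L" using L_I[of m 0] by simp
  then have "z + of_int m \<notin> L" using assms(4) L_add_iff by simp
  then have "f (z + of_int m + of_int n * \<tau>) = f (z + of_int m)" by (intro int L_\<tau> f\<tau>)
  also have "\<dots> = f z" using int[OF L_1 f1 assms(4), of m] by simp
  finally show ?thesis by (simp add: mn add.assoc)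
qed

lemma wp_periodic: "u \<in> L \<Longrightarrow> z \<notin> L \<Longrightarrow> wp (z + u) = wp z"
  by (rule periodic_all[of wp]) (auto intro: wp_periodic_1 wp_periodic_\<tau>)

end

lemma holomorphic_Taylor_remainder:
  fixes f :: "complex \<Rightarrow> complex"
  assumes f: "f holomorphic_on ball 0 r" and r: "r > 0"
  obtains h where "h holomorphic_on ball 0 r"
    "\<And>z. z \<in> ball 0 r \<Longrightarrow> f z = (\<Sum>k<N. (deriv ^^ k) f 0 / fact k * z ^ k) + z ^ N * h z"
proof -
  define a where "a = (\<lambda>k. (deriv ^^ k) f 0 / fact k)"
  define h where "h = (\<lambda>z. if z = 0 then a N else (f z - (\<Sum>k<N. a k * z ^ k)) / z ^ N)"
  have sums: "(\<lambda>k. a k * z ^ k) sums f z" if "z \<in> ball 0 r" for z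
    using holomorphic_power_series[OF f that] by (simp add: a_def)
  have "(\<lambda>k. a (k + N) * (z - 0) ^ k) sums h z" if z: "z \<in> ball 0 r" for z
  proof (cases "z = 0")
    case True
    then show ?thesis using powser_sums_zero[of "\<lambda>k. a (k + N)"] by (simp add: h_def)
  next
    case False
    have "(\<lambda>k. a (k + N) * z ^ (k + N)) sums (f z - (\<Sum>k<N. a k * z ^ k))"
      using sums[OF z] by (subst sums_iff_shift) simp
    from sums_divide[OF this, of "z ^ N"] show ?thesis
      using False by (simp add: h_def power_add)
  qed
  then have "h holomorphic_on ball 0 r" by (rule power_series_holomorphic)
  moreover have "f z = (\<Sum>k<N. a k * z ^ k) + z ^ N * h z" if "z \<in> ball 0 r" for z
  proof (cases "z = 0")
    case True
    have f0: "f 0 = a 0" by (simp add: a_def)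
    show ?thesis
    proof (cases N)
      case (Suc M)
      have "(\<Sum>k<Suc M. a k * 0 ^ k) = a 0" by (simp add: sum.lessThan_Suc_shift del: sum.lessThan_Suc)
      then show ?thesis using True f0 Suc by simp
    qed (simp add: True f0 h_def)
  qed (simp add: h_def)
  ultimately show ?thesis using that by (simp add: a_def)
qed

lemma isCont_holomorphic_ball: "h holomorphic_on ball 0 r \<Longrightarrow> r > 0 \<Longrightarrow> isCont h (0::complex)"
  by (meson centre_in_ball continuous_on_eq_continuous_at holomorphic_on_imp_continuous_on open_ball)

text \<open>An even function cannot have a simple pole.\<close>

lemma even_isolated_singularity:
  fixes f :: "complex \<Rightarrow> complex"
  assumes hol: "f holomorphic_on ball 0 r - {0}" and r: "r > 0"
    and even: "\<And>z. z \<in> ball 0 r - {0} \<Longrightarrow> f (- z) = f z"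
    and lim: "((\<lambda>z. z ^ 2 * f z) \<longlongrightarrow> 0) (at 0)"
  obtains l where "(f \<longlongrightarrow> l) (at 0)"
proof -
  \<comment> \<open>\<open>g\<close> extends over \<open>0\<close> with value \<open>0\<close>, and
    being even it has derivative \<open>0\<close> there, so it is divisible by
    \<open>z ^ 2\<close>.\<close>
  define g where "g = (\<lambda>z. z ^ 2 * f z)"
  have g0: "g 0 = 0" by (simp add: g_def)
  have g: "g holomorphic_on ball 0 r"
  proof (rule no_isolated_singularity'[where K = "{0}"])
    show "g holomorphic_on ball 0 r - {0}" unfolding g_def by (intro holomorphic_intros hol)
    have "(g \<longlongrightarrow> g 0) (at 0)" using lim unfolding g0 by (simp only: g_def)
    then show "(g \<longlongrightarrow> g z) (at z within ball 0 r)" if "z \<in> {0}" for z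
      using that by (auto intro: tendsto_mono[OF at_le])
  qed auto
  have "(g has_field_derivative deriv g 0) (at 0)"
    using g r by (intro holomorphic_derivI[of _ "ball 0 r"]) auto
  then have d: "(g has_field_derivative deriv g 0) (at (- 0))" by simp
  have "((\<lambda>z. g (- z)) has_field_derivative deriv g 0 * - 1) (at 0)"
    by (rule DERIV_chain2[where f = g and g = uminus, OF d]) (auto intro!: derivative_eq_intros)
  moreover have "\<forall>\<^sub>F z in nhds 0. g (- z) = g z"
  proof -
    have "\<forall>\<^sub>F z in nhds 0. z \<in> ball (0::complex) r" using r by (intro eventually_nhds_in_open) auto
    then show ?thesis
    proof eventually_elim
      case (elim z)
      then show ?case using even[of z] by (cases "z = 0") (auto simp: g_def)
    qed
  qed
  ultimately have "(g has_field_derivative deriv g 0 * - 1) (at 0)"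
    by (subst (asm) DERIV_cong_ev[OF refl _ refl])
  then have "deriv g 0 = deriv g 0 * - 1" by (rule DERIV_imp_deriv)
  then have dg: "deriv g 0 = 0" by simp
  obtain h where h: "h holomorphic_on ball 0 r"
    "\<And>z. z \<in> ball 0 r \<Longrightarrow> g z = (\<Sum>k<2. (deriv ^^ k) g 0 / fact k * z ^ k) + z ^ 2 * h z"
    using holomorphic_Taylor_remainder[OF g r] by blast
  have fh: "f z = h z" if "z \<in> ball 0 r - {0}" for z
    using h(2)[of z] that by (simp add: numeral_2_eq_2 g0 dg) (simp add: g_def power2_eq_square)
  have "isCont h 0" using h(1) r by (rule isCont_holomorphic_ball)
  then have "(h \<longlongrightarrow> h 0) (at 0)" by (simp add: isCont_def)
  moreover have "\<forall>\<^sub>F z in at 0. h z = f z"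
    using eventually_at_in_open[of "ball 0 r" 0] r by (auto elim!: eventually_mono simp: fh)
  ultimately have "(f \<longlongrightarrow> h 0) (at 0)" by (rule Lim_transform_eventually)
  then show ?thesis using that by blast
qed

context tau_lattice
begin

lemma eventually_not_L: "\<forall>\<^sub>F z in at 0. z \<notin> L"
proof -
  obtain r where r: "r > 0" "\<And>w z. w \<in> L \<Longrightarrow> z \<in> L \<Longrightarrow> z \<in> ball w r \<Longrightarrow> z = w"
    using L_separated by blast
  have "\<forall>\<^sub>F z in at 0. z \<in> ball (0::complex) r - {0}"
    using r(1) by (intro eventually_at_in_open) auto
  then show ?thesis by eventually_elim (use r(2)[OF L_0] in auto)
qed

lemma reduce_mod_L:
  obtains u a b where "u \<in> L" "0 \<le> a" "a \<le> 1" "0 \<le> b" "b \<le> 1" "z = of_real a + of_real b * \<tau> + u"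
proof -
  define y where "y = Im z / Im \<tau>"
  define x where "x = Re z - y * Re \<tau>"
  have "z = of_real x + of_real y * \<tau>"
    using Im_pos by (simp add: complex_eq_iff x_def y_def)
  also have "\<dots> = of_real (frac x) + of_real (frac y) * \<tau> + (of_int \<lfloor>x\<rfloor> + of_int \<lfloor>y\<rfloor> * \<tau>)"
    by (simp add: frac_def algebra_simps)
  finally show ?thesis
    using frac_ge_0 frac_lt_1 L_I by (intro that) (auto intro: less_imp_le)
qed

text \<open>Liouville's theorem. The limit at \<open>0\<close> fills in all lattice points by
  periodicity, whatever \<open>f\<close> is there, and the continuous extension is bounded because
  it takes all its values on a compact parallelogram.\<close>

lemma elliptic_constant:
  assumes hol: "f holomorphic_on - L"
    and per1: "\<And>z. z \<notin> L \<Longrightarrow> f (z + 1) = f z" and per\<tau>: "\<And>z. z \<notin> L \<Longrightarrow> f (z + \<tau>) = f z"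
    and lim: "(f \<longlongrightarrow> l) (at 0)" and z: "z \<notin> L"
  shows "f z = l"
proof -
  define F where "F = (\<lambda>z. if z \<in> L then l else f z)"
  have per: "F (z + u) = F z" if "u \<in> L" for z u
    using periodic_all[of f, OF per1 per\<tau> that, of z] L_add_iff[OF that, of z] by (simp add: F_def)
  have cont: "isCont F z" for z
  proof (cases "z \<in> L")
    case True
    have "((\<lambda>x. F (x + z)) \<longlongrightarrow> l) (at 0)"
    proof (rule Lim_transform_eventually[OF lim])
      show "\<forall>\<^sub>F x in at 0. f x = F (x + z)"
        using eventually_not_L by eventually_elim (simp add: per True, simp add: F_def)
    qed
    then have "(F \<longlongrightarrow> l) (at z)" by (subst filterlim_at_to_0)
    then show ?thesis using True by (simp add: isCont_def F_def)
  next
    case False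
    have "isCont f z"
      using hol False open_compl_L
      by (metis ComplI continuous_on_eq_continuous_at holomorphic_on_imp_continuous_on)
    moreover have "\<forall>\<^sub>F x in nhds z. x \<in> - L"
      using False by (intro eventually_nhds_in_open open_compl_L) auto
    then have "\<forall>\<^sub>F x in nhds z. F x = f x" by eventually_elim (simp add: F_def)
    ultimately show ?thesis by (subst isCont_cong)
  qed
  have "F holomorphic_on ball 0 R" for R
  proof (rule no_isolated_singularity)
    show "continuous_on (ball 0 R) F" using cont by (intro continuous_at_imp_continuous_on) auto
    have "F holomorphic_on - L" using hol by (rule holomorphic_transform) (simp add: F_def)
    then show "F holomorphic_on ball 0 R - L \<inter> cball 0 R" by (rule holomorphic_on_subset) auto
  qed (auto intro: finite_L_ball)
  then have "F holomorphic_on UNIV"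
    by (intro holomorphic_onI) (metis UNIV_I centre_in_ball dist_0_norm field_differentiable_at_within
        holomorphic_on_imp_differentiable_at less_add_one mem_ball open_ball)
  moreover have "bounded (range F)"
  proof -
    define C where "C = (\<lambda>(a, b). of_real a + of_real b * \<tau>) ` ({0..1} \<times> {0..1})"
    have "compact C" unfolding C_def case_prod_beta
      by (intro compact_continuous_image continuous_intros compact_Times compact_Icc)
    then have "bounded (F ` C)"
      using cont by (intro compact_imp_bounded compact_continuous_image continuous_at_imp_continuous_on) auto
    moreover have "range F \<subseteq> F ` C"
    proof
      fix y assume "y \<in> range F"
      then obtain z where y: "y = F z" by auto
      obtain u a b where "u \<in> L" "0 \<le> a" "a \<le> 1" "0 \<le> b" "b \<le> 1" "z = of_real a + of_real b * \<tau> + u"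
        by (rule reduce_mod_L[of z])
      then have "y = F (of_real a + of_real b * \<tau>)" "of_real a + of_real b * \<tau> \<in> C"
        unfolding C_def by (simp add: y per, intro image_eqI[of _ _ "(a, b)"]) auto
      then show "y \<in> F ` C" by blast
    qed
    ultimately show ?thesis by (rule bounded_subset)
  qed
  ultimately have "F constant_on UNIV" by (rule Liouville_theorem)
  then have "F z = F 0" by (auto simp: constant_on_def)
  then show ?thesis using z L_0 by (simp add: F_def)
qed

lemma phi_holomorphic: "\<phi> holomorphic_on - L'"
  using phi_deriv(1) open_compl_L' by (auto simp: holomorphic_on_open)

lemma wp_holomorphic: "wp holomorphic_on - L" and wp'_holomorphic: "wp' holomorphic_on - L"
  using wp_deriv wp'_deriv open_compl_L by (auto simp: holomorphic_on_open)

lemma wp''_holomorphic: "wp'' holomorphic_on - L"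
  unfolding wp''_def[abs_def]
proof (intro holomorphic_intros)
  have "S 4 holomorphic_on - L'"
    using S_properties(1)[of _ 4] open_compl_L' by (auto simp: holomorphic_on_open)
  then show "S 4 holomorphic_on - L" by (rule holomorphic_on_subset) (auto simp: L'_def)
qed (use L_0 in auto)

lemma wp''_periodic:
  assumes "u \<in> L" "z \<notin> L"
  shows "wp'' (z + u) = wp'' z"
proof -
  have "z + u \<notin> L" using assms L_add_iff by simp
  then have "((\<lambda>z. wp' (z + u)) has_field_derivative wp'' (z + u)) (at z)"
    by (intro DERIV_shift[THEN iffD1] wp'_deriv)
  moreover have "\<forall>\<^sub>F x in nhds z. x \<in> - L"
    using assms by (intro eventually_nhds_in_open open_compl_L) auto
  then have "\<forall>\<^sub>F x in nhds z. wp' (x + u) = wp' x"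
    by eventually_elim (simp add: wp'_periodic assms)
  ultimately have "(wp' has_field_derivative wp'' (z + u)) (at z)"
    by (subst (asm) DERIV_cong_ev[OF refl _ refl])
  then show ?thesis using wp'_deriv[OF assms(2)] by (rule DERIV_unique)
qed

lemma zero_notin_L': "0 \<notin> L'" by (simp add: L'_def)

section \<open>Laurent expansion at 0 and differential equations\<close>

lemma higher_deriv_phi:
  "z \<notin> L' \<Longrightarrow> (deriv ^^ Suc k) \<phi> z = (- 1) ^ Suc k * fact (k + 2) * S (k + 3) z"
proof (induction k arbitrary: z)
  case 0
  then show ?case using phi_deriv(1)[OF 0] by (simp add: DERIV_imp_deriv)
next
  case (Suc k)
  let ?c = "(- 1) ^ Suc k * fact (k + 2) :: complex"
  have "\<forall>\<^sub>F x in nhds z. x \<in> - L'"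
    using Suc.prems by (intro eventually_nhds_in_open open_compl_L') auto
  then have "\<forall>\<^sub>F x in nhds z. (deriv ^^ Suc k) \<phi> x = ?c * S (k + 3) x"
    by eventually_elim (use Suc.IH in auto)
  then have "deriv ((deriv ^^ Suc k) \<phi>) z = deriv (\<lambda>x. ?c * S (k + 3) x) z"
    by (rule deriv_cong_ev) simp
  also have "\<dots> = ?c * (- of_nat (k + 3) * S (Suc (k + 3)) z)"
    by (intro DERIV_imp_deriv DERIV_cmult S_properties(1) Suc.prems) simp
  finally show ?case by (simp add: algebra_simps)
qed

lemma G_odd: "odd k \<Longrightarrow> G k = 0"
  using S_uminus[of k 0] S_0[of k] by simp

lemma deriv_phi_0: "(deriv ^^ Suc k) \<phi> 0 = fact (k + 2) * G (k + 3)"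
  using higher_deriv_phi[OF zero_notin_L', of k] G_odd[of "k + 3"] by (cases "even k") (auto simp: S_0)

text \<open>The coefficient of \<open>z ^ (k + 1)\<close> is \<open>(k + 2) * G (k + 3)\<close>, and
  the \<open>G\<close> of odd index vanish by symmetry.\<close>

lemma phi_expansion:
  "\<exists>r h. r > 0 \<and> ball 0 r \<inter> L' = {} \<and> h holomorphic_on ball 0 r \<and>
    (\<forall>z\<in>ball 0 r. \<phi> z = 3 * G 4 * z ^ 2 + 5 * G 6 * z ^ 4 + z ^ 5 * h z)"
proof -
  obtain r where r: "r > 0" "ball 0 r \<subseteq> - L'"
    using open_compl_L' zero_notin_L' by (meson Compl_iff open_contains_ball)
  have "\<phi> holomorphic_on ball 0 r" using phi_holomorphic r(2) by (rule holomorphic_on_subset)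
  then obtain h where h: "h holomorphic_on ball 0 r" "\<And>z. z \<in> ball 0 r \<Longrightarrow>
      \<phi> z = (\<Sum>k<5. (deriv ^^ k) \<phi> 0 / fact k * z ^ k) + z ^ 5 * h z"
    using holomorphic_Taylor_remainder[OF _ r(1)] by blast
  have G35: "G 3 = 0" "G 5 = 0" by (auto intro: G_odd)
  have "(\<Sum>k<5. (deriv ^^ k) \<phi> 0 / fact k * z ^ k) = 3 * G 4 * z ^ 2 + 5 * G 6 * z ^ 4" for z
    using deriv_phi_0[of 0] deriv_phi_0[of 1] deriv_phi_0[of 2] deriv_phi_0[of 3] G35
    by (simp add: eval_nat_numeral phi_0 fact_numeral)
  then show ?thesis using r h by (intro exI[of _ r] exI[of _ h]) auto
qed

text \<open>The combination \<open>E\<close> is elliptic and its poles cancel, so it is constant;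
  the regular form \<open>F\<close> has the value \<open>- 140 * G 6\<close> at
  \<open>0\<close>.\<close>

lemma wp_ode:
  assumes "z \<notin> L"
  shows "wp' z ^ 2 = 4 * wp z ^ 3 - 60 * G 4 * wp z - 140 * G 6"
proof -
  define E where "E = (\<lambda>z. wp' z ^ 2 - 4 * wp z ^ 3 + 60 * G 4 * wp z)"
  obtain r h where r: "r > 0" "ball 0 r \<inter> L' = {}" and h: "h holomorphic_on ball 0 r"
    and \<phi>: "\<And>z. z \<in> ball 0 r \<Longrightarrow> \<phi> z = 3 * G 4 * z ^ 2 + 5 * G 6 * z ^ 4 + z ^ 5 * h z"
    using phi_expansion by blast
  define A where "A = (\<lambda>z. 3 * G 4 + 5 * G 6 * z ^ 2 + z ^ 3 * h z)"
  define B where "B = (\<lambda>z. 6 * G 4 + 20 * G 6 * z ^ 2 + 5 * z ^ 3 * h z + z ^ 4 * deriv h z)"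
  have S3: "- 2 * S 3 z = z * B z" if "z \<in> ball 0 r" for z
  proof -
    have "\<forall>\<^sub>F x in nhds z. x \<in> ball 0 r" using that by (intro eventually_nhds_in_open) auto
    then have ev: "\<forall>\<^sub>F x in nhds z. \<phi> x = 3 * G 4 * x ^ 2 + 5 * G 6 * x ^ 4 + x ^ 5 * h x"
      by eventually_elim (rule \<phi>)
    have "(h has_field_derivative deriv h z) (at z)"
      using h that by (intro holomorphic_derivI[of _ "ball 0 r"]) auto
    then have "((\<lambda>x. 3 * G 4 * x ^ 2 + 5 * G 6 * x ^ 4 + x ^ 5 * h x) has_field_derivative z * B z) (at z)"
      by (auto intro!: derivative_eq_intros simp: B_def algebra_simps eval_nat_numeral)
    then have "(\<phi> has_field_derivative z * B z) (at z)"
      by (subst DERIV_cong_ev[OF refl ev refl])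
    moreover have "(\<phi> has_field_derivative - 2 * S 3 z) (at z)"
      using that r(2) by (intro phi_deriv(1)) auto
    ultimately show ?thesis by (rule DERIV_unique[rotated])
  qed
  define F where "F = (\<lambda>z. - 140 * G 6 - 32 * z * h z - 4 * z ^ 2 * deriv h z + z ^ 2 * B z ^ 2
    - 12 * z ^ 2 * A z ^ 2 - 4 * z ^ 6 * A z ^ 3 + 60 * G 4 * z ^ 2 * A z)"
  have EF: "E z = F z" if z: "z \<in> ball 0 r" "z \<noteq> 0" for z
  proof -
    have \<phi>A: "\<phi> z = z ^ 2 * A z" using \<phi>[OF z(1)] by (simp add: A_def algebra_simps eval_nat_numeral)
    define i where "i = inverse z"
    have iz: "i * z = 1" using z(2) by (simp add: i_def)
    have wp: "wp z = i ^ 2 + z ^ 2 * A z" by (simp add: wp_def \<phi>A i_def divide_inverse power_inverse)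
    have wp': "wp' z = - 2 * i ^ 3 + z * B z"
      using S3[OF z(1)] by (simp add: wp'_def i_def divide_inverse power_inverse)
    have i: "i ^ Suc k * z = i ^ k" "i ^ Suc k * z * x = i ^ k * x" for k x
      using iz by (simp_all add: mult_ac)
    \<comment> \<open>With \<open>i\<close> for the inverse of \<open>z\<close> this is a polynomial
      identity: the terms \<open>4 * i ^ 6\<close> cancel, and the bracket beside
      \<open>i ^ 2\<close> vanishes to second order since
      \<open>60 = 4 * 6 + 12 * 3\<close>.\<close>
    have "E z = i ^ 2 * (60 * G 4 - 4 * B z * (i * z) - 12 * A z * (i * z) ^ 2) + z ^ 2 * B z ^ 2
        - 12 * (i * z) ^ 2 * z ^ 2 * A z ^ 2 - 4 * z ^ 6 * A z ^ 3 + 60 * G 4 * z ^ 2 * A z"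
      unfolding E_def wp wp' by (simp add: algebra_simps eval_nat_numeral)
    also have "i ^ 2 * (60 * G 4 - 4 * B z * (i * z) - 12 * A z * (i * z) ^ 2)
        = i ^ 2 * (60 * G 4 - 4 * B z - 12 * A z)" by (simp only: iz) simp
    also have "60 * G 4 - 4 * B z - 12 * A z
        = z ^ 2 * (- 140 * G 6 - 32 * z * h z - 4 * z ^ 2 * deriv h z)"
      by (simp add: A_def B_def algebra_simps eval_nat_numeral)
    also have "i ^ 2 * (z ^ 2 * (- 140 * G 6 - 32 * z * h z - 4 * z ^ 2 * deriv h z))
        = (i * z) ^ 2 * (- 140 * G 6 - 32 * z * h z - 4 * z ^ 2 * deriv h z)"
      by (simp only: power_mult_distrib mult.assoc)
    finally show ?thesis by (simp add: iz F_def)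
  qed
  have "deriv h holomorphic_on ball 0 r" by (rule holomorphic_deriv[OF h]) simp
  then have ch: "isCont h 0" "isCont (deriv h) 0" using h r(1) isCont_holomorphic_ball by auto
  have "isCont F 0" unfolding F_def A_def B_def by (intro continuous_intros ch)
  then have "(F \<longlongrightarrow> F 0) (at 0)" by (simp add: isCont_def)
  moreover have "\<forall>\<^sub>F z in at 0. z \<in> ball (0::complex) r - {0}"
    using r(1) by (intro eventually_at_in_open) auto
  then have "\<forall>\<^sub>F z in at 0. F z = E z" by eventually_elim (auto simp: EF)
  ultimately have "(E \<longlongrightarrow> F 0) (at 0)" by (rule Lim_transform_eventually)
  note lim = this
  have hol: "E holomorphic_on - L"
    unfolding E_def by (intro holomorphic_intros wp_holomorphic wp'_holomorphic)
  have per: "E (z + u) = E z" if "u \<in> L" "z \<notin> L" for z u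
    by (simp add: E_def wp_periodic wp'_periodic that)
  have "E z = F 0" by (rule elliptic_constant[OF hol per[OF L_1] per[OF L_\<tau>] lim assms])
  then show ?thesis by (simp add: E_def F_def algebra_simps)
qed

text \<open>Again by Liouville, with the value \<open>6 * G 4 - 36 * G 4\<close> at
  \<open>0\<close>. Differentiating \<open>wp_ode\<close> instead would leave a factor
  \<open>wp'\<close>, which has zeros.\<close>

lemma wp_ode2:
  assumes "z \<notin> L"
  shows "wp'' z = 6 * wp z ^ 2 - 30 * G 4"
proof -
  define E where "E = (\<lambda>z. wp'' z - 6 * wp z ^ 2)"
  obtain r h where r: "r > 0" "ball 0 r \<inter> L' = {}" and h: "h holomorphic_on ball 0 r"
    and \<phi>: "\<And>z. z \<in> ball 0 r \<Longrightarrow> \<phi> z = 3 * G 4 * z ^ 2 + 5 * G 6 * z ^ 4 + z ^ 5 * h z"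
    using phi_expansion by blast
  define A where "A = (\<lambda>z. 3 * G 4 + 5 * G 6 * z ^ 2 + z ^ 3 * h z)"
  define F where "F = (\<lambda>z. 6 * S 4 z - 12 * A z - 6 * z ^ 4 * A z ^ 2)"
  have EF: "E z = F z" if z: "z \<in> ball 0 r" "z \<noteq> 0" for z
  proof -
    have \<phi>A: "\<phi> z = z ^ 2 * A z" using \<phi>[OF z(1)] by (simp add: A_def algebra_simps eval_nat_numeral)
    define i where "i = inverse z"
    have iz: "i * z = 1" using z(2) by (simp add: i_def)
    have wp: "wp z = i ^ 2 + z ^ 2 * A z" by (simp add: wp_def \<phi>A i_def divide_inverse power_inverse)
    have wp'': "wp'' z = 6 * i ^ 4 + 6 * S 4 z"
      by (simp add: wp''_def i_def divide_inverse power_inverse)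
    have "E z = 6 * S 4 z - 12 * (i * z) ^ 2 * A z - 6 * z ^ 4 * A z ^ 2"
      unfolding E_def wp wp'' by (simp add: algebra_simps eval_nat_numeral)
    then show ?thesis by (simp add: iz F_def)
  qed
  have "isCont (S 4) 0" using S_properties(1)[of 0 4] zero_notin_L' by (auto intro: DERIV_isCont)
  moreover have "isCont h 0" using h r(1) isCont_holomorphic_ball by auto
  ultimately have "isCont F 0" unfolding F_def A_def by (intro continuous_intros)
  then have "(F \<longlongrightarrow> F 0) (at 0)" by (simp add: isCont_def)
  moreover have "\<forall>\<^sub>F z in at 0. z \<in> ball (0::complex) r - {0}"
    using r(1) by (intro eventually_at_in_open) auto
  then have "\<forall>\<^sub>F z in at 0. F z = E z" by eventually_elim (auto simp: EF)
  ultimately have "(E \<longlongrightarrow> F 0) (at 0)" by (rule Lim_transform_eventually)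
  note lim = this
  have hol: "E holomorphic_on - L"
    unfolding E_def by (intro holomorphic_intros wp_holomorphic wp''_holomorphic)
  have per: "E (z + u) = E z" if "u \<in> L" "z \<notin> L" for z u
    by (simp add: E_def wp_periodic wp''_periodic that)
  have "E z = F 0" by (rule elliptic_constant[OF hol per[OF L_1] per[OF L_\<tau>] lim assms])
  then show ?thesis by (simp add: E_def F_def A_def S_0 algebra_simps)
qed

end

section \<open>Lattices with \<open>g\<^sub>2 = 0\<close>\<close>

definition \<rho> :: complex where "\<rho> = Complex (- 1 / 2) (sqrt 3 / 2)"

lemma Re_\<rho> [simp]: "Re \<rho> = - 1 / 2" and Im_\<rho> [simp]: "Im \<rho> = sqrt 3 / 2"
  by (simp_all add: \<rho>_def)

lemma \<rho>_square: "\<rho> ^ 2 = - 1 - \<rho>"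
  by (simp add: \<rho>_def complex_eq_iff power2_eq_square)

lemma \<rho>_cube: "\<rho> ^ 3 = 1"
proof -
  have "\<rho> ^ 3 = \<rho> * \<rho> ^ 2" by (simp add: eval_nat_numeral)
  also have "\<dots> = - \<rho> - \<rho> ^ 2" by (subst \<rho>_square) (simp add: algebra_simps power2_eq_square)
  finally show ?thesis by (simp add: \<rho>_square)
qed

lemma \<rho>_nz: "\<rho> \<noteq> 0" using \<rho>_cube by auto

lemma \<rho>_neq_1: "\<rho> \<noteq> 1"
  by (simp add: complex_eq_iff)

context tau_lattice
begin

lemma wp_asymptotics: "((\<lambda>z. z ^ 2 * wp z) \<longlongrightarrow> 1) (at 0)"
proof -
  have "isCont \<phi> 0" using phi_deriv(1)[OF zero_notin_L'] by (rule DERIV_isCont)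
  then have "isCont (\<lambda>z. 1 + z ^ 2 * \<phi> z) 0" by (intro continuous_intros)
  then have "((\<lambda>z. 1 + z ^ 2 * \<phi> z) \<longlongrightarrow> 1) (at 0)" by (simp add: isCont_def)
  moreover have "\<forall>\<^sub>F z in at 0. 1 + z ^ 2 * \<phi> z = z ^ 2 * wp z"
    using eventually_not_L
  proof eventually_elim
    case (elim z)
    then show ?case using not_L[OF elim] by (simp add: wp_def algebra_simps)
  qed
  ultimately show ?thesis by (rule Lim_transform_eventually)
qed

text \<open>If \<open>g\<^sub>2 = 0\<close>, then \<open>\<phi>(z) = \<wp>(z) - z\<^sup>-\<^sup>2\<close> satisfies \<open>z\<^sup>2 \<phi>'' = 12 \<phi> + 6 z\<^sup>2 \<phi>\<^sup>2\<close>. The recursion for its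
  coefficients kills those whose index is not \<open>1\<close> modulo \<open>3\<close>.\<close>

lemma wp_\<rho>_near_0:
  assumes G4: "G 4 = 0"
  shows "\<exists>r>0. \<forall>z\<in>ball 0 r - {0}. wp z = \<rho> ^ 2 * wp (\<rho> * z)"
proof -
  define F where "F = fps_expansion \<phi> 0"
  have F: "\<phi> has_fps_expansion F"
    unfolding F_def using open_compl_L' zero_notin_L' phi_holomorphic
    by (intro has_fps_expansion_fps_expansion[of "- L'"]) auto
  have ode: "z ^ 2 * deriv (deriv \<phi>) z = 12 * \<phi> z + 6 * (z ^ 2 * \<phi> z ^ 2)" if z: "z \<notin> L'" for z
  proof (cases "z = 0")
    case False
    then have zL: "z \<notin> L" using z by (simp add: L'_def)
    have "deriv (deriv \<phi>) z = 6 * S 4 z"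
      using higher_deriv_phi[OF z, of 1] by (simp add: fact_numeral)
    also have "\<dots> = 6 * (1 / z ^ 2 + \<phi> z) ^ 2 - 6 / z ^ 4"
      using wp_ode2[OF zL] by (simp add: wp''_def wp_def G4 algebra_simps)
    finally have "z ^ 2 * (z ^ 2 * deriv (deriv \<phi>) z) = z ^ 2 * (12 * \<phi> z + 6 * (z ^ 2 * \<phi> z ^ 2))"
      using False by (simp add: field_simps eval_nat_numeral)
    then show ?thesis by (rule mult_left_cancel[THEN iffD1, rotated]) (use False in simp)
  qed (simp add: phi_0)
  have "\<forall>\<^sub>F z in nhds 0. z \<in> - L'"
    by (intro eventually_nhds_in_open open_compl_L') (simp add: zero_notin_L')
  then have ev: "\<forall>\<^sub>F z in nhds 0. z ^ 2 * deriv (deriv \<phi>) z = 12 * \<phi> z + 6 * (z ^ 2 * \<phi> z ^ 2)"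
    by eventually_elim (simp add: ode)
  have "(\<lambda>z. z ^ 2 * deriv (deriv \<phi>) z) has_fps_expansion fps_X ^ 2 * fps_deriv (fps_deriv F)"
    by (intro fps_expansion_intros F)
  moreover have "(\<lambda>z. 12 * \<phi> z + 6 * (z ^ 2 * \<phi> z ^ 2)) has_fps_expansion
      fps_const 12 * F + fps_const 6 * (fps_X ^ 2 * F ^ 2)"
    by (intro fps_expansion_intros F)
  ultimately have eq: "fps_X ^ 2 * fps_deriv (fps_deriv F) = fps_const 12 * F + fps_const 6 * (fps_X ^ 2 * F ^ 2)"
    using has_fps_expansion_cong[OF ev refl] fps_expansion_unique_complex by blast
  have sq: "fps_nth (F ^ 2) j = (\<Sum>i=0..j. fps_nth F i * fps_nth F (j - i))" for j
    by (simp add: power2_eq_square fps_mult_nth)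
  have "fps_nth (fps_deriv (fps_deriv F)) j = 12 * fps_nth F (j + 2) + 6 * fps_nth (F ^ 2) j" for j
    using arg_cong[OF eq, of "\<lambda>A. fps_nth A (j + 2)"] by (simp add: fps_X_power_mult_nth)
  \<comment> \<open>For the index \<open>k = j + 2\<close> the factor
    \<open>(j + 1) * (j + 2) - 12\<close> is zero only at \<open>k = 4\<close>; this free
    coefficient does no harm, as \<open>4 mod 3 = 1\<close>.\<close>
  then have rec: "of_nat ((j + 1) * (j + 2)) * fps_nth F (j + 2)
      = 12 * fps_nth F (j + 2) + 6 * (\<Sum>i=0..j. fps_nth F i * fps_nth F (j - i))" for j
    unfolding sq by (simp add: algebra_simps)
  have vanish: "k mod 3 = 1" if "fps_nth F k \<noteq> 0" for k
    using that
  proof (induction k rule: less_induct)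
    case (less k)
    have Suc: "fps_nth F (Suc i) = fact (i + 2) * G (i + 3) / fact (Suc i)" for i
      by (simp only: fps_nth_fps_expansion[OF F] deriv_phi_0)
    have G35: "G 3 = 0" "G 5 = 0" by (auto intro: G_odd)
    have "fps_nth F 0 = 0" by (simp add: fps_nth_fps_expansion[OF F] phi_0)
    moreover have "fps_nth F 1 = 0" using Suc[of 0] G35 by simp
    moreover have "fps_nth F 2 = 0" using Suc[of 1] G4 by (simp add: numeral_2_eq_2)
    moreover have "fps_nth F 3 = 0" using Suc[of 2] G35 by simp
    moreover note less.prems
    ultimately have small: "k \<noteq> 0" "k \<noteq> 1" "k \<noteq> 2" "k \<noteq> 3" by metis+
    show ?case
    proof (rule ccontr)
      assume k: "k mod 3 \<noteq> 1"
      have "k \<noteq> 4" using k by auto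
      with small have "k \<ge> 5" by linarith
      define j where "j = k - 2"
      have j: "k = j + 2" "j \<ge> 3" using \<open>k \<ge> 5\<close> by (simp_all add: j_def)
      have "fps_nth F i * fps_nth F (j - i) = 0" if "i \<le> j" for i
      proof (rule ccontr)
        assume "fps_nth F i * fps_nth F (j - i) \<noteq> 0"
        then have "i mod 3 = 1" "(j - i) mod 3 = 1" using less.IH that j by auto
        moreover have "j mod 3 = (i mod 3 + (j - i) mod 3) mod 3" using that by (simp only: mod_add_eq) simp
        ultimately have "j mod 3 = 2" by simp
        then have "k mod 3 = 1" unfolding j(1) by presburger
        with k show False by simp
      qed
      then have "(\<Sum>i=0..j. fps_nth F i * fps_nth F (j - i)) = 0" by (intro sum.neutral) auto
      then have "of_nat ((j + 1) * (j + 2)) * fps_nth F k = of_nat 12 * fps_nth F k"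
        using rec[of j] by (simp add: j)
      then have "of_nat ((j + 1) * (j + 2)) = (of_nat 12 :: complex)" using less.prems by simp
      then have "(j + 1) * (j + 2) = 12" by (simp only: of_nat_eq_iff)
      moreover have "4 * 5 \<le> (j + 1) * (j + 2)" using j by (intro mult_mono) auto
      ultimately show False by simp
    qed
  qed
  have "\<rho> ^ 2 * (\<rho> ^ k * fps_nth F k) = fps_nth F k" for k
  proof (cases "fps_nth F k = 0")
    case False
    then have "k + 2 = 3 * (k div 3 + 1)" using vanish[OF False] by presburger
    then have "\<rho> ^ (k + 2) = 1" by (simp only: power_mult \<rho>_cube power_one)
    then show ?thesis by (simp add: power_add power2_eq_square mult_ac)
  qed simp
  then have "fps_const (\<rho> ^ 2) * fps_compose F (fps_const \<rho> * fps_X) = F"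
    by (simp add: fps_eq_iff fps_compose_linear)
  moreover have "(\<phi> \<circ> (\<lambda>z. \<rho> * z)) has_fps_expansion fps_compose F (fps_const \<rho> * fps_X)"
    by (intro fps_expansion_intros F) simp
  from has_fps_expansion_cmult_left[OF this, of "\<rho> ^ 2"]
  have "(\<lambda>z. \<rho> ^ 2 * \<phi> (\<rho> * z)) has_fps_expansion fps_const (\<rho> ^ 2) * fps_compose F (fps_const \<rho> * fps_X)"
    by simp
  ultimately have "\<forall>\<^sub>F z in nhds 0. \<rho> ^ 2 * \<phi> (\<rho> * z) = \<phi> z"
    using F unfolding has_fps_expansion_def by (auto elim: eventually_elim2)
  then obtain r where r: "r > 0" "\<And>z. z \<in> ball 0 r \<Longrightarrow> \<rho> ^ 2 * \<phi> (\<rho> * z) = \<phi> z"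
    by (auto simp: eventually_nhds_metric dist_commute)
  have "wp z = \<rho> ^ 2 * wp (\<rho> * z)" if z: "z \<in> ball 0 r - {0}" for z
    using r(2)[of z] z \<rho>_nz by (simp add: wp_def power_mult_distrib distrib_left)
  then show ?thesis using r(1) by blast
qed

text \<open>Analytic continuation from the punctured disc: both sides are holomorphic off a
  countable closed set, whose complement is connected.\<close>

lemma wp_\<rho>:
  assumes G4: "G 4 = 0" and z: "z \<notin> L" "\<rho> * z \<notin> L"
  shows "wp z = \<rho> ^ 2 * wp (\<rho> * z)"
proof -
  obtain r where r: "r > 0" "\<And>z. z \<in> ball 0 r - {0} \<Longrightarrow> wp z = \<rho> ^ 2 * wp (\<rho> * z)"
    using wp_\<rho>_near_0[OF G4] by blast
  define T where "T = L \<union> (\<lambda>z. z / \<rho>) ` L"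
  have T: "x \<in> T \<longleftrightarrow> x \<in> L \<or> \<rho> * x \<in> L" for x
    using \<rho>_nz by (auto simp: T_def image_iff field_simps)
  define U where "U = - T"
  have "connected U" unfolding U_def
    using connected_open_diff_countable[of UNIV T] countable_L connected_UNIV
    by (simp add: Compl_eq_Diff_UNIV T_def)
  moreover have "open U"
  proof -
    have "U = - L \<inter> (\<lambda>z. \<rho> * z) -` (- L)" using T by (auto simp: U_def)
    then show ?thesis using open_compl_L by (auto intro!: open_Int open_vimage continuous_intros)
  qed
  moreover have "U \<inter> ball 0 r \<noteq> {}"
  proof -
    have "infinite (ball (0::complex) r)" "uncountable (ball (0::complex) r)"
      using r(1) by (auto simp: uncountable_ball uncountable_infinite)
    moreover have "countable T" by (simp add: T_def countable_L)
    ultimately show ?thesis unfolding U_def by (meson Compl_disjoint2 countable_subset disjoint_eq_subset_Compl inf.commute subset_Compl_self_eq compl_le_swap1 Compl_subset_Compl_iff double_compl)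
  qed
  moreover have "wp holomorphic_on U" using wp_holomorphic by (rule holomorphic_on_subset) (auto simp: U_def T)
  moreover have "(\<lambda>z. \<rho> ^ 2 * wp (\<rho> * z)) holomorphic_on U"
    by (intro holomorphic_intros holomorphic_on_compose_gen[of "\<lambda>z. \<rho> * z" _ wp "- L", unfolded o_def] wp_holomorphic)
      (auto simp: U_def T)
  moreover have "wp z = \<rho> ^ 2 * wp (\<rho> * z)" if "z \<in> U \<inter> ball 0 r" for z
    using that L_0 by (intro r(2)) (auto simp: U_def T)
  moreover have "z \<in> U" using z by (simp add: U_def T)
  ultimately show ?thesis
    using analytic_continuation_open[of "U \<inter> ball 0 r" U wp "\<lambda>z. \<rho> ^ 2 * wp (\<rho> * z)" z]
    by (simp add: open_Int)
qed

text \<open>Poles are detected by the limit of \<open>y ^ 2 * wp (y + w)\<close>. If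
  \<open>\<rho> * w\<close> were a lattice point but \<open>w\<close> not, the symmetry of
  \<open>wp\<close> would equate a quantity tending to \<open>0\<close> with one tending to
  \<open>1\<close>.\<close>

lemma L_\<rho>_invariant:
  assumes G4: "G 4 = 0" and x: "x \<in> L"
  shows "\<rho> * x \<in> L"
proof -
  have step: "w \<in> L" if w: "\<rho> * w \<in> L" for w
  proof (rule ccontr)
    assume nw: "w \<notin> L"
    have ev: "\<forall>\<^sub>F y in at 0. y + w \<notin> L \<and> \<rho> * y \<notin> L"
    proof -
      have "isCont (\<lambda>y. y + w) 0" by (intro continuous_intros)
      then have "((\<lambda>y. y + w) \<longlongrightarrow> w) (at 0)" by (simp add: isCont_def)
      then have "\<forall>\<^sub>F y in at 0. y + w \<in> - L"
        by (rule topological_tendstoD) (use nw open_compl_L in auto)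
      moreover have ft: "filterlim (\<lambda>y. \<rho> * y) (at 0) (at 0)"
        using \<rho>_nz by (intro filterlim_atI) (auto intro!: tendsto_eq_intros simp: eventually_at_filter)
      have "\<forall>\<^sub>F y in at 0. \<rho> * y \<notin> L"
        by (rule eventually_compose_filterlim[OF eventually_not_L ft])
      ultimately show ?thesis by eventually_elim auto
    qed
    have "isCont (\<lambda>y. y ^ 2 * wp (y + w)) 0"
      using wp_deriv[OF nw] by (intro continuous_intros isCont_o2[where g = wp and f = "\<lambda>y. y + w"])
        (auto intro: DERIV_isCont)
    then have lim0: "((\<lambda>y. y ^ 2 * wp (y + w)) \<longlongrightarrow> 0) (at 0)" by (simp add: isCont_def)
    have lim1: "((\<lambda>y. (\<rho> * y) ^ 2 * wp (\<rho> * y)) \<longlongrightarrow> 1) (at 0)"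
      using \<rho>_nz by (intro filterlim_compose[OF wp_asymptotics] filterlim_atI)
        (auto intro!: tendsto_eq_intros simp: eventually_at_filter)
    have "\<forall>\<^sub>F y in at 0. (\<rho> * y) ^ 2 * wp (\<rho> * y) = y ^ 2 * wp (y + w)"
      using ev
    proof eventually_elim
      case (elim y)
      have "wp (\<rho> * y + \<rho> * w) = wp (\<rho> * y)" using elim w by (intro wp_periodic) auto
      moreover have "\<rho> * (y + w) \<notin> L" using elim L_add_iff[OF w] by (simp add: distrib_left)
      then have "wp (y + w) = \<rho> ^ 2 * wp (\<rho> * (y + w))" using elim by (intro wp_\<rho> G4) auto
      ultimately show ?case by (simp add: distrib_left power_mult_distrib)
    qed
    from LIM_unique[OF lim0 Lim_transform_eventually[OF lim1 this]] show False by simp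
  qed
  \<comment> \<open>So far the lattice is stable under division by \<open>\<rho>\<close>; dividing
    twice amounts to multiplying by \<open>\<rho>\<close>.\<close>
  have "\<rho> * (\<rho> ^ 2 * x) = \<rho> ^ 3 * x" by (simp add: eval_nat_numeral)
  also have "\<dots> = x" by (simp add: \<rho>_cube)
  finally have 1: "\<rho> ^ 2 * x \<in> L" using x step by metis
  have "\<rho> * (\<rho> * x) = \<rho> ^ 2 * x" by (simp add: power2_eq_square)
  then show ?thesis using 1 step by metis
qed

lemma minimal_vector: "\<exists>l\<in>L'. \<forall>w\<in>L'. norm l \<le> norm w"
proof -
  define A where "A = L' \<inter> cball 0 1"
  have A: "finite A" "1 \<in> A"
    by (rule finite_subset[OF _ finite_L_ball[of 1]]) (auto simp: A_def L'_def L_1)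
  define l where "l = arg_min_on norm A"
  have l: "l \<in> A" unfolding l_def using A by (intro arg_min_if_finite(1)) auto
  have min: "norm l \<le> norm w" if "w \<in> A" for w
    unfolding l_def using A that by (intro arg_min_least) auto
  have "norm l \<le> norm w" if "w \<in> L'" for w
  proof (cases "w \<in> A")
    case False
    then have "1 < norm w" using that by (auto simp: A_def)
    then show ?thesis using min[OF A(2)] by simp
  qed (rule min)
  then show ?thesis using l by (auto simp: A_def)
qed

end

text \<open>Rounding leaves errors of at most \<open>sqrt 3 / 4\<close> and \<open>1 / 2\<close> in
  the imaginary and real parts, and \<open>3 / 16 + 1 / 4 < 1\<close>: the Eisenstein integers are
  Euclidean.\<close>

lemma eisenstein_approx: "\<exists>a b :: int. norm (x - (of_int a + of_int b * \<rho>)) < 1"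
proof -
  define b where "b = round (Im x / (sqrt 3 / 2))"
  define a where "a = round (Re x + b / 2)"
  let ?d = "x - (of_int a + of_int b * \<rho>)"
  have "\<bar>of_int b - Im x / (sqrt 3 / 2)\<bar> \<le> 1 / 2"
    unfolding b_def by (rule of_int_round_abs_le)
  then have "\<bar>of_int b - Im x / (sqrt 3 / 2)\<bar> * (sqrt 3 / 2) \<le> 1 / 2 * (sqrt 3 / 2)"
    by (rule mult_right_mono) simp
  also have "\<bar>of_int b - Im x / (sqrt 3 / 2)\<bar> * (sqrt 3 / 2) = \<bar>(of_int b - Im x / (sqrt 3 / 2)) * (sqrt 3 / 2)\<bar>"
    by (simp add: abs_mult)
  also have "(of_int b - Im x / (sqrt 3 / 2)) * (sqrt 3 / 2) = - Im ?d" by (simp add: left_diff_distrib)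
  finally have "\<bar>Im ?d\<bar> \<le> 1 / 2 * (sqrt 3 / 2)" by (simp only: abs_minus_cancel)
  then have "\<bar>Im ?d\<bar> \<le> sqrt 3 / 4" by linarith
  then have "\<bar>Im ?d\<bar> ^ 2 \<le> (sqrt 3 / 4) ^ 2" by (intro power_mono) auto
  then have im: "Im ?d ^ 2 \<le> 3 / 16" by (simp add: power_divide)
  have "\<bar>of_int a - (Re x + b / 2)\<bar> \<le> 1 / 2"
    unfolding a_def by (rule of_int_round_abs_le)
  also have "of_int a - (Re x + b / 2) = - Re ?d" by simp
  finally have "\<bar>Re ?d\<bar> \<le> 1 / 2" by (simp only: abs_minus_cancel)
  then have "\<bar>Re ?d\<bar> ^ 2 \<le> (1 / 2) ^ 2" by (intro power_mono) auto
  then have re: "Re ?d ^ 2 \<le> 1 / 4" by (simp add: power_divide)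
  have "norm ?d ^ 2 < 1 ^ 2" unfolding cmod_power2 using im re by simp
  then have "norm ?d < 1" by (rule power2_less_imp_less) simp
  then show ?thesis by blast
qed

interpretation hex: tau_lattice \<rho> by unfold_locales simp

context tau_lattice
begin

text \<open>Division with remainder by a shortest vector \<open>l\<close> shows that
  \<open>L\<close> consists of the Eisenstein multiples of \<open>l\<close>. The last conjunct
  equates the areas of the parallelograms spanned by \<open>1, \<tau>\<close> and by
  \<open>l, l * \<rho>\<close>, which fixes \<open>norm l\<close>.\<close>

lemma L_eq_hex:
  assumes G4: "G 4 = 0"
  shows "\<exists>l. l \<noteq> 0 \<and> L = (\<lambda>w. l * w) ` hex.L \<and> norm l ^ 2 * (sqrt 3 / 2) = Im \<tau>"
proof -
  obtain l where l: "l \<in> L'" "\<And>w. w \<in> L' \<Longrightarrow> norm l \<le> norm w" using minimal_vector by blast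
  have nz: "l \<noteq> 0" "l \<in> L" using l(1) by (auto simp: L'_def)
  have mult: "of_int a * w \<in> L" if w: "w \<in> L" for a w
  proof -
    obtain m n where "w = of_int m + of_int n * \<tau>" using w by (elim L_E)
    then have "of_int a * w = of_int (a * m) + of_int (a * n) * \<tau>" by (simp add: algebra_simps)
    then show ?thesis by (simp only: L_I)
  qed
  have sub: "l * (of_int a + of_int b * \<rho>) \<in> L" for a b
  proof -
    have "l * (of_int a + of_int b * \<rho>) = of_int a * l + of_int b * (\<rho> * l)" by (simp add: algebra_simps)
    then show ?thesis by (simp only: L_add mult L_\<rho>_invariant[OF G4] nz(2))
  qed
  have L: "L = (\<lambda>w. l * w) ` hex.L"
  proof (intro equalityI subsetI)
    fix w assume w: "w \<in> L"
    obtain a b :: int where ab: "norm (w / l - (of_int a + of_int b * \<rho>)) < 1"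
      using eisenstein_approx by blast
    define d where "d = w - l * (of_int a + of_int b * \<rho>)"
    have "d \<in> L" unfolding d_def by (intro L_diff w sub)
    moreover have "d = l * (w / l - (of_int a + of_int b * \<rho>))" using nz by (simp add: d_def algebra_simps)
    then have "norm d < norm l" using ab nz by (simp add: norm_mult)
    ultimately have "d = 0" using l(2)[of d] by (auto simp: L'_def)
    then have "w = l * (of_int a + of_int b * \<rho>)" by (simp add: d_def)
    then show "w \<in> (\<lambda>w. l * w) ` hex.L" using hex.L_I by blast
  next
    fix w assume "w \<in> (\<lambda>w. l * w) ` hex.L"
    then show "w \<in> L" using sub by (auto elim!: hex.L_E)
  qed
  have hexE: "\<exists>a b. x = l * (of_int a + of_int b * \<rho>)" if x: "x \<in> L" for x
    using x unfolding L by (elim imageE hex.L_E) blast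
  obtain a b where ab: "1 = l * (of_int a + of_int b * \<rho>)" using hexE[OF L_1] by blast
  obtain c d where cd: "\<tau> = l * (of_int c + of_int d * \<rho>)" using hexE[OF L_\<tau>] by blast
  obtain p q where pq: "l = of_int p + of_int q * \<tau>" using nz(2) by (elim L_E)
  obtain r s where rs: "l * \<rho> = of_int r + of_int s * \<tau>"
    using sub[of 0 1] by (elim L_E) simp
  define Z where "Z = norm l ^ 2 * (sqrt 3 / 2)"
  \<comment> \<open>\<open>Im (cnj x * y)\<close> is the oriented area spanned by \<open>x\<close>
    and \<open>y\<close>, and changes by the determinant under a change of basis.\<close>
  have Im_prod: "Im (cnj (of_int m1 + of_int n1 * z) * (of_int m2 + of_int n2 * z)) = of_int (m1 * n2 - n1 * m2) * Im z"
    for m1 n1 m2 n2 and z :: complex by (simp add: algebra_simps)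
  have Im_of_real: "Im (of_real r * z) = r * Im z" for r z by simp
  have norm_l: "cnj l * l = of_real (norm l ^ 2)" by (metis complex_norm_square mult.commute of_real_power)
  let ?A = "of_int a + of_int b * \<rho>" and ?C = "of_int c + of_int d * \<rho>"
  have "\<tau> = cnj (l * ?A) * (l * ?C)" by (simp only: ab[symmetric] cd[symmetric]) simp
  also have "\<dots> = cnj l * l * (cnj ?A * ?C)" by (simp only: complex_cnj_mult mult_ac)
  finally have "\<tau> = of_real (norm l ^ 2) * (cnj ?A * ?C)" by (simp only: norm_l)
  then have "Im \<tau> = norm l ^ 2 * (of_int (a * d - b * c) * Im \<rho>)"
    by (simp only: Im_of_real Im_prod)
  then have 1: "Im \<tau> = of_int (a * d - b * c) * Z" by (simp add: Z_def)
  have "Z = Im (cnj l * (l * \<rho>))"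
    by (simp only: mult.assoc[symmetric] norm_l Im_of_real Z_def Im_\<rho>)
  also have "\<dots> = of_int (p * s - q * r) * Im \<tau>" unfolding rs by (subst pq) (rule Im_prod)
  finally have 2: "Z = of_int (p * s - q * r) * Im \<tau>" .
  have "Z > 0" using nz by (simp add: Z_def)
  \<comment> \<open>The two integral determinants have product \<open>1\<close>; the orientation
    rules out \<open>- 1\<close>.\<close>
  have "of_int (a * d - b * c) * Z > 0" using 1 Im_pos by simp
  then have pos: "a * d - b * c > 0" using \<open>Z > 0\<close> by (simp only: zero_less_mult_iff of_int_0_less_iff) auto
  have "Z = of_int (p * s - q * r) * (of_int (a * d - b * c) * Z)" unfolding 1[symmetric] by (rule 2)
  then have "Z = of_int ((p * s - q * r) * (a * d - b * c)) * Z" by (simp only: of_int_mult mult.assoc)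
  then have "(p * s - q * r) * (a * d - b * c) = 1"
    using \<open>Z > 0\<close> by (metis mult_cancel_right1 of_int_eq_1_iff order_less_irrefl)
  then have "a * d - b * c = 1" using pos by (metis pos_zmult_eq_1_iff mult.commute)
  then have "Z = Im \<tau>" using 1 by simp
  then show ?thesis using nz L by (auto simp: Z_def)
qed

text \<open>Scaling by \<open>l\<close> divides \<open>G 6\<close> by \<open>l ^ 6\<close> and
  multiplies the area by \<open>norm l ^ 2\<close>, so the two effects cancel.\<close>

lemma G_hex:
  assumes G4: "G 4 = 0"
  shows "norm (G 6) ^ 2 * Im \<tau> ^ 6 = norm (hex.G 6) ^ 2 * (sqrt 3 / 2) ^ 6"
proof -
  obtain l where l: "l \<noteq> 0" "L = (\<lambda>w. l * w) ` hex.L" "norm l ^ 2 * (sqrt 3 / 2) = Im \<tau>"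
    using L_eq_hex[OF G4] by blast
  have L': "L' = (\<lambda>w. l * w) ` hex.L'" using l by (auto simp: L'_def hex.L'_def)
  have "G 6 = (\<Sum>\<^sub>\<infinity>w\<in>hex.L'. 1 / l ^ 6 * (1 / w ^ 6))"
    unfolding G_def L' using l(1)
    by (subst infsum_reindex) (auto simp: inj_on_def o_def power_mult_distrib)
  then have G6: "G 6 = 1 / l ^ 6 * hex.G 6" by (simp only: hex.G_def infsum_cmult_right')
  have "norm (G 6) ^ 2 * Im \<tau> ^ 6
      = (1 / norm l ^ 6 * norm (hex.G 6)) ^ 2 * (norm l ^ 2 * (sqrt 3 / 2)) ^ 6"
    by (simp only: G6 l(3)) (simp add: norm_mult norm_divide norm_power)
  also have "\<dots> = norm (hex.G 6) ^ 2 * (sqrt 3 / 2) ^ 6"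
    using l(1) by (simp add: power_mult_distrib power_divide flip: power_mult)
  finally show ?thesis .
qed

end

lemma hex_\<rho>_mult: "w \<in> hex.L \<Longrightarrow> \<rho> * w \<in> hex.L"
proof -
  assume "w \<in> hex.L"
  then obtain m n where w: "w = of_int m + of_int n * \<rho>" by (elim hex.L_E)
  have "\<rho> * w = of_int m * \<rho> + of_int n * \<rho> ^ 2" by (simp add: w algebra_simps power2_eq_square)
  also have "\<dots> = of_int (- n) + of_int (m - n) * \<rho>" by (simp add: \<rho>_square algebra_simps)
  finally show ?thesis by (simp only: hex.L_I)
qed

lemma hex_bij: "bij_betw (\<lambda>w. \<rho> * w) hex.L' hex.L'"
proof (rule bij_betwI[of _ _ _ "\<lambda>w. \<rho> ^ 2 * w"])
  have "\<rho> ^ 2 * w \<in> hex.L" if "w \<in> hex.L" for w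
    using hex_\<rho>_mult[OF hex_\<rho>_mult[OF that]] by (simp add: power2_eq_square mult.assoc)
  then show "(\<lambda>w. \<rho> ^ 2 * w) \<in> hex.L' \<rightarrow> hex.L'" using \<rho>_nz by (auto simp: hex.L'_def)
  show "(\<lambda>w. \<rho> * w) \<in> hex.L' \<rightarrow> hex.L'" using \<rho>_nz hex_\<rho>_mult by (auto simp: hex.L'_def)
  have "\<rho> ^ 2 * (\<rho> * w) = \<rho> ^ 3 * w" "\<rho> * (\<rho> ^ 2 * w) = \<rho> ^ 3 * w" for w
    by (simp_all add: eval_nat_numeral)
  then show "\<rho> ^ 2 * (\<rho> * w) = w" "\<rho> * (\<rho> ^ 2 * w) = w" for w by (simp_all add: \<rho>_cube)
qed

text \<open>Multiplication by \<open>\<rho>\<close> permutes the nonzero lattice points, so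
  \<open>G 4\<close> equals itself divided by \<open>\<rho> ^ 4 = \<rho>\<close>.\<close>

lemma hex_G4: "hex.G 4 = 0"
proof -
  have "hex.G 4 = (\<Sum>\<^sub>\<infinity>w\<in>hex.L'. 1 / (\<rho> * w) ^ 4)"
    unfolding hex.G_def by (rule infsum_reindex_bij_betw[OF hex_bij, symmetric])
  also have "\<dots> = (\<Sum>\<^sub>\<infinity>w\<in>hex.L'. 1 / \<rho> ^ 4 * (1 / w ^ 4))"
    by (simp add: power_mult_distrib)
  also have "\<dots> = 1 / \<rho> ^ 4 * hex.G 4" by (simp only: infsum_cmult_right' hex.G_def)
  also have "\<rho> ^ 4 = \<rho>"
  proof -
    have "\<rho> ^ 4 = \<rho> ^ 3 * \<rho>" by (simp add: eval_nat_numeral)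
    then show ?thesis by (simp add: \<rho>_cube)
  qed
  finally have "hex.G 4 * (\<rho> - 1) = 0" using \<rho>_nz by (simp add: field_simps)
  then show ?thesis using \<rho>_neq_1 by simp
qed

section \<open>The product formula for the discriminant\<close>

text \<open>The q-Pochhammer symbol of \<open>x\<close> with base \<open>a\<close>. With
  \<open>x\<close> as an argument, the product for the discriminant, the theta function and Euler's
  product share one set of rules.\<close>

definition qprod :: "complex \<Rightarrow> complex \<Rightarrow> complex"
  where "qprod a x = (\<Prod>n. 1 - a ^ n * x)"

lemma convergent_qprod:
  fixes a x :: complex
  assumes "norm a < 1"
  shows "convergent_prod (\<lambda>n. 1 - a ^ n * x)"
proof -
  have "summable (\<lambda>n. norm a ^ n * norm x)"
    using assms by (intro summable_mult2 summable_geometric) simp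
  then have "abs_convergent_prod (\<lambda>n. 1 - a ^ n * x)"
    by (simp add: abs_convergent_prod_conv_summable norm_mult norm_power)
  then show ?thesis by (rule abs_convergent_prod_imp_convergent_prod)
qed

lemma qprod_LIMSEQ: "norm a < 1 \<Longrightarrow> (\<lambda>N. \<Prod>n<N. 1 - a ^ n * x) \<longlonglongrightarrow> qprod a x"
  unfolding qprod_def by (intro has_prod_imp_tendsto' convergent_prod_has_prod convergent_qprod)

lemma qprod_rec:
  assumes "norm a < 1"
  shows "qprod a x = (1 - x) * qprod a (a * x)"
proof -
  have "(\<lambda>N. \<Prod>n<Suc N. 1 - a ^ n * x) \<longlonglongrightarrow> qprod a x"
    by (rule LIMSEQ_Suc[OF qprod_LIMSEQ[OF assms]])
  moreover have "(\<Prod>n<Suc N. 1 - a ^ n * x) = (1 - x) * (\<Prod>n<N. 1 - a ^ n * (a * x))" for N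
    by (simp add: prod.lessThan_Suc_shift mult_ac del: prod.lessThan_Suc)
  ultimately have "(\<lambda>N. (1 - x) * (\<Prod>n<N. 1 - a ^ n * (a * x))) \<longlonglongrightarrow> qprod a x" by simp
  moreover have "(\<lambda>N. (1 - x) * (\<Prod>n<N. 1 - a ^ n * (a * x))) \<longlonglongrightarrow> (1 - x) * qprod a (a * x)"
    by (intro tendsto_mult_left qprod_LIMSEQ assms)
  ultimately show ?thesis by (rule LIMSEQ_unique)
qed

lemma qprod_nonzero:
  assumes "norm a < 1" "\<And>n. a ^ n * x \<noteq> 1"
  shows "qprod a x \<noteq> 0"
  unfolding qprod_def using assms by (intro prodinf_nonzero convergent_qprod) auto

lemma qprod_self_nonzero:
  assumes "norm a < 1" "a \<noteq> 0"
  shows "qprod a a \<noteq> 0"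
proof (rule qprod_nonzero[OF assms(1)])
  show "a ^ n * a \<noteq> 1" for n
  proof
    assume "a ^ n * a = 1"
    then have "norm a ^ Suc n = 1" by (metis norm_one norm_power power_Suc2)
    moreover have "norm a ^ Suc n < 1" using assms by (intro power_Suc_less_one) auto
    ultimately show False by simp
  qed
qed

lemma qprod_minus:
  assumes "norm a < 1"
  shows "qprod a x * qprod a (- x) = qprod (a ^ 2) (x ^ 2)"
proof -
  have "qprod a x * qprod a (- x) = (\<Prod>n. (1 - a ^ n * x) * (1 - a ^ n * - x))"
    unfolding qprod_def by (intro prodinf_mult convergent_qprod assms)
  moreover have "(1 - a ^ n * x) * (1 - a ^ n * - x) = 1 - (a ^ 2) ^ n * x ^ 2" for n
    by (simp add: algebra_simps power_mult_distrib power2_eq_square)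
  ultimately show ?thesis by (simp only: qprod_def)
qed

lemma qprod_split:
  assumes "norm a < 1"
  shows "qprod a x = qprod (a ^ 2) x * qprod (a ^ 2) (a * x)"
proof -
  have a2: "norm (a ^ 2) < 1" using assms by (simp add: norm_power power_less_one_iff)
  have "(\<lambda>N. \<Prod>n<2 * N. 1 - a ^ n * x) \<longlonglongrightarrow> qprod a x"
    using LIMSEQ_subseq_LIMSEQ[OF qprod_LIMSEQ[OF assms], of "\<lambda>N. 2 * N"]
    by (auto simp: o_def strict_mono_def)
  moreover have "(\<Prod>n<2 * N. 1 - a ^ n * x)
      = (\<Prod>n<N. 1 - (a ^ 2) ^ n * x) * (\<Prod>n<N. 1 - (a ^ 2) ^ n * (a * x))" for N
  proof (induction N)
    case (Suc N)
    have *: "(\<Prod>n<2 * Suc N. 1 - a ^ n * x)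
        = (\<Prod>n<2 * N. 1 - a ^ n * x) * ((1 - a ^ (2 * N) * x) * (1 - a ^ (2 * N) * (a * x)))"
      by (simp add: mult.assoc mult.left_commute)
    show ?case unfolding * Suc.IH power_mult prod.lessThan_Suc by (simp only: mult_ac)
  qed simp
  ultimately have "(\<lambda>N. (\<Prod>n<N. 1 - (a ^ 2) ^ n * x) * (\<Prod>n<N. 1 - (a ^ 2) ^ n * (a * x)))
      \<longlonglongrightarrow> qprod a x" by simp
  moreover have "(\<lambda>N. (\<Prod>n<N. 1 - (a ^ 2) ^ n * x) * (\<Prod>n<N. 1 - (a ^ 2) ^ n * (a * x)))
      \<longlonglongrightarrow> qprod (a ^ 2) x * qprod (a ^ 2) (a * x)"
    by (intro tendsto_mult qprod_LIMSEQ a2)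
  ultimately show ?thesis by (rule LIMSEQ_unique)
qed

lemma qprod_holomorphic:
  assumes "norm a < 1"
  shows "qprod a holomorphic_on UNIV"
proof (rule holomorphic_uniform_sequence)
  fix x :: complex
  have uc: "uniformly_convergent_on (cball x 1) (\<lambda>N y. \<Sum>n<N. norm ((1 - a ^ n * y) - 1))"
  proof (rule Weierstrass_m_test'_ev)
    show "\<forall>\<^sub>F n in sequentially. \<forall>y\<in>cball x 1. norm (norm ((1 - a ^ n * y) - 1)) \<le> norm a ^ n * (norm x + 1)"
    proof (intro always_eventually allI ballI)
      fix n y assume "y \<in> cball x 1"
      then have "norm y \<le> norm x + 1" using norm_triangle_ineq4[of x "x - y"] by (simp add: dist_norm)
      then show "norm (norm ((1 - a ^ n * y) - 1)) \<le> norm a ^ n * (norm x + 1)"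
        by (simp add: norm_mult norm_power mult_left_mono)
    qed
    show "summable (\<lambda>n. norm a ^ n * (norm x + 1))"
      using assms by (intro summable_mult2 summable_geometric) simp
  qed
  have "uniformly_convergent_on (cball x 1) (\<lambda>N y. \<Prod>n<N. 1 - a ^ n * y)"
    by (rule uniformly_convergent_on_prod'[OF _ _ uc]) (auto intro!: continuous_intros)
  then obtain l where l: "uniform_limit (cball x 1) (\<lambda>N y. \<Prod>n<N. 1 - a ^ n * y) l sequentially"
    by (auto simp: uniformly_convergent_on_def)
  have "l y = qprod a y" if "y \<in> cball x 1" for y
    by (rule LIMSEQ_unique[OF tendsto_uniform_limitI[OF l that] qprod_LIMSEQ[OF assms]])
  then have "uniform_limit (cball x 1) (\<lambda>N y. \<Prod>n<N. 1 - a ^ n * y) (qprod a) sequentially"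
    using l by (subst uniform_limit_cong'[where g = "\<lambda>N y. \<Prod>n<N. 1 - a ^ n * y" and i = l]) auto
  then show "\<exists>d. 0 < d \<and> cball x d \<subseteq> UNIV \<and>
      uniform_limit (cball x d) (\<lambda>N y. \<Prod>n<N. 1 - a ^ n * y) (qprod a) sequentially"
    by (intro exI[of _ 1]) auto
qed (auto intro!: holomorphic_intros)

text \<open>Euler's identity \<open>\<Prod> (1 - q\<^bsup>2n-1\<^esup>) (1 + q\<^bsup>n\<^esup>) = 1\<close>.\<close>

lemma qprod_euler:
  assumes "norm a < 1" "s ^ 2 = a" "a \<noteq> 0"
  shows "qprod a s * qprod a (- s) * qprod a (- a) = 1"
proof -
  have nz: "qprod a a \<noteq> 0" using assms by (intro qprod_self_nonzero)
  have "qprod a s * qprod a (- s) * (qprod a a * qprod a (- a))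
      = qprod (a ^ 2) a * qprod (a ^ 2) (a ^ 2)"
    using qprod_minus[OF assms(1), of s] qprod_minus[OF assms(1), of a] assms(2) by simp
  also have "\<dots> = qprod a a" using qprod_split[OF assms(1), of a] by (simp add: power2_eq_square)
  finally show ?thesis using nz by (simp add: mult_ac)
qed

section \<open>Theta quotients\<close>

context tau_lattice
begin

definition e :: "complex \<Rightarrow> complex" where "e z = exp (2 * of_real pi * \<i> * z)"
definition q :: complex where "q = e \<tau>"
definition s :: complex where "s = e (\<tau> / 2)"
text \<open>Jacobi's theta function in the multiplicative variable, without its constant factor
  \<open>Q\<close>; the zeros of \<open>\<theta> (e z)\<close> are the lattice points.\<close>

definition \<theta> :: "complex \<Rightarrow> complex" where "\<theta> x = qprod q x * qprod q (q / x)"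
definition Q :: complex where "Q = qprod q q"

lemma e_add: "e (x + y) = e x * e y" by (simp add: e_def distrib_left exp_add)
lemma e_nz [simp]: "e x \<noteq> 0" by (simp add: e_def)
lemma e_minus: "e (- x) = 1 / e x" by (simp add: e_def exp_minus inverse_eq_divide)
lemma e_power: "e x ^ n = e (of_nat n * x)" by (simp add: e_def exp_of_nat_mult[symmetric] mult_ac)

lemma e_eq_1: "e z = 1 \<longleftrightarrow> z \<in> \<int>"
proof -
  have "e z = 1 \<longleftrightarrow> Im z = 0 \<and> (\<exists>n::int. Re z = of_int n)"
    unfolding e_def exp_eq_1 by (simp add: mult.commute mult.left_commute)
  then show ?thesis by (simp add: complex_is_Int_iff)
qed

lemma e_1: "e 1 = 1" by (simp add: e_eq_1)

lemma e_half: "e (1 / 2) = - 1"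
  by (simp add: e_def)

lemma s_square: "s ^ 2 = q" by (simp add: s_def q_def e_power)

lemma q_nz: "q \<noteq> 0" and s_nz: "s \<noteq> 0" by (simp_all add: q_def s_def)

lemma norm_q: "norm q < 1"
  using Im_pos by (simp add: q_def e_def)

lemma \<theta>_factor: "\<theta> x = (1 - x) * (qprod q (q * x) * qprod q (q / x))"
  using qprod_rec[OF norm_q, of x] by (simp add: \<theta>_def)

lemma \<theta>_q:
  assumes "x \<noteq> 0"
  shows "\<theta> (q * x) = - (\<theta> x / x)"
proof -
  have "\<theta> (q * x) = qprod q (q * x) * qprod q (1 / x)" using q_nz assms by (simp add: \<theta>_def)
  also have "qprod q (1 / x) = (1 - 1 / x) * qprod q (q / x)" using qprod_rec[OF norm_q, of "1 / x"] by simp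
  finally show ?thesis using assms by (simp add: \<theta>_factor field_simps)
qed

lemma \<theta>_inverse:
  assumes "x \<noteq> 0"
  shows "\<theta> (1 / x) = - (\<theta> x / x)"
  using assms by (simp add: \<theta>_factor field_simps)

lemma \<theta>_e_nz:
  assumes "z \<notin> L"
  shows "\<theta> (e z) \<noteq> 0"
proof -
  have qe: "q ^ n = e (of_nat n * \<tau>)" for n by (simp add: q_def e_power)
  have "q ^ n * e z \<noteq> 1" for n
  proof
    assume "q ^ n * e z = 1"
    then have "of_nat n * \<tau> + z \<in> \<int>" by (simp add: qe e_eq_1 flip: e_add)
    then obtain m where "of_nat n * \<tau> + z = of_int m" by (auto elim: Ints_cases)
    then have "z = of_int m + of_int (- int n) * \<tau>" by (simp add: algebra_simps)
    then show False using assms L_I by blast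
  qed
  moreover have "q ^ n * (q / e z) \<noteq> 1" for n
  proof
    assume "q ^ n * (q / e z) = 1"
    then have "e (of_nat (Suc n) * \<tau> + - z) = 1"
      unfolding e_add e_minus using qe[of "Suc n"] by (simp add: mult.commute)
    then have "of_nat (Suc n) * \<tau> + - z \<in> \<int>" by (simp only: e_eq_1)
    then obtain m where "of_nat (Suc n) * \<tau> + - z = of_int m" by (auto elim: Ints_cases)
    then have "z = of_int (- m) + of_int (int (Suc n)) * \<tau>" by (simp add: algebra_simps)
    then show False using assms L_I by blast
  qed
  ultimately show ?thesis unfolding \<theta>_def using qprod_nonzero[OF norm_q] by simp
qed

lemma Q_nz: "Q \<noteq> 0"
  unfolding Q_def by (rule qprod_self_nonzero[OF norm_q q_nz])

lemma qprod_field_differentiable: "qprod q field_differentiable at x"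
  using qprod_holomorphic[OF norm_q] by (simp add: holomorphic_on_def)

lemma holomorphic_qprod [holomorphic_intros]:
  "f holomorphic_on A \<Longrightarrow> (\<lambda>z. qprod q (f z)) holomorphic_on A"
  using holomorphic_on_compose_gen[of f A "qprod q" UNIV] qprod_holomorphic[OF norm_q] by (auto simp: o_def)

lemma holomorphic_e [holomorphic_intros]: "f holomorphic_on A \<Longrightarrow> (\<lambda>z. e (f z)) holomorphic_on A"
  unfolding e_def by (intro holomorphic_intros)

lemma isCont_qprod: "isCont (qprod q) x"
  using qprod_field_differentiable by (rule field_differentiable_imp_continuous_at)

lemma \<theta>_asymptotics: "((\<lambda>z. \<theta> (e z) / z) \<longlongrightarrow> - 2 * of_real pi * \<i> * Q ^ 2) (at 0)"
proof -
  have "(e has_field_derivative 2 * of_real pi * \<i>) (at 0)"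
    unfolding e_def[abs_def] by (auto intro!: derivative_eq_intros)
  then have "((\<lambda>z. (e z - e 0) / (z - 0)) \<longlongrightarrow> 2 * of_real pi * \<i>) (at 0)"
    by (simp only: has_field_derivative_iff)
  then have d: "((\<lambda>z. (e z - 1) / z) \<longlongrightarrow> 2 * of_real pi * \<i>) (at 0)" by (simp add: e_def)
  have ce: "isCont e 0" unfolding e_def[abs_def] by (intro continuous_intros)
  have "isCont (\<lambda>z. qprod q (q * e z) * qprod q (q / e z)) 0"
    by (intro continuous_mult isCont_o2[OF _ isCont_qprod] continuous_intros ce) simp_all
  then have "((\<lambda>z. qprod q (q * e z) * qprod q (q / e z)) \<longlongrightarrow> Q ^ 2) (at 0)"
    by (simp add: isCont_def Q_def power2_eq_square e_def)
  from tendsto_mult[OF tendsto_minus[OF d] this]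
  have "((\<lambda>z. - ((e z - 1) / z) * (qprod q (q * e z) * qprod q (q / e z)))
      \<longlongrightarrow> - (2 * of_real pi * \<i>) * Q ^ 2) (at 0)" .
  moreover have "- ((e z - 1) / z) * (qprod q (q * e z) * qprod q (q / e z)) = \<theta> (e z) / z" for z
    by (simp add: \<theta>_factor minus_divide_left)
  ultimately show ?thesis by simp
qed

text \<open>Applied with \<open>j = 0\<close> to the half period \<open>1 / 2\<close> and with
  \<open>j = 1\<close> to the other two. The factor \<open>e z ^ j\<close> compensates the
  multiplier \<open>1 / y ^ 2\<close> of the theta quotient under \<open>z + \<tau>\<close>, and the
  constant matches the double poles at \<open>0\<close>. The difference of both sides is even, hence
  has no pole left and is constant.\<close>

lemma wp_theta:
  assumes u: "u \<notin> L" and y: "y = e u" "y ^ 2 = q ^ j" and j: "j \<le> 1"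
    and z: "z \<notin> L"
  shows "wp z - wp u = - 4 * of_real pi ^ 2 * Q ^ 4 / \<theta> y ^ 2 * (e z ^ j * \<theta> (y * e z) ^ 2 / \<theta> (e z) ^ 2)"
proof -
  define F where "F = (\<lambda>z. e z ^ j * \<theta> (y * e z) ^ 2 / \<theta> (e z) ^ 2)"
  define A where "A = - 4 * of_real pi ^ 2 * Q ^ 4 / \<theta> y ^ 2"
  have \<theta>y: "\<theta> y \<noteq> 0" unfolding y(1) by (rule \<theta>_e_nz[OF u])
  have y_nz: "y \<noteq> 0" by (simp add: y(1))
  have j01: "j = 0 \<or> j = 1" using j by auto
  have Fhol: "F holomorphic_on - L"
    unfolding F_def \<theta>_def[of "y * _"] \<theta>_def[of "e _"]
    using \<theta>_e_nz y_nz by (auto intro!: holomorphic_intros simp: \<theta>_def)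
  have F1: "F (z + 1) = F z" for z by (simp add: F_def e_add e_1)
  have F\<tau>: "F (z + \<tau>) = F z" for z
  proof -
    have 1: "\<theta> (y * e (z + \<tau>)) = - (\<theta> (y * e z) / (y * e z))"
      using \<theta>_q[of "y * e z"] y_nz by (simp add: e_add mult_ac flip: q_def)
    have 2: "\<theta> (e (z + \<tau>)) = - (\<theta> (e z) / e z)"
      using \<theta>_q[of "e z"] by (simp add: e_add mult_ac flip: q_def)
    have "F (z + \<tau>) = (q ^ j / y ^ 2) * F z"
      unfolding F_def 1 2 using y_nz
      by (simp add: e_add power_mult_distrib power_divide flip: q_def)
    then show ?thesis using y_nz by (simp flip: y(2))
  qed
  have Feven: "F (- z) = F z" for z
  proof -
    define x where "x = e z"
    have x: "x \<noteq> 0" by (simp add: x_def)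
    have "\<theta> (y * e (- z)) = \<theta> (1 / (x / y))" by (simp add: e_minus x_def)
    also have "\<dots> = - (\<theta> (x / y) / (x / y))" using x y_nz by (intro \<theta>_inverse) simp
    finally have 1: "\<theta> (y * e (- z)) ^ 2 = \<theta> (x / y) ^ 2 * y ^ 2 / x ^ 2"
      by (simp add: power_divide power_mult_distrib)
    have 2: "\<theta> (e (- z)) ^ 2 = \<theta> x ^ 2 / x ^ 2"
      using \<theta>_inverse[OF x] by (simp add: e_minus x_def power_divide)
    \<comment> \<open>Since \<open>y ^ 2 = q ^ j\<close>, the points \<open>x * y\<close> and
      \<open>x / y\<close> differ by the factor \<open>q ^ j\<close>, so their theta values are
      related by at most one application of \<open>\<theta>_q\<close>.\<close>
    have 3: "\<theta> (x * y) ^ 2 = (if j = 0 then \<theta> (x / y) ^ 2 else \<theta> (x / y) ^ 2 * y ^ 2 / x ^ 2)"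
    proof (cases "j = 0")
      case True
      then have "x * y = x / y" using y(2) y_nz by (simp add: field_simps power2_eq_square)
      then show ?thesis using True by simp
    next
      case False
      then have "x * y = q * (x / y)" using y(2) y_nz j01 by (simp add: field_simps power2_eq_square)
      then have "\<theta> (x * y) = - (\<theta> (x / y) / (x / y))" using \<theta>_q[of "x / y"] x y_nz by simp
      then show ?thesis using False by (simp add: power_divide power_mult_distrib)
    qed
    have "F (- z) = (1 / x) ^ j * (\<theta> (x / y) ^ 2 * y ^ 2 / x ^ 2) / (\<theta> x ^ 2 / x ^ 2)"
      unfolding F_def 1 2 by (simp add: e_minus x_def)
    also have "\<dots> = x ^ j * \<theta> (x * y) ^ 2 / \<theta> x ^ 2"
      using j01 x y(2) y_nz unfolding 3 by (auto simp: power2_eq_square)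
    finally show ?thesis by (simp add: F_def x_def mult.commute)
  qed
  define f where "f = (\<lambda>z. A * F z - wp z)"
  have fhol: "f holomorphic_on - L" unfolding f_def by (intro holomorphic_intros Fhol wp_holomorphic)
  have lim: "((\<lambda>z. z ^ 2 * f z) \<longlongrightarrow> 0) (at 0)"
  proof -
    have ce: "isCont e 0" unfolding e_def[abs_def] by (intro continuous_intros)
    have e0: "e 0 = 1" by (simp add: e_def)
    have "isCont (\<lambda>z. e z ^ j * \<theta> (y * e z) ^ 2) 0"
      unfolding \<theta>_def using y_nz
      by (intro continuous_mult continuous_power isCont_o2[OF _ isCont_qprod] continuous_intros ce) simp_all
    then have "((\<lambda>z. e z ^ j * \<theta> (y * e z) ^ 2) \<longlongrightarrow> \<theta> y ^ 2) (at 0)" by (simp add: isCont_def e0)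
    moreover have "((\<lambda>z. (\<theta> (e z) / z) ^ 2) \<longlongrightarrow> (- 2 * of_real pi * \<i> * Q ^ 2) ^ 2) (at 0)"
      by (rule tendsto_power[OF \<theta>_asymptotics])
    ultimately have "((\<lambda>z. A * (e z ^ j * \<theta> (y * e z) ^ 2 / (\<theta> (e z) / z) ^ 2))
        \<longlongrightarrow> A * (\<theta> y ^ 2 / (- 2 * of_real pi * \<i> * Q ^ 2) ^ 2)) (at 0)"
      by (intro tendsto_mult_left tendsto_divide) (use Q_nz in auto)
    also have "A * (\<theta> y ^ 2 / (- 2 * of_real pi * \<i> * Q ^ 2) ^ 2) = 1"
      using \<theta>y Q_nz by (simp add: A_def power_mult_distrib flip: power_mult)
    finally have "((\<lambda>z. A * (e z ^ j * \<theta> (y * e z) ^ 2 / (\<theta> (e z) / z) ^ 2) - z ^ 2 * wp z) \<longlongrightarrow> 1 - 1) (at 0)"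
      by (intro tendsto_diff wp_asymptotics)
    moreover have "\<forall>\<^sub>F z in at (0::complex). z \<noteq> 0" by (simp add: eventually_at_filter)
    then have "\<forall>\<^sub>F z in at 0. A * (e z ^ j * \<theta> (y * e z) ^ 2 / (\<theta> (e z) / z) ^ 2) - z ^ 2 * wp z = z ^ 2 * f z"
      by eventually_elim (simp add: f_def F_def power_divide algebra_simps)
    ultimately show ?thesis using Lim_transform_eventually by fastforce
  qed
  obtain r where r: "r > 0" "\<And>w z. w \<in> L \<Longrightarrow> z \<in> L \<Longrightarrow> z \<in> ball w r \<Longrightarrow> z = w"
    using L_separated by blast
  have sub: "ball 0 r - {0} \<subseteq> - L" using r(2)[OF L_0] by blast
  have feven: "f (- z) = f z" for z by (simp add: f_def Feven wp_uminus)
  obtain l where l: "(f \<longlongrightarrow> l) (at 0)"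
    using even_isolated_singularity[OF holomorphic_on_subset[OF fhol sub] r(1) feven lim] by blast
  have fconst: "f x = l" if "x \<notin> L" for x
    by (rule elliptic_constant[OF fhol _ _ l that]) (simp_all add: f_def F1 F\<tau> wp_periodic_1 wp_periodic_\<tau>)
  \<comment> \<open>The constant is read off at \<open>u\<close>, where
    \<open>y * e u = q ^ j\<close> is a zero of \<open>\<theta>\<close>.\<close>
  have "\<theta> (y * e u) = 0"
  proof -
    have \<theta>1: "\<theta> 1 = 0" by (simp add: \<theta>_factor)
    then have "\<theta> q = 0" using \<theta>_q[of 1] by simp
    then show ?thesis using j01 \<theta>1 y by (auto simp: power2_eq_square)
  qed
  then have "F u = 0" by (simp add: F_def)
  then have "A * F z - wp z = - wp u" using fconst[OF u] fconst[OF z] by (simp add: f_def)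
  then have "wp z - wp u = A * F z" by (simp add: algebra_simps)
  then show ?thesis by (simp add: A_def F_def)
qed

section \<open>The discriminant from the half periods\<close>

lemma wp'_half:
  assumes "2 * u \<in> L" "u \<notin> L"
  shows "wp' u = 0"
proof -
  have "wp' (- z) = - wp' z" for z by (simp add: wp'_def S_uminus power3_eq_cube)
  moreover have "wp' (- u + 2 * u) = wp' (- u)"
    using assms L_uminus_iff by (intro wp'_periodic) auto
  ultimately show ?thesis by simp
qed

lemma half_periods:
  "1 / 2 \<notin> L" "\<tau> / 2 \<notin> L" "1 / 2 + \<tau> / 2 \<notin> L"
proof -
  show "1 / 2 \<notin> L" "\<tau> / 2 \<notin> L" by (rule half_notin_L)+
  show "1 / 2 + \<tau> / 2 \<notin> L"
  proof
    assume "1 / 2 + \<tau> / 2 \<in> L"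
    then obtain m n where mn: "1 / 2 + \<tau> / 2 = of_int m + of_int n * \<tau>" by (elim L_E)
    have "Im (1 / 2 + \<tau> / 2) = Im (of_int m + of_int n * \<tau>)" by (simp only: mn)
    then have "real_of_int (2 * n) = real_of_int 1" using Im_pos by (simp add: field_simps)
    then have "2 * n = 1" unfolding of_int_eq_iff .
    then show False by presburger
  qed
qed

text \<open>At \<open>s\<close> and \<open>- s\<close> the two factors of \<open>\<theta>\<close>
  coincide, and at \<open>- 1\<close> they do so up to a factor \<open>2\<close>; the product is
  therefore twice the square of Euler's product.\<close>

lemma \<theta>_values:
  "\<theta> (- 1) \<noteq> 0" "\<theta> s \<noteq> 0" "\<theta> (- s) \<noteq> 0" "\<theta> s * \<theta> (- s) * \<theta> (- 1) = 2"
proof -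
  show "\<theta> (- 1) \<noteq> 0" "\<theta> s \<noteq> 0" "\<theta> (- s) \<noteq> 0"
    using half_periods[THEN \<theta>_e_nz] by (simp_all add: e_half e_add flip: s_def)
  have qs: "q / s = s" "q / - s = - s" using s_square s_nz by (simp_all add: field_simps power2_eq_square)
  have s: "\<theta> s = qprod q s ^ 2" "\<theta> (- s) = qprod q (- s) ^ 2"
    unfolding \<theta>_def qs by (simp_all add: power2_eq_square)
  have "\<theta> (- 1) = 2 * qprod q (- q) ^ 2"
    using qprod_rec[OF norm_q, of "- 1"] by (simp add: \<theta>_def power2_eq_square)
  then have "\<theta> s * \<theta> (- s) * \<theta> (- 1) = 2 * (qprod q s * qprod q (- s) * qprod q (- q)) ^ 2"
    by (simp add: s power_mult_distrib)
  then show "\<theta> s * \<theta> (- s) * \<theta> (- 1) = 2"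
    using qprod_euler[OF norm_q s_square q_nz] by simp
qed

lemma modular_discriminant_eq: "modular_discriminant \<tau> = (2 * of_real pi) ^ 12 * q * Q ^ 24"
proof -
  have "(\<Prod>n. (1 - q ^ Suc n) ^ 24) = (\<Prod>n. 1 - q ^ n * q) ^ 24"
    using prodinf_power[OF convergent_qprod[OF norm_q, of q], of 24] by (simp add: mult.commute)
  then show ?thesis
    by (simp add: modular_discriminant_def Let_def Q_def qprod_def flip: e_def q_def)
qed

text \<open>Each difference is a theta quotient at a half period. In their product the theta values
  combine to the square of \<open>\<theta> s * \<theta> (- s) * \<theta> (- 1) = 2\<close>, leaving
  \<open>Q ^ 12 * s\<close> up to constants, and \<open>s ^ 2 = q\<close>.\<close>

lemma modular_discriminant_roots:
  defines "e1 \<equiv> wp (1 / 2)" and "e2 \<equiv> wp (\<tau> / 2)" and "e3 \<equiv> wp (1 / 2 + \<tau> / 2)"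
  shows "16 * ((e1 - e2) * (e1 - e3) * (e2 - e3)) ^ 2 = modular_discriminant \<tau>"
    and "e1 \<noteq> e2" "e1 \<noteq> e3" "e2 \<noteq> e3"
proof -
  let ?c = "4 * of_real pi ^ 2 * Q ^ 4"
  have y3: "- s = e (1 / 2 + \<tau> / 2)" by (simp add: e_add e_half s_def)
  have s2: "s ^ 2 = q ^ 1" "(- s) ^ 2 = q ^ 1" using s_square by simp_all
  have \<theta>q: "\<theta> (- q) = \<theta> (- 1)" using \<theta>_q[of "- 1"] by simp
  have ss: "s * s = q" using s_square by (simp add: power2_eq_square)
  have 12: "e1 - e2 = ?c * \<theta> (- s) ^ 2 / (\<theta> s ^ 2 * \<theta> (- 1) ^ 2)"
    using wp_theta[OF half_periods(2) s_def s2(1) _ half_periods(1)]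
    by (simp add: e1_def e2_def e_half)
  have 13: "e1 - e3 = ?c * \<theta> s ^ 2 / (\<theta> (- s) ^ 2 * \<theta> (- 1) ^ 2)"
    using wp_theta[OF half_periods(3) y3 s2(2) _ half_periods(1)]
    by (simp add: e1_def e3_def e_half)
  have 23: "e2 - e3 = - (?c * s * \<theta> (- 1) ^ 2 / (\<theta> (- s) ^ 2 * \<theta> s ^ 2))"
    using wp_theta[OF half_periods(3) y3 s2(2) _ half_periods(2)]
    by (simp add: e2_def e3_def ss \<theta>q mult_ac flip: s_def)
  have c: "?c \<noteq> 0" using Q_nz by simp
  show "e1 \<noteq> e2" "e1 \<noteq> e3" "e2 \<noteq> e3"
    using 12 13 23 c \<theta>_values(1-3) s_nz Q_nz by auto
  have "(e1 - e2) * (e1 - e3) * (e2 - e3)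
      = - (?c ^ 3 * s / (\<theta> s * \<theta> (- s) * \<theta> (- 1)) ^ 2)"
    unfolding 12 13 23 using \<theta>_values(1-3)
    by (simp add: field_simps power2_eq_square power3_eq_cube)
  also have "\<dots> = - (?c ^ 3 * s / 4)" by (simp only: \<theta>_values(4)) simp
  finally have "16 * ((e1 - e2) * (e1 - e3) * (e2 - e3)) ^ 2 = (?c ^ 3) ^ 2 * s ^ 2"
    by (simp add: power_mult_distrib power_divide)
  also have "\<dots> = modular_discriminant \<tau>"
    by (simp add: modular_discriminant_eq s_square power_mult_distrib flip: power_mult)
  finally show "16 * ((e1 - e2) * (e1 - e3) * (e2 - e3)) ^ 2 = modular_discriminant \<tau>" .
qed

text \<open>The discriminant of \<open>X ^ 3 - d\<close>. Distinctness gives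
  \<open>a + b + c = 0\<close> and \<open>a ^ 2 + a * b + b ^ 2 = 0\<close>, which reduce everything
  to a power of \<open>a\<close>.\<close>

lemma discriminant_cube_roots:
  fixes a b c d :: complex
  assumes "a ^ 3 = d" "b ^ 3 = d" "c ^ 3 = d" "a \<noteq> b" "a \<noteq> c" "b \<noteq> c"
  shows "((a - b) * (a - c) * (b - c)) ^ 2 = - 27 * d ^ 2"
proof -
  have "(a - b) * (a ^ 2 + a * b + b ^ 2) = 0"
    using assms(1,2) by (simp add: algebra_simps power2_eq_square power3_eq_cube)
  then have ab: "a ^ 2 + a * b + b ^ 2 = 0" using assms(4) by simp
  have "(a - c) * (a ^ 2 + a * c + c ^ 2) = 0"
    using assms(1,3) by (simp add: algebra_simps power2_eq_square power3_eq_cube)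
  then have ac: "a ^ 2 + a * c + c ^ 2 = 0" using assms(5) by simp
  have "(b - c) * (a + b + c) = (a ^ 2 + a * b + b ^ 2) - (a ^ 2 + a * c + c ^ 2)"
    by (simp add: algebra_simps power2_eq_square)
  then have "a + b + c = 0" using ab ac assms(6) by simp
  then have c: "c = - a - b" by (simp add: eq_neg_iff_add_eq_0 algebra_simps)
  have b2: "b * b = - a * a - a * b" using ab by (simp add: power2_eq_square eq_neg_iff_add_eq_0 algebra_simps)
  have "(a - b) * (a - c) * (b - c) = (a - b) * (2 * a * a + 5 * (a * b) + 2 * (b * b))"
    by (simp add: c algebra_simps)
  also have "\<dots> = (a - b) * (3 * (a * b))" by (simp add: b2 algebra_simps)
  also have "\<dots> = 3 * a * (a * b - b * b)" by (simp add: algebra_simps)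
  also have "\<dots> = 3 * a * (a * a + 2 * (a * b))" by (simp add: b2 algebra_simps)
  finally have "((a - b) * (a - c) * (b - c)) ^ 2 = 9 * a ^ 2 * (a * a + 2 * (a * b)) ^ 2"
    by (simp add: power_mult_distrib)
  also have "(a * a + 2 * (a * b)) ^ 2 = a * a * (a * a + 4 * (a * b) + 4 * (b * b))"
    by (simp add: algebra_simps power2_eq_square)
  also have "\<dots> = - 3 * a ^ 4" by (simp add: b2 algebra_simps eval_nat_numeral)
  finally have "((a - b) * (a - c) * (b - c)) ^ 2 = - 27 * (a ^ 3) ^ 2"
    by (simp add: algebra_simps eval_nat_numeral)
  then show ?thesis by (simp add: assms(1))
qed

text \<open>The three half-period values of \<open>wp\<close> are distinct cube roots of
  \<open>35 * G 6\<close>, whence \<open>529200 = 16 * 27 * 35 ^ 2\<close>. That \<open>G 6\<close>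
  is nonzero comes from the product formula.\<close>

lemma modular_discriminant_G6:
  assumes G4: "G 4 = 0"
  shows "norm (modular_discriminant \<tau>) = 529200 * norm (G 6) ^ 2"
    and "G 6 \<noteq> 0"
proof -
  have cube: "wp u ^ 3 = 35 * G 6" if "2 * u \<in> L" "u \<notin> L" for u
    using wp_ode[OF that(2)] wp'_half[OF that] G4 by simp
  have per: "2 * (1 / 2) \<in> L" "2 * (\<tau> / 2) \<in> L" "2 * (1 / 2 + \<tau> / 2) \<in> L"
    using L_1 L_\<tau> L_add[OF L_1 L_\<tau>] by (simp_all add: distrib_left)
  note r = modular_discriminant_roots
  have "modular_discriminant \<tau> = 16 * (- 27 * (35 * G 6) ^ 2)"
    unfolding r(1)[symmetric]
    by (subst discriminant_cube_roots[OF cube[OF per(1) half_periods(1)] cube[OF per(2) half_periods(2)]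
        cube[OF per(3) half_periods(3)] r(2-4)]) simp
  then have eq: "modular_discriminant \<tau> = - 529200 * G 6 ^ 2" by (simp add: power_mult_distrib)
  then show "norm (modular_discriminant \<tau>) = 529200 * norm (G 6) ^ 2"
    by (simp add: norm_mult norm_power)
  show "G 6 \<noteq> 0" using eq modular_discriminant_eq Q_nz q_nz by auto
qed

end

section \<open>The real period of the hexagonal lattice\<close>

text \<open>The substitution \<open>s = c\<^sup>3 / (c\<^sup>3 + f\<^sup>3)\<close> turns \<open>dt = - df / (2 \<surd>(f\<^sup>3 + c\<^sup>3))\<close> into a multiple of the
  Beta density \<open>s\<^bsup>-5/6\<^esup> (1 - s)\<^bsup>-2/3\<^esup> ds\<close>.\<close>

lemma ode_beta_integral:
  fixes f :: "real \<Rightarrow> real"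
  assumes c: "c > 0" and T: "T > 0"
    and deriv: "\<And>t. 0 < t \<Longrightarrow> t \<le> T \<Longrightarrow> (f has_real_derivative - 2 * sqrt (f t ^ 3 + c ^ 3)) (at t)"
    and pos: "\<And>t. 0 < t \<Longrightarrow> t < T \<Longrightarrow> f t > 0" and fT: "f T = 0"
    and lim: "((\<lambda>t. t ^ 2 * f t) \<longlongrightarrow> 1) (at_right 0)"
  shows "6 * sqrt c * T = Beta (1 / 6) (1 / 3)"
proof -
  define h :: "real \<Rightarrow> real" where "h = (\<lambda>u. u powr (1 / 6 - 1) * (1 - u) powr (1 / 3 - 1))"
  have h: "(h has_integral Beta (1 / 6) (1 / 3)) {0..1}"
    unfolding h_def by (rule has_integral_Beta_real) auto
  then have hint: "h integrable_on {0..1}" by blast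
  define I where "I = (\<lambda>x. integral {0..x} h)"
  have I_cont: "continuous_on {0..1} I"
    unfolding I_def by (rule indefinite_integral_continuous_1[OF hint])
  have I_deriv: "(I has_real_derivative h x) (at x)" if x: "0 < x" "x < 1" for x
  proof -
    have "isCont h x" unfolding h_def using x by (intro continuous_intros) auto
    then have "continuous (at x within ({0..1} - {})) h" by (simp add: continuous_at_imp_continuous_within)
    from integral_has_vector_derivative_continuous_at[OF hint _ _ this]
    have "(I has_vector_derivative h x) (at x within {0..1})" using x by (simp add: I_def)
    then have "(I has_real_derivative h x) (at x within {0..1})"
      by (simp add: has_real_derivative_iff_has_vector_derivative)
    then show ?thesis using x at_within_interior[of x "{0..1}"] by simp
  qed
  \<comment> \<open>At \<open>t = 0\<close> the quotient is replaced by its limit, as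
    \<open>f\<close> grows like \<open>1 / t ^ 2\<close> there.\<close>
  define s where "s = (\<lambda>t. if t = 0 then 0 else c ^ 3 / (c ^ 3 + f t ^ 3))"
  have f0: "f t \<ge> 0" if "0 < t" "t \<le> T" for t
    using pos[of t] fT that by (cases "t = T") auto
  have D: "c ^ 3 + f t ^ 3 > 0" if "0 < t" "t \<le> T" for t
    using c f0[OF that] by (intro add_pos_nonneg) auto
  have s01: "s t \<in> {0..1}" if "0 \<le> t" "t \<le> T" for t
    using that c f0[of t] D[of t] by (auto simp: s_def)
  have s_eq: "\<forall>\<^sub>F x in nhds t. s x = c ^ 3 / (c ^ 3 + f x ^ 3)" if "0 < t" for t
  proof -
    have "\<forall>\<^sub>F x in nhds t. x \<in> {0<..}" using that by (intro eventually_nhds_in_open) auto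
    then show ?thesis by eventually_elim (simp add: s_def)
  qed
  have s_cont: "continuous_on {0..T} s"
  proof (rule continuous_on_eq_continuous_within[THEN iffD2], rule ballI)
    fix t assume t: "t \<in> {0..T}"
    show "continuous (at t within {0..T}) s"
    proof (cases "t = 0")
      case False
      then have t0: "0 < t" "t \<le> T" using t by auto
      have "isCont f t" using deriv[OF t0] by (rule DERIV_isCont)
      then have "isCont (\<lambda>t. c ^ 3 / (c ^ 3 + f t ^ 3)) t"
        using D[OF t0] by (intro continuous_intros) auto
      then have "isCont s t" by (subst isCont_cong[OF s_eq[OF t0(1)]])
      then show ?thesis by (rule continuous_at_imp_continuous_within)
    next
      case True
      \<comment> \<open>Numerator and denominator are multiplied by \<open>t ^ 6\<close>, turning
        \<open>f t\<close> into \<open>t ^ 2 * f t\<close>, whose limit is known.\<close>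
      have "((\<lambda>t. c ^ 3 * t ^ 6 / (c ^ 3 * t ^ 6 + (t ^ 2 * f t) ^ 3)) \<longlongrightarrow> c ^ 3 * 0 ^ 6 / (c ^ 3 * 0 ^ 6 + 1 ^ 3)) (at_right 0)"
        by (intro tendsto_intros lim) auto
      then have "((\<lambda>t. c ^ 3 * t ^ 6 / (c ^ 3 * t ^ 6 + (t ^ 2 * f t) ^ 3)) \<longlongrightarrow> s 0) (at_right 0)"
        by (simp add: s_def)
      moreover have "\<forall>\<^sub>F t in at_right 0. c ^ 3 * t ^ 6 / (c ^ 3 * t ^ 6 + (t ^ 2 * f t) ^ 3) = s t"
        using eventually_at_right_less[of "0::real"]
      proof eventually_elim
        case (elim t)
        have "c ^ 3 * t ^ 6 + (t ^ 2 * f t) ^ 3 = t ^ 6 * (c ^ 3 + f t ^ 3)"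
          by (simp add: algebra_simps power_mult_distrib flip: power_mult)
        then show ?case using elim by (simp add: s_def)
      qed
      ultimately have "(s \<longlongrightarrow> s 0) (at_right 0)" by (rule Lim_transform_eventually)
      moreover have "at 0 within {0..T} = at_right 0" using T by (rule at_within_Icc_at_right)
      ultimately show ?thesis by (simp add: True continuous_within)
    qed
  qed
  \<comment> \<open>A zero derivative inside and continuity at both ends suffice, so the
    singularities of the density \<open>h\<close> at \<open>0\<close> and \<open>1\<close> do no
    harm.\<close>
  define g where "g = (\<lambda>t. I (s t) - 6 * sqrt c * t)"
  have "g T = g 0"
  proof (rule DERIV_isconst_end[OF T])
    show "continuous_on {0..T} g"
      unfolding g_def using s01
      by (intro continuous_intros continuous_on_compose2[OF I_cont s_cont]) auto
    fix t assume t: "0 < t" "t < T"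
    have ft: "f t > 0" using pos t by simp
    define d where "d = c ^ 3 + f t ^ 3"
    have d: "d > 0" using D[of t] t by (simp add: d_def)
    have st: "s t = c ^ 3 / d" "1 - s t = f t ^ 3 / d"
      using t d by (simp_all add: s_def d_def field_simps)
    have "0 < s t" using c d by (simp add: st(1))
    moreover have "0 < 1 - s t" unfolding st(2) using ft d by simp
    ultimately have "0 < s t" "0 < 1 - s t" .
    then have s1: "0 < s t" "s t < 1" by auto
    have "((\<lambda>t. c ^ 3 / (c ^ 3 + f t ^ 3)) has_real_derivative
        6 * c ^ 3 * f t ^ 2 * sqrt d / d ^ 2) (at t)"
      using d deriv[of t] t
      by (auto intro!: derivative_eq_intros simp: d_def add.commute power2_eq_square)
    then have "(s has_real_derivative 6 * c ^ 3 * f t ^ 2 * sqrt d / d ^ 2) (at t)"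
      by (subst DERIV_cong_ev[OF refl s_eq[OF t(1)] refl])
    from DERIV_chain2[OF I_deriv[OF s1] this]
    have "((\<lambda>t. I (s t)) has_real_derivative h (s t) * (6 * c ^ 3 * f t ^ 2 * sqrt d / d ^ 2)) (at t)" .
    moreover have "h (s t) * (6 * c ^ 3 * f t ^ 2 * sqrt d / d ^ 2) = 6 * sqrt c"
    proof -
      \<comment> \<open>In logarithmic coordinates the identity is linear in the exponents:
        \<open>y\<close> and \<open>z\<close> cancel and \<open>x / 2\<close> remains.\<close>
      define x where "x = ln c"
      define y where "y = ln (f t)"
      define z where "z = ln d"
      have e: "c = exp x" "f t = exp y" "d = exp z" using c ft d by (simp_all add: x_def y_def z_def)
      have sq: "sqrt (exp r) = exp (r / 2)" for r
        by (rule real_sqrt_unique) (auto simp flip: exp_double)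
      have pw: "exp r ^ k = exp (real k * r)" for r :: real and k by (simp add: exp_of_nat_mult)
      have pe: "exp r powr a = exp (r * a)" for r a :: real by (simp add: powr_def mult.commute)
      have "h (s t) = exp ((3 * x - z) * (1 / 6 - 1)) * exp ((3 * y - z) * (1 / 3 - 1))"
        unfolding h_def st(2) unfolding st(1) e pw exp_diff[symmetric] pe by simp
      moreover have "6 * c ^ 3 * f t ^ 2 * sqrt d / d ^ 2 = 6 * exp (3 * x + 2 * y + z / 2 - 2 * z)"
        unfolding e pw sq by (simp only: exp_add exp_diff) simp
      ultimately have "h (s t) * (6 * c ^ 3 * f t ^ 2 * sqrt d / d ^ 2)
          = 6 * exp ((3 * x - z) * (1 / 6 - 1) + (3 * y - z) * (1 / 3 - 1) + (3 * x + 2 * y + z / 2 - 2 * z))"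
        by (simp only: exp_add mult_ac)
      also have "(3 * x - z) * (1 / 6 - 1) + (3 * y - z) * (1 / 3 - 1) + (3 * x + 2 * y + z / 2 - 2 * z) = x / 2"
        by (simp add: field_simps)
      finally show ?thesis by (simp add: e sq)
    qed
    ultimately show "(g has_real_derivative 0) (at t)"
      unfolding g_def by (auto intro!: derivative_eq_intros)
  qed
  moreover have "s T = 1" "s 0 = 0" using T c fT by (simp_all add: s_def)
  ultimately show ?thesis using h by (simp add: g_def I_def integral_unique)
qed

lemma hex_cnj: "w \<in> hex.L \<Longrightarrow> cnj w \<in> hex.L"
proof -
  assume "w \<in> hex.L"
  then obtain m n where w: "w = of_int m + of_int n * \<rho>" by (elim hex.L_E)
  have "cnj w = of_int (m - n) + of_int (- n) * \<rho>" by (simp add: w complex_eq_iff)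
  then show ?thesis by (simp only: hex.L_I)
qed

lemma hex_cnj_bij: "bij_betw cnj hex.L' hex.L'"
  by (rule bij_betwI[of _ _ _ cnj]) (auto simp: hex.L'_def hex_cnj)

text \<open>Together with evenness this makes \<open>wp\<close> real on the imaginary axis.\<close>

lemma hex_wp_cnj: "hex.wp (cnj z) = cnj (hex.wp z)"
proof -
  have "hex.\<phi> (cnj z) = (\<Sum>\<^sub>\<infinity>w\<in>hex.L'. 1 / (cnj z - cnj w) ^ 2 - 1 / cnj w ^ 2)"
    unfolding hex.\<phi>_def by (rule infsum_reindex_bij_betw[OF hex_cnj_bij, symmetric])
  also have "\<dots> = (\<Sum>\<^sub>\<infinity>w\<in>hex.L'. cnj (1 / (z - w) ^ 2 - 1 / w ^ 2))"
    by (simp add: complex_cnj_divide)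
  also have "\<dots> = cnj (hex.\<phi> z)" by (simp only: infsum_cnj hex.\<phi>_def)
  finally show ?thesis by (simp add: hex.wp_def complex_cnj_divide)
qed

lemma hex_wp'_cnj: "hex.wp' (cnj z) = cnj (hex.wp' z)"
proof -
  have "hex.S 3 (cnj z) = (\<Sum>\<^sub>\<infinity>w\<in>hex.L'. 1 / (cnj z - cnj w) ^ 3)"
    unfolding hex.S_def by (rule infsum_reindex_bij_betw[OF hex_cnj_bij, symmetric])
  also have "\<dots> = (\<Sum>\<^sub>\<infinity>w\<in>hex.L'. cnj (1 / (z - w) ^ 3))"
    by (simp add: complex_cnj_divide)
  also have "\<dots> = cnj (hex.S 3 z)" by (simp only: infsum_cnj hex.S_def)
  finally show ?thesis by (simp add: hex.wp'_def complex_cnj_divide)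
qed

lemma hex_G_real: "cnj (hex.G k) = hex.G k"
proof -
  have "hex.G k = (\<Sum>\<^sub>\<infinity>w\<in>hex.L'. 1 / cnj w ^ k)"
    unfolding hex.G_def by (rule infsum_reindex_bij_betw[OF hex_cnj_bij, symmetric])
  also have "\<dots> = (\<Sum>\<^sub>\<infinity>w\<in>hex.L'. cnj (1 / w ^ k))" by (simp add: complex_cnj_divide)
  also have "\<dots> = cnj (hex.G k)" by (simp only: infsum_cnj hex.G_def)
  finally show ?thesis by simp
qed

lemma hex_imaginary_notin_L:
  assumes "0 < t" "t < sqrt 3 / 2"
  shows "\<i> * of_real t \<notin> hex.L" "\<i> * of_real t + 1 / 2 \<notin> hex.L"
proof -
  have *: False if mn: "\<i> * of_real t + of_real x = of_int m + of_int n * \<rho>" for x m n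
  proof -
    have "Im (\<i> * of_real t + of_real x) = Im (of_int m + of_int n * \<rho>)" by (simp only: mn)
    then have t: "t = n * (sqrt 3 / 2)" by simp
    then have "0 < real_of_int n * (sqrt 3 / 2)" "real_of_int n * (sqrt 3 / 2) < 1 * (sqrt 3 / 2)"
      using assms by simp_all
    then have "0 < real_of_int n" "real_of_int n < 1"
      by (simp_all only: zero_less_mult_iff mult_less_cancel_right) auto
    then show False by (simp only: of_int_0_less_iff of_int_less_1_iff)
  qed
  show "\<i> * of_real t \<notin> hex.L"
    using *[of 0] by (auto elim!: hex.L_E)
  show "\<i> * of_real t + 1 / 2 \<notin> hex.L"
    using *[of "1 / 2"] by (auto elim!: hex.L_E)
qed

text \<open>For \<open>f t = - wp (\<i> * t)\<close> with derivative \<open>v\<close>, the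
  differential equation reads \<open>v ^ 2 = 4 * f ^ 3 + g\<close>. The work lies in the sign of
  \<open>v\<close>, which selects the branch of the square root required by
  \<open>ode_beta_integral\<close>.\<close>

lemma hex_G6: "6 * root 6 (35 * norm (hex.G 6)) = sqrt 3 * Beta (1 / 6) (1 / 3)"
proof -
  define T :: real where "T = 1 / sqrt 3"
  have "sqrt 3 * sqrt 3 = (3 :: real)" by simp
  then have T: "0 < T" "T < sqrt 3 / 2" by (auto simp: T_def field_simps)
  define g where "g = 140 * Re (hex.G 6)"
  have G6: "140 * hex.G 6 = of_real g"
    using hex_G_real[of 6] by (simp add: complex_eq_iff g_def)
  define f where "f = (\<lambda>t. - Re (hex.wp (\<i> * of_real t)))"
  define v where "v = (\<lambda>t. Im (hex.wp' (\<i> * of_real t)))"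
  have odd: "hex.wp' (- z) = - hex.wp' z" for z by (simp add: hex.wp'_def hex.S_uminus power3_eq_cube)
  have f: "hex.wp (\<i> * of_real t) = - of_real (f t)" for t
    using hex_wp_cnj[of "\<i> * of_real t"] hex.wp_uminus[of "\<i> * of_real t"]
    by (simp add: f_def complex_eq_iff)
  have v: "hex.wp' (\<i> * of_real t) = \<i> * of_real (v t)" for t
    using hex_wp'_cnj[of "\<i> * of_real t"] odd[of "\<i> * of_real t"]
    by (simp add: v_def complex_eq_iff)
  have ode: "v t ^ 2 = 4 * f t ^ 3 + g" if "0 < t" "t < sqrt 3 / 2" for t
  proof -
    have "(\<i> * of_real (v t)) ^ 2 = 4 * (- of_real (f t)) ^ 3 - of_real g"
      using hex.wp_ode[OF hex_imaginary_notin_L(1)[OF that]] by (simp add: f v hex_G4 G6)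
    then have "- complex_of_real (v t ^ 2) = of_real (- 4 * f t ^ 3 - g)"
      by (simp add: power_mult_distrib)
    then have "complex_of_real (- (v t ^ 2)) = of_real (- 4 * f t ^ 3 - g)" by simp
    then have "- (v t ^ 2) = - 4 * f t ^ 3 - g" unfolding of_real_eq_iff .
    then show ?thesis by simp
  qed
  have fderiv: "(f has_real_derivative v t) (at t)" if "0 < t" "t < sqrt 3 / 2" for t
  proof -
    have "((\<lambda>x. \<i> * complex_of_real x) has_vector_derivative \<i>) (at t)"
      by (auto intro!: derivative_eq_intros)
    from field_vector_diff_chain_at[OF this hex.wp_deriv[OF hex_imaginary_notin_L(1)[OF that]]]
    have "((\<lambda>x. hex.wp (\<i> * of_real x)) has_vector_derivative (\<i> * hex.wp' (\<i> * of_real t))) (at t)"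
      by (simp add: o_def)
    from has_vector_derivative_minus[OF bounded_linear.has_vector_derivative[OF bounded_linear_Re this]]
    show ?thesis by (simp add: has_real_derivative_iff_has_vector_derivative f_def v_def)
  qed
  \<comment> \<open>\<open>\<i> * T\<close> is fixed by
    \<open>z \<mapsto> \<rho> * z + (1 + \<rho>)\<close>, so periodicity and the symmetry give
    \<open>wp z = \<rho> ^ 2 * wp z\<close>.\<close>
  have fT: "f T = 0"
  proof -
    define z where "z = \<i> * complex_of_real T"
    have zL: "z \<notin> hex.L" unfolding z_def using T by (rule hex_imaginary_notin_L)
    have "sqrt 3 * T = 1" "T * 3 = sqrt 3" by (simp_all add: T_def real_div_sqrt)
    then have "z = \<rho> * z + (1 + \<rho>)"
      by (simp add: z_def complex_eq_iff)
    then have \<rho>z: "\<rho> * z + (1 + \<rho>) = z" by simp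
    have per: "1 + \<rho> \<in> hex.L" using hex.L_I[of 1 1] by simp
    have \<rho>zL: "\<rho> * z \<notin> hex.L" using zL hex.L_add_iff[OF per, of "\<rho> * z"] \<rho>z by simp
    have "hex.wp z = \<rho> ^ 2 * hex.wp (\<rho> * z)" by (rule hex.wp_\<rho>[OF hex_G4 zL \<rho>zL])
    also have "hex.wp (\<rho> * z) = hex.wp z" using hex.wp_periodic[OF per \<rho>zL] \<rho>z by simp
    finally have "hex.wp z * (1 - \<rho> ^ 2) = 0" by (simp add: algebra_simps)
    moreover have "1 - \<rho> ^ 2 \<noteq> 0" by (simp add: \<rho>_square complex_eq_iff)
    ultimately show ?thesis by (simp add: f_def z_def)
  qed
  have "g \<noteq> 0" using hex.modular_discriminant_G6(2)[OF hex_G4] G6 by auto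
  \<comment> \<open>At \<open>T\<close> the differential equation reads
    \<open>g = v T ^ 2\<close>.\<close>
  moreover have "g \<ge> 0" using ode[OF T] fT by (metis add_0 mult_zero_right power_eq_0_iff zero_le_power2 zero_neq_numeral power_zero_numeral)
  ultimately have g: "g > 0" by simp
  \<comment> \<open>At a zero of \<open>v\<close> the real number \<open>wp (\<i> * t)\<close> would
    have the same cube as the real number \<open>wp (1 / 2)\<close>, hence equal it; but the theta
    quotient for \<open>1 / 2\<close> has no zero on this segment.\<close>
  have vnz: "v t \<noteq> 0" if t: "0 < t" "t < sqrt 3 / 2" for t
  proof
    assume "v t = 0"
    then have "4 * f t ^ 3 = - g" using ode[OF t] by simp
    moreover have "cnj (hex.wp (1 / 2)) = hex.wp (1 / 2)"
      using hex_wp_cnj[of "1 / 2"] by (simp add: complex_cnj_divide)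
    then obtain r where r: "hex.wp (1 / 2) = of_real r" by (metis Reals_cases Reals_cnj_iff)
    have "hex.wp' (1 / 2) = 0" using hex.half_periods(1) hex.L_1 by (intro hex.wp'_half) auto
    then have "0 = 4 * complex_of_real r ^ 3 - of_real g"
      using hex.wp_ode[OF hex.half_periods(1)] by (simp add: r hex_G4 G6)
    then have "complex_of_real (4 * r ^ 3) = of_real g" by simp
    then have "4 * r ^ 3 = g" unfolding of_real_eq_iff .
    ultimately have "r ^ 3 = (- f t) ^ 3" by simp
    then have "r = - f t" by (metis odd_numeral odd_real_root_power_cancel)
    then have eq: "hex.wp (\<i> * of_real t) - hex.wp (1 / 2) = 0" by (simp add: r f)
    have "hex.e (1 / 2) ^ 2 = hex.q ^ 0" by (simp add: hex.e_half)
    from hex.wp_theta[OF hex.half_periods(1) refl this _ hex_imaginary_notin_L(1)[OF t]]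
    have "hex.\<theta> (hex.e (1 / 2) * hex.e (\<i> * of_real t)) = 0"
      using eq hex.Q_nz hex.\<theta>_e_nz[OF hex.half_periods(1)] hex.\<theta>_e_nz[OF hex_imaginary_notin_L(1)[OF t]]
      by auto
    then show False
      using hex.\<theta>_e_nz[OF hex_imaginary_notin_L(2)[OF t]] by (simp add: hex.e_add mult.commute)
  qed
  have lim: "((\<lambda>t. t ^ 2 * f t) \<longlongrightarrow> 1) (at_right 0)"
  proof -
    have "filterlim (\<lambda>t. \<i> * complex_of_real t) (at 0) (at_right 0)"
      by (rule filterlim_atI) (auto intro!: tendsto_eq_intros simp: eventually_at_filter)
    from filterlim_compose[OF hex.wp_asymptotics this]
    have "((\<lambda>t. (\<i> * complex_of_real t) ^ 2 * hex.wp (\<i> * of_real t)) \<longlongrightarrow> 1) (at_right 0)" .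
    then have "((\<lambda>t. complex_of_real (t ^ 2 * f t)) \<longlongrightarrow> of_real 1) (at_right 0)"
      by (simp add: f power_mult_distrib)
    then show ?thesis by (simp only: tendsto_of_real_iff)
  qed
  have T': "t < sqrt 3 / 2" if "t \<le> T" for t using that T by simp
  \<comment> \<open>By the intermediate value theorem \<open>v\<close> keeps its sign. If positive,
    \<open>f\<close> would increase to \<open>f T = 0\<close> and be at most \<open>0\<close>
    before, against \<open>t ^ 2 * f t\<close> tending to \<open>1\<close>.\<close>
  have vneg: "v t < 0" if t: "0 < t" "t \<le> T" for t
  proof (rule ccontr)
    assume "\<not> v t < 0"
    then have vt: "v t > 0" using vnz[of t] t T' by force
    have vcont: "isCont v x" if "0 < x" "x \<le> T" for x
    proof -
      have "isCont hex.wp' (\<i> * of_real x)"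
        using hex.wp'_deriv[OF hex_imaginary_notin_L(1)[of x]] that T' by (auto intro: DERIV_isCont)
      then have "isCont (\<lambda>t. hex.wp' (\<i> * complex_of_real t)) x"
        by (rule isCont_o2[rotated]) (intro continuous_intros)
      then show ?thesis unfolding v_def by (rule isCont_Im)
    qed
    have vpos: "v x > 0" if x: "0 < x" "x \<le> T" for x
    proof (rule ccontr)
      assume "\<not> v x > 0"
      then have vx: "v x < 0" using vnz[of x] x T' by force
      have "\<exists>y. 0 < y \<and> y \<le> T \<and> v y = 0"
      proof (cases "x \<le> t")
        case True
        have "\<exists>y\<ge>x. y \<le> t \<and> v y = 0"
          using True vx vt x t vcont by (intro IVT) auto
        then show ?thesis using x t by (meson less_le_trans order.trans)
      next
        case False
        have "\<exists>y\<ge>t. y \<le> x \<and> v y = 0"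
          using False vx vt x t vcont by (intro IVT2) auto
        then show ?thesis using x t by (meson less_le_trans order.trans)
      qed
      then show False using vnz T' by blast
    qed
    have f_le: "f x \<le> 0" if x: "0 < x" "x < T" for x
    proof -
      have "f x < f T"
      proof (rule DERIV_pos_imp_increasing[OF x(2)])
        fix y assume "x \<le> y" "y \<le> T"
        then have "0 < y" "y \<le> T" using x by simp_all
        then show "\<exists>d. (f has_real_derivative d) (at y) \<and> 0 < d"
          using fderiv vpos T' by blast
      qed
      then show ?thesis by (simp add: fT)
    qed
    have "\<forall>\<^sub>F x in at_right 0. x ^ 2 * f x > 0"
      using lim by (rule order_tendstoD) simp
    moreover have "\<forall>\<^sub>F x in at_right 0. x \<in> {0<..<T}"
      by (rule eventually_at_right_real[OF T(1)])
    ultimately have "\<forall>\<^sub>F x in at_right (0::real). False"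
    proof eventually_elim
      case (elim x)
      then show ?case using f_le[of x] by (auto simp: zero_less_mult_iff)
    qed
    then show False by simp
  qed
  have fpos: "f t > 0" if t: "0 < t" "t < T" for t
  proof -
    have "f T < f t"
    proof (rule DERIV_neg_imp_decreasing[OF t(2)])
      fix y assume "t \<le> y" "y \<le> T"
      then have "0 < y" "y \<le> T" using t by simp_all
      then show "\<exists>d. (f has_real_derivative d) (at y) \<and> d < 0"
        using fderiv vneg T' by blast
    qed
    then show ?thesis by (simp add: fT)
  qed
  define c where "c = root 3 (g / 4)"
  have c: "c > 0" "c ^ 3 = g / 4" using g by (simp_all add: c_def)
  have vsqrt: "v t = - 2 * sqrt (f t ^ 3 + c ^ 3)" if t: "0 < t" "t \<le> T" for t
  proof -
    have "(- v t / 2) ^ 2 = v t ^ 2 / 4" by (simp add: power2_eq_square)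
    also have "\<dots> = f t ^ 3 + c ^ 3" unfolding ode[OF t(1) T'[OF t(2)]] c(2) by simp
    finally have "(- v t / 2) ^ 2 = f t ^ 3 + c ^ 3" .
    then have "sqrt (f t ^ 3 + c ^ 3) = - v t / 2" using vneg[OF t] by (intro real_sqrt_unique) auto
    then show ?thesis by simp
  qed
  have "6 * sqrt c * T = Beta (1 / 6) (1 / 3)"
  proof (rule ode_beta_integral[OF c(1) T(1) _ fpos fT lim])
    fix t assume t: "0 < t" "t \<le> T"
    show "(f has_real_derivative - 2 * sqrt (f t ^ 3 + c ^ 3)) (at t)"
      using fderiv[of t] t T' vsqrt[OF t] by simp
  qed
  then have "6 * sqrt c = sqrt 3 * Beta (1 / 6) (1 / 3)" by (simp add: T_def field_simps)
  moreover have "norm (hex.G 6) = g / 140"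
  proof -
    have "norm (140 * hex.G 6) = g" using g by (simp only: G6) simp
    then show ?thesis by (simp add: norm_mult)
  qed
  then have "35 * norm (hex.G 6) = sqrt c ^ 6"
  proof -
    have "sqrt c ^ 6 = (sqrt c ^ 2) ^ 3" by (simp flip: power_mult)
    then show ?thesis using c \<open>norm (hex.G 6) = g / 140\<close> by simp
  qed
  then have "root 6 (35 * norm (hex.G 6)) = sqrt c" using c by (simp add: real_root_power_cancel)
  ultimately show ?thesis by simp
qed

section \<open>Gamma values and the constant \<open>h_min\<close>\<close>

lemma Gamma_sixth: "Gamma (1 / 6 :: real) * Gamma (2 / 3) = 2 powr (2 / 3) * sqrt pi * Gamma (1 / 3)"
proof -
  have "z \<notin> \<int>\<^sub>\<le>\<^sub>0" if "Re z > 0" for z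
    using that by (metis Re_complex_of_real nonpos_Ints_cases not_less of_int_le_0_iff of_real_of_int_eq)
  then have "1 / 6 \<notin> (\<int>\<^sub>\<le>\<^sub>0 :: complex set)" "1 / 6 + 1 / 2 \<notin> (\<int>\<^sub>\<le>\<^sub>0 :: complex set)"
    by simp_all
  from Gamma_legendre_duplication[OF this]
  have "Gamma (complex_of_real (1 / 6)) * Gamma (complex_of_real (2 / 3)) =
      exp (of_real ((2 / 3) * ln 2)) * of_real (sqrt pi) * Gamma (complex_of_real (1 / 3))"
    by simp
  then have "complex_of_real (Gamma (1 / 6) * Gamma (2 / 3)) =
      of_real (exp ((2 / 3) * ln 2) * sqrt pi * Gamma (1 / 3))"
    by (simp only: Gamma_complex_of_real exp_of_real flip: of_real_mult)
  then show ?thesis unfolding of_real_eq_iff by (simp add: powr_def)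
qed

lemma Gamma_third: "Gamma (1 / 3 :: real) * Gamma (2 / 3) = 2 * pi / sqrt 3"
proof -
  have "Gamma (complex_of_real (1 / 3)) * Gamma (complex_of_real (2 / 3)) =
      of_real pi / sin (complex_of_real (pi / 3))"
    using Gamma_reflection_complex[of "1 / 3"] by simp
  then have "complex_of_real (Gamma (1 / 3) * Gamma (2 / 3)) = of_real (pi / sin (pi / 3))"
    by (simp only: Gamma_complex_of_real sin_of_real flip: of_real_mult of_real_divide)
  then show ?thesis unfolding of_real_eq_iff by (simp add: sin_60)
qed

text \<open>Duplication removes \<open>Gamma (1 / 6)\<close> and gives \<open>p * a ^ 2 / b\<close>
  for the Beta value; reflection expresses \<open>pi\<close> by \<open>a * b\<close>, and both sides
  become \<open>a ^ 24 / (64 * b ^ 12)\<close>.\<close>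

lemma Beta_sixth_third:
  "Beta (1 / 6) (1 / 3 :: real) ^ 12 / 2 ^ 14 = (pi * (1 / sqrt 3 * (Gamma (1 / 3) / Gamma (2 / 3)) ^ 3)) ^ 6"
proof -
  define a b p :: real where "a = Gamma (1 / 3)" and "b = Gamma (2 / 3)" and "p = 2 powr (2 / 3)"
  have ab: "a > 0" "b > 0" by (simp_all add: a_def b_def Gamma_real_pos)
  have p: "p ^ 3 = 4" by (simp add: p_def powr_power)
  have p12: "p ^ 12 = 256"
  proof -
    have "p ^ 12 = (p ^ 3) ^ 4" by (simp flip: power_mult)
    then show ?thesis by (simp add: p)
  qed
  have "Gamma (1 / 6) * b = p * sqrt pi * a" unfolding a_def b_def p_def by (rule Gamma_sixth)
  then have "Gamma (1 / 6) = p * sqrt pi * a / b" using ab by (simp add: eq_divide_eq)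
  then have "Beta (1 / 6) (1 / 3) = p * a ^ 2 / b"
    by (simp add: Beta_def Gamma_one_half_real power2_eq_square flip: a_def)
  then have B: "Beta (1 / 6) (1 / 3) ^ 12 = 256 * a ^ 24 / b ^ 12"
    by (simp add: power_mult_distrib power_divide p12 flip: power_mult)
  have "pi = a * b * (sqrt 3 / 2)"
    using Gamma_third by (simp add: a_def b_def field_simps)
  then have "(pi * (1 / sqrt 3 * (a / b) ^ 3)) ^ 6 = (a * b * (sqrt 3 / 2) * (1 / sqrt 3 * (a / b) ^ 3)) ^ 6"
    by (simp only:)
  also have "a * b * (sqrt 3 / 2) * (1 / sqrt 3 * (a / b) ^ 3) = a ^ 4 / (2 * b ^ 2)"
    using ab by (simp add: field_simps eval_nat_numeral)
  also have "(a ^ 4 / (2 * b ^ 2)) ^ 6 = a ^ 24 / (64 * b ^ 12)"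
    by (simp add: power_mult_distrib power_divide flip: power_mult)
  finally show ?thesis by (simp add: B flip: a_def b_def)
qed

context tau_lattice
begin

lemma g2_eq: "g2 \<tau> = 60 * G 4"
proof -
  have "G 4 = (\<Sum>\<^sub>\<infinity>x\<in>UNIV - {(0, 0)}. 1 / pt x ^ 4)"
    unfolding G_def L'_eq
    by (subst infsum_reindex) (auto simp: o_def intro: inj_on_subset[OF inj_pt])
  then show ?thesis by (simp add: g2_def pt_def case_prod_unfold)
qed

lemma modular_j_eq_0_iff: "modular_j \<tau> = 0 \<longleftrightarrow> G 4 = 0"
proof -
  have "modular_discriminant \<tau> \<noteq> 0" by (simp add: modular_discriminant_eq Q_nz q_nz)
  then show ?thesis by (simp add: modular_j_def g2_eq)
qed

end

text \<open>With \<open>432 = 529200 / 35 ^ 2\<close>, the constant is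
  \<open>432 * (27 / 64) * (729 / 6 ^ 12)\<close>: the powers of \<open>3\<close> cancel and
  \<open>1 / 2 ^ 14\<close> remains.\<close>

lemma modular_discriminant_j_0:
  assumes "Im \<tau> > 0" "modular_j \<tau> = 0"
  shows "norm (modular_discriminant \<tau>) * Im \<tau> ^ 6 = Beta (1 / 6) (1 / 3) ^ 12 / 2 ^ 14"
proof -
  interpret tau_lattice \<tau> by unfold_locales (rule assms)
  have G4: "G 4 = 0" using assms(2) modular_j_eq_0_iff by simp
  define r where "r = root 6 (35 * norm (hex.G 6))"
  have r6: "r ^ 6 = 35 * norm (hex.G 6)" by (simp add: r_def)
  have s3: "sqrt 3 ^ 6 = (27 :: real)" "sqrt 3 ^ 12 = (729 :: real)"
  proof -
    have "sqrt 3 ^ 6 = (sqrt 3 ^ 2) ^ 3" "sqrt 3 ^ 12 = (sqrt 3 ^ 2) ^ 6"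
      by (subst power_mult[symmetric], simp)+
    then show "sqrt 3 ^ 6 = (27 :: real)" "sqrt 3 ^ 12 = (729 :: real)" by simp_all
  qed
  have "(6 * r) ^ 12 = (sqrt 3 * Beta (1 / 6) (1 / 3)) ^ 12" unfolding r_def hex_G6 ..
  then have r12: "6 ^ 12 * r ^ 12 = 729 * Beta (1 / 6) (1 / 3) ^ 12"
    by (simp only: power_mult_distrib s3)
  have "r ^ 12 = (r ^ 6) ^ 2" by (simp flip: power_mult)
  then have "1225 * norm (hex.G 6) ^ 2 = r ^ 12" unfolding r6 by (simp add: power_mult_distrib)
  moreover have "norm (modular_discriminant \<tau>) * Im \<tau> ^ 6 = 529200 * (norm (hex.G 6) ^ 2 * (sqrt 3 / 2) ^ 6)"
    unfolding modular_discriminant_G6(1)[OF G4] G_hex[OF G4, symmetric] by simp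
  ultimately show ?thesis using r12 by (simp add: power_divide s3)
qed

text \<open>The point \<open>\<rho>\<close> witnesses that the choice in \<open>tau_of\<close> is
  not void.\<close>

lemma tau_of_0: "Im (tau_of 0) > 0" "modular_j (tau_of 0) = 0"
proof -
  have "Im \<rho> > 0 \<and> modular_j \<rho> = 0" using hex_G4 hex.modular_j_eq_0_iff by simp
  then have "Im (tau_of 0) > 0 \<and> modular_j (tau_of 0) = 0" unfolding tau_of_def by (rule someI)
  then show "Im (tau_of 0) > 0" "modular_j (tau_of 0) = 0" by simp_all
qed

theorem theorem1p3:
  fixes \<epsilon> :: real
  assumes "\<epsilon> > 0"
  shows "\<exists>K E. number_field K \<and> elliptic_curve K E \<and> j_invariant E = 0 \<and>
    h_min < faltings_height K E \<and> faltings_height K E < h_min + \<epsilon>"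
proof -
  define x :: real where "x = 1 / sqrt 3 * (Gamma (1 / 3) / Gamma (2 / 3)) ^ 3"
  have x: "x > 0" by (simp add: x_def Gamma_real_pos)
  have "ln (norm (modular_discriminant (tau_of 0)) * Im (tau_of 0) ^ 6) = ln ((pi * x) ^ 6)"
    unfolding modular_discriminant_j_0[OF tau_of_0] Beta_sixth_third x_def ..
  also have "\<dots> = 6 * (ln pi + ln x)" using x by (simp add: ln_realpow ln_mult)
  finally have "ln (norm (modular_discriminant (tau_of 0)) * Im (tau_of 0) ^ 6) = 6 * (ln pi + ln x)" .
  \<comment> \<open>The summand \<open>1 / 2 * ln pi\<close> of the height cancels the
    \<open>ln pi\<close> coming from the archimedean part, leaving
    \<open>- (1 / 2) * ln x\<close>.\<close>
  moreover have "- (6 * (ln pi + ln x)) / 12 + 1 / 2 * ln pi = h_min"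
    unfolding h_min_def x_def[symmetric] by (simp add: field_simps)
  ultimately show ?thesis using small_height[OF assms] by metis
qed

end
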